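(* Let $p$ be a prime. The following conditions are equivalent: (1) the continuum hypothesis holds: $\aleph_1=2^{\aleph_0}$; (2) the group $\sum_{\aleph_1}\mathbb{Z}_p$ admits a compact Hausdorff group topology; (3) the group $\sum_{\aleph_1}\mathbb{Z}_p$ admits a nondiscrete locally compact Hausdorff group topology; (4) the group $\prod_{\aleph_0}\mathbb{Z}_p$ admits, up to equivalence, at most four locally compact Hausdorff group topologies; (5) the group $\prod_{\aleph_0}\mathbb{Z}_p$ admits, up to equivalence, precisely four locally compact Hausdorff group topologies.
   Context: $\mathbb{Z}_p=\mathbb{Z}/p\mathbb{Z}$. For a cardinal $\mathbf{m}$, $\sum_{\mathbf{m}}\mathbb{Z}_p$ denotes the direct sum and $\prod_{\mathbf{m}}\mathbb{Z}_p$ the direct product of $\mathbf{m}$ copies of $\mathbb{Z}_p$, both regarded here as abstract Abelian groups. Two topologies on a group are equivalent if the corresponding topological spaces are homeomorphic (the homeomorphism need not be a group homomorphism). *)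

theory Defs
  imports "HOL-Analysis.Analysis" "HOL-Algebra.Product_Groups"
begin

unbundle cardinal_syntax

definition group_topology :: "('a, 'm) monoid_scheme \<Rightarrow> 'a topology \<Rightarrow> bool" where
  "group_topology G T \<longleftrightarrow>
     topspace T = carrier G \<and>
     continuous_map (prod_topology T T) T (\<lambda>(x, y). x \<otimes>\<^bsub>G\<^esub> y) \<and>
     continuous_map T T (\<lambda>x. inv\<^bsub>G\<^esub> x)"

definition LCH_group_topologies :: "('a, 'm) monoid_scheme \<Rightarrow> 'a topology set" where
  "LCH_group_topologies G =
     {T. group_topology G T \<and> locally_compact_space T \<and> Hausdorff_space T}"

text \<open>Topologies are identified when the spaces are homeomorphic; the homeomorphism
  is not required to be a homomorphism.\<close>

definition LCH_group_topology_classes :: "('a, 'm) monoid_scheme \<Rightarrow> 'a topology set set" where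
  "LCH_group_topology_classes G =
     LCH_group_topologies G //
       {(S, T). S \<in> LCH_group_topologies G \<and> T \<in> LCH_group_topologies G \<and> S homeomorphic_space T}"

text \<open>The cardinals \<open>\<aleph>\<^sub>0\<close> and \<open>\<aleph>\<^sub>1\<close> are \<^const>\<open>natLeq\<close> and \<^term>\<open>cardSuc natLeq\<close>.\<close>

definition continuum_hypothesis :: bool where
  "continuum_hypothesis \<longleftrightarrow> cardSuc natLeq =o ctwo ^c natLeq"

end

theory Submission
  imports Defs
begin

text \<open>The key is the structure of a locally compact Hausdorff group topology on a group \<open>G\<close> of prime
  exponent \<open>p\<close>. Such a group has a compact open subgroup \<open>K\<close>, so \<open>G\<close> is homeomorphic to the product of
  \<open>K\<close> with a discrete space. Bogolyubov's lemma, applied to finite subgroups and combined with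
  Tychonoff's theorem, replaces Pontryagin duality: it shows that \<open>K\<close> has small open subgroups, hence
  that continuous characters to \<open>\<int>/p\<close> separate points, and therefore that \<open>K\<close> is homeomorphic to a
  power of \<open>\<int>/p\<close>, with exponent \<open>X\<close> say. If \<open>G\<close> is not discrete then \<open>X\<close> is infinite and
  \<open>|G| \<ge> 2\<^bsup>|X|\<^esup>\<close>, which gives the continuum hypothesis if \<open>|G| = \<aleph>\<^sub>1\<close>.

  Two infinite groups of exponent \<open>p\<close> and equal cardinality are isomorphic. Hence \<open>\<Prod>\<^bsub>\<aleph>\<^sub>0\<^esub> \<int>/p\<close> can be
  topologized as the product of the Cantor set with a discrete space of cardinality \<open>1\<close>, \<open>\<aleph>\<^sub>0\<close>, \<open>\<aleph>\<^sub>1\<close> or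
  \<open>2\<^bsup>\<aleph>\<^sub>0\<^esup>\<close>. Together with the discrete topology these give five classes, the last two products
  coinciding exactly under the continuum hypothesis; in that case \<open>|G| = \<aleph>\<^sub>1 < 2\<^bsup>|X|\<^esup>\<close> for
  uncountable \<open>X\<close>, so that no other class occurs.\<close>

section \<open>Elementary abelian groups\<close>

text \<open>The exponent \<open>p\<close> does much of the work: finitely generated subgroups are
  finite, inverses are powers, and linear algebra over the field with \<open>p\<close> elements can
  be done with \<open>generate\<close> alone. The main obstacle is that homomorphisms obtained by
  algebra and choice need not be continuous. Bogolyubov's lemma helps because the number of
  characters it needs, the square of the number of translates covering the group, is the same for
  every finite subgroup; so the compact space in which the local families are glued is fixed
  beforehand. The common kernel of the glued family may still fail to be closed, but its closure has
  finite index, hence is open, and stays inside the prescribed neighbourhood. On the topological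
  side, the discrete factor is arranged to be infinite or a single point. Sums of finitely many
  copies of the Cantor set thus never have to be compared with one another, and for infinitely many
  copies their number is a topological invariant.\<close>

locale elem_abelian = comm_group G for G (structure) +
  fixes p :: nat
  assumes prime_p: "prime p"
    and exponent: "x \<in> carrier G \<Longrightarrow> x [^] p = \<one>"
begin

section \<open>Powers and generated subgroups in exponent p\<close>

lemma p_gt_1: "1 < p" and p_pos: "0 < p"
  using prime_gt_1_nat[OF prime_p] by auto

lemma carrier_Zp [simp]: "carrier (integer_mod_group p) = {0..<int p}"
  using p_pos by (simp add: carrier_integer_mod_group)

lemma l_cancel_inv: "x \<in> carrier G \<Longrightarrow> y \<in> carrier G \<Longrightarrow> x \<otimes> (inv x \<otimes> y) = y"
  by (simp flip: m_assoc)

lemma int_pow_mod_exponent: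
  assumes "x \<in> carrier G"
  shows "x [^] (k mod int p) = x [^] (k :: int)"
proof -
  have "x [^] k = x [^] (int p * (k div int p) + k mod int p)"
    by simp
  also have "\<dots> = (x [^] int p) [^] (k div int p) \<otimes> x [^] (k mod int p)"
    using assms by (simp only: int_pow_mult int_pow_pow)
  finally show ?thesis
    using assms by (simp add: int_pow_int exponent)
qed

text \<open>As \<open>p\<close> is prime, Bezout makes \<open>k\<close> invertible modulo
  \<open>p\<close>, so \<open>x\<close> is itself a power of \<open>x [^] k\<close>. In vector space
  terms, a nonzero scalar is cancelled.\<close>

lemma int_pow_mem_cancel:
  assumes M: "subgroup M G" and x: "x \<in> carrier G"
    and xk: "x [^] (k :: int) \<in> M" and k: "\<not> int p dvd k"
  shows "x \<in> M"
proof -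
  have "coprime k (int p)"
    using k prime_p by (metis coprime_commute prime_imp_coprime prime_nat_int_transfer)
  then obtain u v where uv: "u * k + v * int p = 1"
    by (metis bezout_int coprime_imp_gcd_eq_1)
  have "x = x [^] (k * u + int p * v)"
    using uv x by (simp add: mult.commute)
  also have "\<dots> = (x [^] k) [^] u \<otimes> (x [^] int p) [^] v"
    using x by (simp add: int_pow_mult int_pow_pow)
  also have "\<dots> = (x [^] k) [^] u"
    using x by (simp add: int_pow_int exponent)
  also have "\<dots> \<in> M"
    using M xk by (rule subgroup_int_pow_closed)
  finally show ?thesis .
qed

text \<open>Being a power, an inverse comes for free in any set that contains the identity and is
  closed under products. The cardinality bound for generated subgroups and the construction of a
  compact open subgroup both rely on this.\<close>

lemma inv_eq_pow:
  assumes "x \<in> carrier G" shows "inv x = x [^] (p - 1)"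
proof -
  have "x \<otimes> x [^] (p - 1) = \<one>"
    using assms exponent[OF assms] p_pos
    by (metis Suc_diff_1 nat_pow_Suc2)
  then show ?thesis
    using assms by (metis inv_equality m_comm nat_pow_closed)
qed

lemma subgroup_adjoin:
  assumes M: "subgroup M G" and g: "g \<in> carrier G"
  shows "subgroup {m \<otimes> g [^] (k :: int) |m k. m \<in> M} G" (is "subgroup ?S G")
proof
  note mc = subgroup.mem_carrier[OF M]
  show "?S \<subseteq> carrier G" using g mc by auto
  show "\<one> \<in> ?S"
    using subgroup.one_closed[OF M] g by (force intro!: exI[of _ \<one>] exI[of _ "0::int"])
  fix x assume "x \<in> ?S"
  then obtain m and k :: int where x: "m \<in> M" "x = m \<otimes> g [^] k" by auto
  show "inv x \<in> ?S"
    using x g mc subgroup.m_inv_closed[OF M]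
    by (force intro!: exI[of _ "inv m"] exI[of _ "- k"] simp: int_pow_neg inv_mult)
  fix y assume "y \<in> ?S"
  then obtain n and l :: int where y: "n \<in> M" "y = n \<otimes> g [^] l" by auto
  have "x \<otimes> y = (m \<otimes> n) \<otimes> g [^] (k + l)"
    using x y g mc by (simp add: int_pow_mult m_ac)
  then show "x \<otimes> y \<in> ?S"
    using x y subgroup.m_closed[OF M] by blast
qed

lemma generate_insert:
  assumes "X \<subseteq> carrier G" "g \<in> carrier G" "x \<in> generate G (insert g X)"
  obtains m and k :: int where "m \<in> generate G X" "0 \<le> k" "k < int p" "x = m \<otimes> g [^] k"
proof -
  let ?S = "{m \<otimes> g [^] (k :: int) |m k. m \<in> generate G X}"
  have "generate G (insert g X) \<subseteq> ?S"
  proof (rule generate_subgroup_incl)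
    show "subgroup ?S G"
      by (intro subgroup_adjoin generate_is_subgroup assms)
    have "g = \<one> \<otimes> g [^] (1 :: int)" using assms by simp
    moreover have "x = x \<otimes> g [^] (0 :: int)" if "x \<in> X" for x
      using that assms by auto
    ultimately show "insert g X \<subseteq> ?S"
      using generate.one[of G X] generate.incl[of _ X G] by blast
  qed
  then obtain m and k :: int where mk: "m \<in> generate G X" "x = m \<otimes> g [^] k"
    using assms(3) by blast
  show ?thesis
    by (rule that[of m "k mod int p"]) (use mk assms p_pos in \<open>auto simp: int_pow_mod_exponent\<close>)
qed

text \<open>Each generator multiplies the order by at most \<open>p\<close>. The topological part
  uses this local finiteness twice: finitely many translates lead to a compact open subgroup, and
  every finite set of elements lies in a finite group, where Fourier analysis applies.\<close>

lemma finite_generate: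
  assumes "finite X" "X \<subseteq> carrier G"
  shows "finite (generate G X)"
  using assms
proof (induction X)
  case empty
  then show ?case by (simp add: generate_empty)
next
  case (insert g X)
  have "generate G (insert g X) \<subseteq> (\<lambda>(m, k). m \<otimes> g [^] k) ` (generate G X \<times> {0..<int p})"
  proof
    fix x assume "x \<in> generate G (insert g X)"
    then obtain m and k :: int where "m \<in> generate G X" "0 \<le> k" "k < int p" "x = m \<otimes> g [^] k"
      using generate_insert[of X g x] insert.prems by auto
    then show "x \<in> (\<lambda>(m, k). m \<otimes> g [^] k) ` (generate G X \<times> {0..<int p})" by force
  qed
  then show ?case
    using insert by (meson finite_SigmaI finite_atLeastLessThan_int finite_imageI finite_subset insert_subset)
qed

section \<open>Homomorphisms to the group of order p\<close>

lemma hom_Zp_int_pow: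
  assumes "\<phi> \<in> hom G (integer_mod_group p)" "x \<in> carrier G"
  shows "\<phi> (x [^] (k :: int)) = (k * \<phi> x) mod int p"
proof -
  interpret h: group_hom G "integer_mod_group p" \<phi>
    using assms by (simp add: group_hom_def group_hom_axioms_def)
  show ?thesis
    using h.hom_int_pow assms by (simp add: int_pow_integer_mod_group)
qed

text \<open>A subgroup maximal among those that contain \<open>N\<close> and avoid \<open>x\<close> is a hyperplane.\<close>

lemma separating_hom:
  assumes N: "subgroup N G" and x: "x \<in> carrier G" "x \<notin> N"
  obtains \<phi> where "\<phi> \<in> hom G (integer_mod_group p)" "\<And>n. n \<in> N \<Longrightarrow> \<phi> n = 0" "\<phi> x = 1"
proof -
  define S where "S = {M. subgroup M G \<and> N \<subseteq> M \<and> x \<notin> M}"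
  have "\<exists>M\<in>S. \<forall>X\<in>S. M \<subseteq> X \<longrightarrow> X = M"
  proof (rule subset_Zorn_nonempty)
    show "S \<noteq> {}" using N x by (auto simp: S_def)
    fix C assume C: "C \<noteq> {}" "subset.chain S C"
    have sub: "subgroup M G" if "M \<in> C" for M
      using C that by (auto simp: S_def subset_chain_def)
    have "subgroup (\<Union>C) G"
    proof
      show "\<Union>C \<subseteq> carrier G" using sub subgroup.subset by blast
      show "\<one> \<in> \<Union>C" using sub C subgroup.one_closed by blast
      show "inv y \<in> \<Union>C" if "y \<in> \<Union>C" for y
        using that by (auto dest: subgroup.m_inv_closed[OF sub])
      fix y z assume "y \<in> \<Union>C" "z \<in> \<Union>C"
      then obtain M M' where M: "M \<in> C" "M' \<in> C" "y \<in> M" "z \<in> M'" by blast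
      then have "M \<subseteq> M' \<or> M' \<subseteq> M" using C by (simp add: subset_chain_def)
      then show "y \<otimes> z \<in> \<Union>C"
        using M subgroup.m_closed[OF sub] by blast
    qed
    then show "\<Union>C \<in> S" using C by (auto simp: S_def subset_chain_def)
  qed
  then obtain M where M: "subgroup M G" "N \<subseteq> M" "x \<notin> M"
    and max: "\<And>L. subgroup L G \<Longrightarrow> M \<subseteq> L \<Longrightarrow> x \<notin> L \<Longrightarrow> L = M"
  proof -
    assume a: "\<And>M. subgroup M G \<Longrightarrow> N \<subseteq> M \<Longrightarrow> x \<notin> M \<Longrightarrow>
      (\<And>L. subgroup L G \<Longrightarrow> M \<subseteq> L \<Longrightarrow> x \<notin> L \<Longrightarrow> L = M) \<Longrightarrow> thesis"
    obtain M where M: "M \<in> S" "\<forall>X\<in>S. M \<subseteq> X \<longrightarrow> X = M"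
      using \<open>\<exists>M\<in>S. \<forall>X\<in>S. M \<subseteq> X \<longrightarrow> X = M\<close> by blast
    show thesis
    proof (rule a[of M])
      show "L = M" if "subgroup L G" "M \<subseteq> L" "x \<notin> L" for L
        using M that by (auto simp: S_def)
    qed (use M in \<open>auto simp: S_def\<close>)
  qed
  note mc = subgroup.mem_carrier[OF M(1)]
  \<comment> \<open>Modulo \<open>M\<close> every \<open>g\<close> is a power of \<open>x\<close>:
    if \<open>g\<close> is not in \<open>M\<close>, then by maximality adjoining \<open>g\<close>
    catches \<open>x\<close>, say \<open>x = m \<otimes> g [^] k\<close> with \<open>k\<close>
    invertible modulo \<open>p\<close>, and inverting \<open>k\<close> expresses \<open>g\<close>
    through \<open>x\<close>. The exponent \<open>c\<close> is the future value of the homomorphism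
    at \<open>g\<close>.\<close>
  have ex: "\<exists>c. 0 \<le> c \<and> c < int p \<and> g \<otimes> x [^] (- c) \<in> M" if g: "g \<in> carrier G" for g
  proof (cases "g \<in> M")
    case True
    then show ?thesis using g p_pos by (intro exI[of _ 0]) auto
  next
    case False
    let ?L = "{m \<otimes> g [^] (k :: int) |m k. m \<in> M}"
    have "M \<subseteq> ?L" using g mc by (force intro: exI[of _ "0::int"])
    moreover have "g \<in> ?L"
      using g M subgroup.one_closed by (force intro!: exI[of _ \<one>] exI[of _ "1::int"])
    ultimately have "x \<in> ?L" using max subgroup_adjoin[OF M(1) g] False by blast
    then obtain m and k :: int where mk: "m \<in> M" "x = m \<otimes> g [^] k" by blast
    have "\<not> int p dvd k"
    proof
      assume "int p dvd k"
      then have "k mod int p = 0" by simp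
      then have "g [^] k = \<one>" using int_pow_mod_exponent[OF g, of k] by simp
      then show False using mk M mc by simp
    qed
    then have "coprime k (int p)"
      using prime_p by (metis coprime_commute prime_imp_coprime prime_nat_int_transfer)
    then obtain u v where uv: "u * k + v * int p = 1"
      by (metis bezout_int coprime_imp_gcd_eq_1)
    have "g \<otimes> x [^] (- u) = inv (m [^] u)"
    proof -
      have "g = g [^] (k * u) \<otimes> g [^] (int p * v)"
        using uv g by (simp add: mult.commute flip: int_pow_mult)
      also have "\<dots> = g [^] (k * u)"
        using g by (simp add: int_pow_int exponent flip: int_pow_pow)
      finally have gk: "g = (g [^] k) [^] u" using g by (simp add: int_pow_pow)
      have "x [^] u = m [^] u \<otimes> g"
        using mk g mc gk by (metis int_pow_closed int_pow_distrib)
      then show ?thesis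
        using g mk mc by (simp add: int_pow_neg inv_mult m_comm[of _ "inv g"] l_cancel_inv)
    qed
    then have "g \<otimes> x [^] (- u) \<in> M"
      using M mk by (simp add: subgroup_int_pow_closed subgroup.m_inv_closed)
    moreover have "x [^] (- (u mod int p)) = x [^] (- u)"
      using x by (simp add: int_pow_neg int_pow_mod_exponent)
    ultimately show ?thesis using p_pos by (intro exI[of _ "u mod int p"]) auto
  qed
  \<comment> \<open>Two admissible exponents would put a power of \<open>x\<close> with exponent
    prime to \<open>p\<close> into \<open>M\<close>, and hence \<open>x\<close> itself.\<close>
  have uniq: "c = d" if "g \<in> carrier G" "0 \<le> c" "c < int p" "0 \<le> d" "d < int p"
    "g \<otimes> x [^] (- c) \<in> M" "g \<otimes> x [^] (- d) \<in> M" for g c d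
  proof (rule ccontr)
    assume "c \<noteq> d"
    have "\<not> int p dvd (d - c)"
      using that \<open>c \<noteq> d\<close> dvd_imp_le_int[of "d - c" "int p"] by auto
    moreover have "x [^] (d - c) = (g \<otimes> x [^] (- c)) \<otimes> inv (g \<otimes> x [^] (- d))"
    proof -
      let ?a = "x [^] (- c)" and ?b = "x [^] (- d)"
      have "(g \<otimes> ?a) \<otimes> inv (g \<otimes> ?b) = (?a \<otimes> g) \<otimes> (inv g \<otimes> inv ?b)"
        using that x by (simp add: inv_mult m_comm)
      also have "\<dots> = ?a \<otimes> inv ?b"
        using that x by (simp add: m_assoc l_cancel_inv del: int_pow_neg)
      also have "\<dots> = x [^] (- c) \<otimes> x [^] d"
        using x by (simp add: int_pow_neg)
      also have "\<dots> = x [^] (d - c)"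
        using x by (simp flip: int_pow_mult)
      finally show ?thesis by simp
    qed
    ultimately have "x [^] (d - c) \<in> M"
      using that M(1) by (metis subgroup.m_closed subgroup.m_inv_closed)
    then show False
      using int_pow_mem_cancel[OF M(1) x(1)] M(3) \<open>\<not> int p dvd (d - c)\<close> by blast
  qed
  define \<phi> where "\<phi> g = (SOME c. 0 \<le> c \<and> c < int p \<and> g \<otimes> x [^] (- c) \<in> M)" for g
  have chi: "0 \<le> \<phi> g \<and> \<phi> g < int p \<and> g \<otimes> x [^] (- \<phi> g) \<in> M" if "g \<in> carrier G" for g
    unfolding \<phi>_def by (rule someI_ex) (rule ex[OF that])
  have chi_eq: "\<phi> g = c" if "g \<in> carrier G" "0 \<le> c" "c < int p" "g \<otimes> x [^] (- c) \<in> M" for g c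
    using uniq[OF that(1)] chi[OF that(1)] that by blast
  show ?thesis
  proof
    show "\<phi> n = 0" if "n \<in> N" for n
      using that M mc by (intro chi_eq) (auto simp: p_pos)
    show "\<phi> x = 1"
      using x p_gt_1 subgroup.one_closed[OF M(1)] by (intro chi_eq) (auto simp: int_pow_neg)
    show "\<phi> \<in> hom G (integer_mod_group p)"
    proof (rule homI)
      fix g assume g: "g \<in> carrier G"
      show "\<phi> g \<in> carrier (integer_mod_group p)" using chi[OF g] by simp
      fix h assume h: "h \<in> carrier G"
      have "x [^] (- ((\<phi> g + \<phi> h) mod int p)) = x [^] (- (\<phi> g + \<phi> h))"
        using x by (simp only: int_pow_neg int_pow_mod_exponent)
      also have "\<dots> = x [^] (- \<phi> g) \<otimes> x [^] (- \<phi> h)"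
        using x by (simp flip: int_pow_mult)
      finally have "(g \<otimes> h) \<otimes> x [^] (- ((\<phi> g + \<phi> h) mod int p))
          = (g \<otimes> x [^] (- \<phi> g)) \<otimes> (h \<otimes> x [^] (- \<phi> h))"
        using g h x by (simp add: m_ac)
      then have "\<phi> (g \<otimes> h) = (\<phi> g + \<phi> h) mod int p"
        using g h p_pos chi M by (intro chi_eq) (auto simp: subgroup.m_closed)
      then show "\<phi> (g \<otimes> h) = \<phi> g \<otimes>\<^bsub>integer_mod_group p\<^esub> \<phi> h" by simp
    qed
  qed
qed

section \<open>Bases and the classification by cardinality\<close>

lemma generate_finite_subset:
  assumes "x \<in> generate G X"
  shows "\<exists>F\<subseteq>X. finite F \<and> x \<in> generate G F"
  using assms
proof (induction x rule: generate.induct)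
  case one
  then show ?case by (intro exI[of _ "{}"]) (auto intro: generate.one)
next
  case (incl h)
  then show ?case by (intro exI[of _ "{h}"]) (auto intro: generate.incl)
next
  case (inv h)
  then show ?case by (intro exI[of _ "{h}"]) (auto intro: generate.inv)
next
  case (eng h1 h2)
  then obtain F1 F2 where F: "F1 \<subseteq> X" "finite F1" "h1 \<in> generate G F1"
    "F2 \<subseteq> X" "finite F2" "h2 \<in> generate G F2" by blast
  have "h1 \<in> generate G (F1 \<union> F2)" "h2 \<in> generate G (F1 \<union> F2)"
    using F mono_generate[of F1 "F1 \<union> F2"] mono_generate[of F2 "F1 \<union> F2"] by auto
  then show ?case
    using F by (intro exI[of _ "F1 \<union> F2"]) (auto intro: generate.eng)
qed

text \<open>This is linear independence over the field with \<open>p\<close> elements, phrased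
  through \<open>generate\<close> so that no vector space has to be set up.\<close>

definition independent :: "'a set \<Rightarrow> bool" where
  "independent X \<longleftrightarrow> X \<subseteq> carrier G \<and> (\<forall>x\<in>X. x \<notin> generate G (X - {x}))"

text \<open>Zorn's lemma applies because a dependence involves finitely many elements, which lie in
  one member of a chain. That a maximal independent set generates is the exchange argument.\<close>

lemma exists_basis:
  obtains X where "independent X" "generate G X = carrier G"
proof -
  have "\<exists>M\<in>Collect independent. \<forall>X\<in>Collect independent. M \<subseteq> X \<longrightarrow> X = M"
  proof (rule subset_Zorn_nonempty)
    have "independent {}" by (simp add: independent_def)
    then show "Collect independent \<noteq> {}" by blast
    fix C assume C: "C \<noteq> {}" "subset.chain (Collect independent) C"
    have "x \<notin> generate G (\<Union>C - {x})" if x: "x \<in> \<Union>C" for x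
    proof
      assume "x \<in> generate G (\<Union>C - {x})"
      then obtain F where F: "F \<subseteq> \<Union>C - {x}" "finite F" "x \<in> generate G F"
        using generate_finite_subset by blast
      obtain X where X: "X \<in> C" "insert x F \<subseteq> X"
        using finite_subset_Union_chain[of "insert x F" C "Collect independent"] F x C by auto
      then have "x \<in> generate G (X - {x})"
        using F mono_generate[of F "X - {x}"] by auto
      then show False
        using X C by (auto simp: independent_def subset_chain_def)
    qed
    moreover have "\<Union>C \<subseteq> carrier G"
      using C unfolding subset_chain_def independent_def by blast
    ultimately show "\<Union>C \<in> Collect independent"
      by (simp add: independent_def)
  qed
  then obtain X where X: "independent X"
    and max: "\<And>Y. independent Y \<Longrightarrow> X \<subseteq> Y \<Longrightarrow> Y = X"
    unfolding Bex_def Ball_def mem_Collect_eq by blast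
  have Xc: "X \<subseteq> carrier G" using X by (simp add: independent_def)
  have "y \<in> generate G X" if y: "y \<in> carrier G" for y
  proof (rule ccontr)
    assume n: "y \<notin> generate G X"
    then have "y \<notin> X" by (auto intro: generate.incl)
    \<comment> \<open>If \<open>y\<close> enters the expression of \<open>x\<close> with exponent
      \<open>k = 0\<close>, then \<open>X\<close> is already dependent; otherwise
      \<open>y [^] k\<close>, and so \<open>y\<close>, is generated by \<open>X\<close>.\<close>
    have "x \<notin> generate G (insert y (X - {x}))" if x: "x \<in> X" for x
    proof
      assume "x \<in> generate G (insert y (X - {x}))"
      moreover have "X - {x} \<subseteq> carrier G" using Xc by auto
      ultimately obtain m and k :: int where mk: "m \<in> generate G (X - {x})" "0 \<le> k" "k < int p"
        "x = m \<otimes> y [^] k"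
        using generate_insert y by metis
      have mX: "m \<in> generate G X" using mk mono_generate[of "X - {x}" X] by auto
      have mc: "m \<in> carrier G" using mX Xc generate_in_carrier by blast
      show False
      proof (cases "k = 0")
        case True
        then show False using mk mc X x by (auto simp: independent_def)
      next
        case False
        have "y [^] k = inv m \<otimes> x"
          using mk mc y by (simp add: m_assoc[symmetric])
        also have "\<dots> \<in> generate G X"
          using generate_is_subgroup[OF Xc] mX x
          by (simp add: generate.incl subgroup.m_closed subgroup.m_inv_closed)
        finally show False
          using int_pow_mem_cancel[OF generate_is_subgroup[OF Xc] y] n False mk zdvd_not_zless[of k "int p"]
          by (metis less_le)
      qed
    qed
    moreover have "insert y X - {x} = (if x = y then X else insert y (X - {x}))" if "x \<in> insert y X" for x
      using that \<open>y \<notin> X\<close> by auto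
    ultimately have "\<forall>x\<in>insert y X. x \<notin> generate G (insert y X - {x})"
      using n by (metis insertE)
    then have "independent (insert y X)"
      unfolding independent_def using Xc y by blast
    then show False using max[of "insert y X"] \<open>y \<notin> X\<close> by auto
  qed
  then show ?thesis
    using that X generate_incl[OF Xc] by blast
qed

text \<open>The coordinate \<open>\<phi> b\<close> of the isomorphism is a homomorphism separating \<open>b\<close> from the
  subgroup generated by the rest of the basis.\<close>

lemma iso_sum_group_basis:
  assumes B: "independent B" "generate G B = carrier G"
  shows "G \<cong> sum_group B (\<lambda>_. integer_mod_group p)"
proof -
  let ?Z = "integer_mod_group p"
  have Bc: "B \<subseteq> carrier G" using B by (simp add: independent_def)
  have "\<forall>b\<in>B. \<exists>\<phi>. \<phi> \<in> hom G ?Z \<and> (\<forall>n\<in>generate G (B - {b}). \<phi> n = 0) \<and> \<phi> b = 1"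
  proof
    fix b assume b: "b \<in> B"
    have "subgroup (generate G (B - {b})) G" using Bc by (intro generate_is_subgroup) auto
    then obtain \<phi> where "\<phi> \<in> hom G ?Z" "\<And>n. n \<in> generate G (B - {b}) \<Longrightarrow> \<phi> n = 0" "\<phi> b = 1"
      using separating_hom[of "generate G (B - {b})" b] B b Bc unfolding independent_def by blast
    then show "\<exists>\<phi>. \<phi> \<in> hom G ?Z \<and> (\<forall>n\<in>generate G (B - {b}). \<phi> n = 0) \<and> \<phi> b = 1" by blast
  qed
  then obtain \<phi> where \<phi>: "\<And>b. b \<in> B \<Longrightarrow> \<phi> b \<in> hom G ?Z"
    "\<And>b n. b \<in> B \<Longrightarrow> n \<in> generate G (B - {b}) \<Longrightarrow> \<phi> b n = 0"
    "\<And>b. b \<in> B \<Longrightarrow> \<phi> b b = 1" by metis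
  have \<phi>_other: "\<phi> b c = 0" if "b \<in> B" "c \<in> B" "b \<noteq> c" for b c
    using that \<phi>(2)[of b c] by (auto intro: generate.incl)
  have \<phi>_mult: "\<phi> b (x \<otimes> y) = (\<phi> b x + \<phi> b y) mod int p"
    if "b \<in> B" "x \<in> carrier G" "y \<in> carrier G" for b x y
    using hom_mult[OF \<phi>(1)] that by simp
  have \<phi>_range: "\<phi> b x \<in> {0..<int p}" if "b \<in> B" "x \<in> carrier G" for b x
    using hom_in_carrier[OF \<phi>(1)] that by simp
  have \<phi>_one: "\<phi> b \<one> = 0" if "b \<in> B" for b
    using hom_one[OF \<phi>(1)[OF that]] by simp
  have \<phi>_inv: "\<phi> b (inv x) = (- \<phi> b x) mod int p" if "b \<in> B" "x \<in> carrier G" for b x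
    using hom_Zp_int_pow[OF \<phi>(1), of b x "-1"] that by (simp add: int_pow_neg)
  have fin: "finite {b \<in> B. \<phi> b g \<noteq> 0}" if "g \<in> generate G B" for g
    using that
  proof (induction g rule: generate.induct)
    case one
    then show ?case using \<phi>_one by (simp cong: conj_cong)
  next
    case (incl h)
    then have "{b \<in> B. \<phi> b h \<noteq> 0} \<subseteq> {h}" using \<phi>_other by blast
    then show ?case by (rule finite_subset) simp
  next
    case (inv h)
    have "\<phi> b (inv h) = 0" if "b \<in> B" "b \<noteq> h" for b
      using that inv Bc by (simp add: \<phi>_inv \<phi>_other subsetD)
    then have "{b \<in> B. \<phi> b (inv h) \<noteq> 0} \<subseteq> {h}" by blast
    then show ?case by (rule finite_subset) simp
  next
    case (eng h1 h2)
    have "\<phi> b (h1 \<otimes> h2) = (\<phi> b h1 + \<phi> b h2) mod int p" if "b \<in> B" for b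
      using \<phi>_mult[OF that] eng B(2) by simp
    then have "{b \<in> B. \<phi> b (h1 \<otimes> h2) \<noteq> 0} \<subseteq> {b \<in> B. \<phi> b h1 \<noteq> 0} \<union> {b \<in> B. \<phi> b h2 \<noteq> 0}"
      by auto
    then show ?case using eng by (meson finite_UnI finite_subset)
  qed
  \<comment> \<open>In \<open>g = m \<otimes> x [^] k\<close> with \<open>m\<close> generated by
    \<open>F\<close>, the coordinate at \<open>x\<close> reads off \<open>k\<close>. It vanishes, so
    \<open>g\<close> already lies in the smaller span.\<close>
  have inj: "g = \<one>" if "finite F" "F \<subseteq> B" "g \<in> generate G F" "\<And>b. b \<in> F \<Longrightarrow> \<phi> b g = 0" for g F
    using that
  proof (induction F arbitrary: g)
    case empty
    then show ?case by (simp add: generate_empty)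
  next
    case (insert x F)
    have Fc: "F \<subseteq> carrier G" "x \<in> carrier G" using insert.prems Bc by auto
    obtain m and k :: int where mk: "m \<in> generate G F" "0 \<le> k" "k < int p" "g = m \<otimes> x [^] k"
      using generate_insert[OF Fc insert.prems(2)] by metis
    have mc: "m \<in> carrier G" using mk Fc generate_in_carrier by blast
    have "F \<subseteq> B - {x}" using insert by auto
    then have "\<phi> x m = 0" using \<phi>(2)[of x m] mk mono_generate[of F "B - {x}"] insert.prems by auto
    then have "\<phi> x g = k"
      using mk mc Fc insert.prems by (simp add: \<phi>_mult hom_Zp_int_pow \<phi>(1,3))
    then have "g = m" using insert.prems mk mc by simp
    then show ?case using insert mk by auto
  qed
  \<comment> \<open>Multiplying by a power of the basis element \<open>x\<close> changes the
    coordinate at \<open>x\<close> only, so prescribed values are reached one basis element at a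
    time.\<close>
  have surj: "\<exists>g\<in>carrier G. \<forall>b\<in>B. \<phi> b g = (if b \<in> F then t b mod int p else 0)"
    if "finite F" "F \<subseteq> B" for F and t :: "'a \<Rightarrow> int"
    using that
  proof (induction F)
    case empty
    then show ?case using \<phi>_one by (intro bexI[of _ \<one>]) auto
  next
    case (insert x F)
    then obtain g where g: "g \<in> carrier G" "\<forall>b\<in>B. \<phi> b g = (if b \<in> F then t b mod int p else 0)" by auto
    have xc: "x \<in> carrier G" using insert.prems Bc by auto
    have "\<phi> b (g \<otimes> x [^] t x) = (if b \<in> insert x F then t b mod int p else 0)" if "b \<in> B" for b
      using that g xc insert \<phi>_other[of b x]
      by (cases "b = x") (auto simp: \<phi>_mult hom_Zp_int_pow \<phi>(1,3))
    then show ?case using g xc by (intro bexI[of _ "g \<otimes> x [^] t x"]) auto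
  qed
  define \<Phi> where "\<Phi> g = (\<lambda>b\<in>B. \<phi> b g)" for g
  have carr: "carrier (sum_group B (\<lambda>_. ?Z)) = {x \<in> \<Pi>\<^sub>E i\<in>B. {0..<int p}. finite {i \<in> B. x i \<noteq> 0}}"
    by (simp add: carrier_sum_group)
  have hom: "\<Phi> \<in> hom G (sum_group B (\<lambda>_. ?Z))"
  proof (rule homI)
    fix x assume x: "x \<in> carrier G"
    have "{b \<in> B. \<Phi> x b \<noteq> 0} = {b \<in> B. \<phi> b x \<noteq> 0}" by (auto simp: \<Phi>_def)
    then show "\<Phi> x \<in> carrier (sum_group B (\<lambda>_. ?Z))"
      unfolding carr using x fin[of x] \<phi>_range B(2) by (auto simp: \<Phi>_def)
    fix y assume y: "y \<in> carrier G"
    show "\<Phi> (x \<otimes> y) = \<Phi> x \<otimes>\<^bsub>sum_group B (\<lambda>_. ?Z)\<^esub> \<Phi> y"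
      using x y by (auto simp: \<Phi>_def \<phi>_mult fun_eq_iff)
  qed
  interpret h: group_hom G "sum_group B (\<lambda>_. ?Z)" \<Phi>
    using hom by (simp add: group_hom_def group_hom_axioms_def)
  have "\<Phi> \<in> iso G (sum_group B (\<lambda>_. ?Z))"
  proof (rule h.iso_iff[THEN iffD2], intro conjI ballI impI)
    show "carrier (sum_group B (\<lambda>_. ?Z)) \<subseteq> \<Phi> ` carrier G"
      proof
        fix t assume t: "t \<in> carrier (sum_group B (\<lambda>_. ?Z))"
        then obtain g where g: "g \<in> carrier G"
          "\<forall>b\<in>B. \<phi> b g = (if b \<in> {i \<in> B. t i \<noteq> 0} then t b mod int p else 0)"
          using surj[of "{i \<in> B. t i \<noteq> 0}" t] by (auto simp: carr)
        have "t = \<Phi> g"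
          using g t by (auto simp: \<Phi>_def carr PiE_iff extensional_def fun_eq_iff)
        then show "t \<in> \<Phi> ` carrier G" using g by blast
      qed
    fix x assume x: "x \<in> carrier G" "\<Phi> x = \<one>\<^bsub>sum_group B (\<lambda>_. ?Z)\<^esub>"
    obtain F where F: "F \<subseteq> B" "finite F" "x \<in> generate G F"
      using generate_finite_subset[of x B] x(1) B(2) by blast
    have "\<phi> b x = 0" if "b \<in> B" for b
      using fun_cong[OF x(2), of b] that by (simp add: \<Phi>_def)
    then show "x = \<one>" using inj F by blast
  qed
  then show ?thesis by (auto simp: is_iso_def)
qed

text \<open>\<open>T n\<close> consists of the products of \<open>2 ^ n\<close> factors from
  \<open>insert \<one> B\<close>. Squaring does not enlarge an infinite cardinal, so each
  \<open>T n\<close> is at most as large as \<open>B\<close>, and so is their countable union.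
  Inverses are covered because they are powers.\<close>

lemma card_of_generate_infinite:
  assumes B: "infinite B" "B \<subseteq> carrier G"
  shows "|generate G B| \<le>o |B|"
proof -
  define T where "T n = ((\<lambda>S. (\<lambda>(x, y). x \<otimes> y) ` (S \<times> S)) ^^ n) (insert \<one> B)" for n
  have T0: "T 0 = insert \<one> B" and TS: "T (Suc n) = (\<lambda>(x, y). x \<otimes> y) ` (T n \<times> T n)" for n
    by (simp_all add: T_def)
  have Tc: "T n \<subseteq> carrier G" for n
    by (induction n) (use B in \<open>auto simp: T0 TS\<close>)
  have T1: "\<one> \<in> T n" for n
    by (induction n) (force simp: T0 TS image_iff)+
  have "T n \<subseteq> T (Suc n)" for n
  proof
    fix x assume "x \<in> T n"
    then have "x = x \<otimes> \<one>" using Tc[of n] by auto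
    then show "x \<in> T (Suc n)" using T1 \<open>x \<in> T n\<close> by (auto simp: TS image_iff)
  qed
  then have mono: "T m \<subseteq> T n" if "m \<le> n" for m n
    using that by (rule lift_Suc_mono_le)
  have closed: "x \<otimes> y \<in> (\<Union>n. T n)" if xy: "x \<in> (\<Union>n. T n)" "y \<in> (\<Union>n. T n)" for x y
  proof -
    obtain m n where "x \<in> T m" "y \<in> T n" using xy by blast
    then have "x \<in> T (max m n)" "y \<in> T (max m n)" using mono[of m "max m n"] mono[of n "max m n"] by auto
    then have "x \<otimes> y \<in> T (Suc (max m n))" by (auto simp: TS)
    then show ?thesis by blast
  qed
  have pow: "x [^] (k :: nat) \<in> (\<Union>n. T n)" if "x \<in> (\<Union>n. T n)" for x k
  proof (induction k)
    case 0
    then show ?case using T1 by (metis UNIV_I UN_I nat_pow_0)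
  next
    case (Suc k)
    then show ?case using closed that by (metis nat_pow_Suc)
  qed
  have "generate G B \<subseteq> (\<Union>n. T n)"
  proof
    fix x assume "x \<in> generate G B"
    then show "x \<in> (\<Union>n. T n)"
    proof (induction x rule: generate.induct)
      case one
      then show ?case using T1 by blast
    next
      case (incl h)
      then show ?case using T0 by blast
    next
      case (inv h)
      then have "h \<in> (\<Union>n. T n)" using T0 by blast
      then show ?case using pow inv_eq_pow[of h] inv B by (metis subsetD)
    next
      case (eng h1 h2)
      then show ?case by (intro closed)
    qed
  qed
  moreover have "|T n| \<le>o |B|" for n
  proof (induction n)
    case 0
    obtain h where "bij_betw h B (insert \<one> B)"
      using infinite_imp_bij_betw2[OF B(1), of \<one>] by auto
    then have "|insert \<one> B| =o |B|"
      by (rule ordIso_symmetric[OF card_of_ordIsoI])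
    then show ?case unfolding T0 by (rule ordIso_imp_ordLeq)
  next
    case (Suc n)
    have "|T n \<times> T n| \<le>o |B|"
      by (intro card_of_Sigma_ordLeq_infinite B(1) Suc ballI)
    then show ?case unfolding TS by (rule ordLeq_transitive[OF card_of_image])
  qed
  then have "|\<Union>n. T n| \<le>o |B|"
    using B(1) infinite_iff_card_of_nat[of B] by (intro card_of_UNION_ordLeq_infinite ballI) auto
  ultimately show ?thesis by (meson card_of_mono1 ordLeq_transitive)
qed

text \<open>A finite set generates a finite group, and an infinite one generates no more than its
  own cardinality. A basis of an infinite group is therefore as large as the group, and the rank is
  visible from the cardinality.\<close>

lemma iso_sum_group_carrier:
  assumes "infinite (carrier G)"
  obtains X :: "'a set" where "G \<cong> sum_group X (\<lambda>_. integer_mod_group p)" "|X| =o |carrier G|"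
proof -
  obtain X where X: "independent X" "generate G X = carrier G" by (rule exists_basis)
  have Xc: "X \<subseteq> carrier G" using X by (simp add: independent_def)
  have "infinite X" using finite_generate[OF _ Xc] X assms by auto
  then have "|X| =o |carrier G|"
    using card_of_generate_infinite[OF _ Xc] X card_of_mono1[OF Xc] by (simp add: ordIso_iff_ordLeq)
  then show ?thesis by (rule that[OF iso_sum_group_basis[OF X]])
qed

end

lemma sum_group_reindex:
  assumes "bij_betw f X Y" "group Z"
  shows "sum_group Y (\<lambda>_. Z) \<cong> sum_group X (\<lambda>_. Z)"
proof -
  define h where "h t = (\<lambda>x\<in>X. t (f x))" for t :: "'b \<Rightarrow> 'c"
  define k where "k t = (\<lambda>y\<in>Y. t (inv_into X f y))" for t :: "'a \<Rightarrow> 'c"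
  have fX: "f x \<in> Y" if "x \<in> X" for x using assms(1) that by (auto simp: bij_betw_def)
  have gY: "inv_into X f y \<in> X" if "y \<in> Y" for y
    using assms(1) that by (metis bij_betw_imp_surj_on inv_into_into)
  have fg: "f (inv_into X f y) = y" if "y \<in> Y" for y
    using assms(1) that by (metis bij_betw_inv_into_right)
  have gf: "inv_into X f (f x) = x" if "x \<in> X" for x
    using assms(1) that by (metis bij_betw_inv_into_left)
  have carr: "carrier (sum_group I (\<lambda>_. Z)) = {x \<in> \<Pi>\<^sub>E i\<in>I. carrier Z. finite {i \<in> I. x i \<noteq> \<one>\<^bsub>Z\<^esub>}}" for I :: "'d set"
    using assms(2) by (simp add: carrier_sum_group)
  have fin1: "finite {x \<in> X. t (f x) \<noteq> \<one>\<^bsub>Z\<^esub>}" if "finite {y \<in> Y. t y \<noteq> \<one>\<^bsub>Z\<^esub>}" for t :: "'b \<Rightarrow> 'c"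
  proof (rule finite_subset)
    show "{x \<in> X. t (f x) \<noteq> \<one>\<^bsub>Z\<^esub>} \<subseteq> inv_into X f ` {y \<in> Y. t y \<noteq> \<one>\<^bsub>Z\<^esub>}"
      using fX gf by (force simp: image_iff)
  qed (use that in simp)
  have fin2: "finite {y \<in> Y. t (inv_into X f y) \<noteq> \<one>\<^bsub>Z\<^esub>}" if "finite {x \<in> X. t x \<noteq> \<one>\<^bsub>Z\<^esub>}" for t :: "'a \<Rightarrow> 'c"
  proof (rule finite_subset)
    show "{y \<in> Y. t (inv_into X f y) \<noteq> \<one>\<^bsub>Z\<^esub>} \<subseteq> f ` {x \<in> X. t x \<noteq> \<one>\<^bsub>Z\<^esub>}"
      using gY fg by (force simp: image_iff)
  qed (use that in simp)
  have "h \<in> hom (sum_group Y (\<lambda>_. Z)) (sum_group X (\<lambda>_. Z))"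
  proof (rule homI)
    fix t assume t: "t \<in> carrier (sum_group Y (\<lambda>_. Z))"
    have "{x \<in> X. h t x \<noteq> \<one>\<^bsub>Z\<^esub>} = {x \<in> X. t (f x) \<noteq> \<one>\<^bsub>Z\<^esub>}" by (auto simp: h_def)
    then show "h t \<in> carrier (sum_group X (\<lambda>_. Z))"
      using t fX fin1[of t] by (auto simp: carrier_sum_group assms(2) h_def PiE_iff)
  qed (auto simp: h_def fX)
  moreover have "bij_betw h (carrier (sum_group Y (\<lambda>_. Z))) (carrier (sum_group X (\<lambda>_. Z)))"
  proof (rule bij_betw_byWitness[where f' = k])
    show "\<forall>t\<in>carrier (sum_group Y (\<lambda>_. Z)). k (h t) = t"
      using gY fg by (auto simp: carrier_sum_group assms(2) h_def k_def PiE_iff extensional_def fun_eq_iff)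
    show "\<forall>t\<in>carrier (sum_group X (\<lambda>_. Z)). h (k t) = t"
      using fX gf by (auto simp: carrier_sum_group assms(2) h_def k_def PiE_iff extensional_def fun_eq_iff)
    show "h ` carrier (sum_group Y (\<lambda>_. Z)) \<subseteq> carrier (sum_group X (\<lambda>_. Z))"
    proof clarify
      fix t assume t: "t \<in> carrier (sum_group Y (\<lambda>_. Z))"
      have "{x \<in> X. h t x \<noteq> \<one>\<^bsub>Z\<^esub>} = {x \<in> X. t (f x) \<noteq> \<one>\<^bsub>Z\<^esub>}" by (auto simp: h_def)
      then show "h t \<in> carrier (sum_group X (\<lambda>_. Z))"
        using t fX fin1[of t] by (auto simp: carrier_sum_group assms(2) h_def PiE_iff)
    qed
    show "k ` carrier (sum_group X (\<lambda>_. Z)) \<subseteq> carrier (sum_group Y (\<lambda>_. Z))"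
    proof clarify
      fix t assume t: "t \<in> carrier (sum_group X (\<lambda>_. Z))"
      have "{x \<in> Y. k t x \<noteq> \<one>\<^bsub>Z\<^esub>} = {x \<in> Y. t (inv_into X f x) \<noteq> \<one>\<^bsub>Z\<^esub>}" by (auto simp: k_def)
      then show "k t \<in> carrier (sum_group Y (\<lambda>_. Z))"
        using t gY fin2[of t] by (auto simp: carrier_sum_group assms(2) k_def PiE_iff)
    qed
  qed
  ultimately show ?thesis by (auto simp: is_iso_def iso_def)
qed

text \<open>The bases on both sides have the same cardinality. The groups of the theorem may thus be
  exchanged for any convenient model of exponent \<open>p\<close> and the same size, which is how
  they receive their topologies.\<close>

lemma elem_abelian_iso:
  fixes G :: "('a, 'b) monoid_scheme" and H :: "('c, 'd) monoid_scheme"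
  assumes G: "elem_abelian G p" and H: "elem_abelian H p"
    and inf: "infinite (carrier G)" and eq: "|carrier G| =o |carrier H|"
  shows "G \<cong> H"
proof -
  interpret G: elem_abelian G p by (rule G)
  interpret H: elem_abelian H p by (rule H)
  obtain X :: "'a set" where X: "G \<cong> sum_group X (\<lambda>_. integer_mod_group p)" "|X| =o |carrier G|"
    by (rule G.iso_sum_group_carrier[OF inf])
  have "infinite (carrier H)" using inf eq card_of_ordIso_finite by blast
  then obtain Y :: "'c set" where Y: "H \<cong> sum_group Y (\<lambda>_. integer_mod_group p)" "|Y| =o |carrier H|"
    by (rule H.iso_sum_group_carrier)
  have "|X| =o |Y|" using X Y eq by (meson ordIso_symmetric ordIso_transitive)
  then obtain f where "bij_betw f X Y" using card_of_ordIso by blast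
  then have "sum_group Y (\<lambda>_. integer_mod_group p) \<cong> sum_group X (\<lambda>_. integer_mod_group p)"
    by (intro sum_group_reindex) auto
  then have "H \<cong> sum_group X (\<lambda>_. integer_mod_group p)" using Y iso_trans by blast
  then show ?thesis using X H.iso_sym iso_trans by blast
qed

section \<open>Fourier analysis on finite elementary abelian groups\<close>

context elem_abelian
begin

text \<open>Without \<open>extensional\<close> the values off the carrier would be arbitrary; with
  it, a finite group has finitely many characters, and distinct ones differ at an element of the
  group.\<close>

definition chars :: "('a \<Rightarrow> int) set" where
  "chars = hom G (integer_mod_group p) \<inter> extensional (carrier G)"

definition char_val :: "('a \<Rightarrow> int) \<Rightarrow> 'a \<Rightarrow> complex" where
  "char_val \<phi> x = cis (2 * pi * of_int (\<phi> x) / of_nat p)"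

lemma cis_mod_p: "cis (2 * pi * of_int (k mod int p) / of_nat p) = cis (2 * pi * of_int k / of_nat p)"
proof -
  have "of_int k = (of_nat p * of_int (k div int p) + of_int (k mod int p) :: real)"
    by (metis mult_div_mod_eq of_int_add of_int_mult of_int_of_nat_eq)
  then have "2 * pi * of_int k / of_nat p = 2 * pi * of_int (k div int p) + 2 * pi * of_int (k mod int p) / of_nat p"
    using p_pos by (simp add: field_simps)
  then show ?thesis
    by (simp add: cis_multiple_2pi flip: cis_mult)
qed

lemma
  assumes "\<phi> \<in> chars"
  shows char_val_mult: "x \<in> carrier G \<Longrightarrow> y \<in> carrier G \<Longrightarrow> char_val \<phi> (x \<otimes> y) = char_val \<phi> x * char_val \<phi> y"
    and char_val_one: "char_val \<phi> \<one> = 1"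
    and char_val_inv: "x \<in> carrier G \<Longrightarrow> char_val \<phi> (inv x) = cnj (char_val \<phi> x)"
proof -
  have hom: "\<phi> \<in> hom G (integer_mod_group p)" using assms by (simp add: chars_def)
  have mult: "char_val \<phi> (x \<otimes> y) = char_val \<phi> x * char_val \<phi> y" if "x \<in> carrier G" "y \<in> carrier G" for x y
    using hom_mult[OF hom that] unfolding char_val_def
    by (simp only: mult_integer_mod_group cis_mod_p) (simp add: cis_mult distrib_left add_divide_distrib)
  then show "x \<in> carrier G \<Longrightarrow> y \<in> carrier G \<Longrightarrow> char_val \<phi> (x \<otimes> y) = char_val \<phi> x * char_val \<phi> y" .
  show one: "char_val \<phi> \<one> = 1"
    using hom_one[OF hom] by (simp add: char_val_def)
  assume x: "x \<in> carrier G"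
  have "char_val \<phi> x * char_val \<phi> (inv x) = 1" using mult[of x "inv x"] x one by simp
  then have "char_val \<phi> (inv x) = inverse (char_val \<phi> x)" by (metis inverse_unique)
  then show "char_val \<phi> (inv x) = cnj (char_val \<phi> x)" by (simp add: char_val_def cis_inverse cis_cnj)
qed

lemma norm_char_val [simp]: "norm (char_val \<phi> x) = 1"
  by (simp add: char_val_def)

lemma char_val_eq_1_iff:
  assumes "0 \<le> \<phi> x" "\<phi> x < int p"
  shows "char_val \<phi> x = 1 \<longleftrightarrow> \<phi> x = 0"
proof
  assume "char_val \<phi> x = 1"
  then have "cos (2 * pi * of_int (\<phi> x) / of_nat p) = 1"
    by (simp add: char_val_def complex_eq_iff)
  then obtain n :: int where "2 * pi * of_int (\<phi> x) / of_nat p = of_int n * (2 * pi)"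
    by (auto simp: cos_one_2pi_int)
  then have "of_int (\<phi> x) = (of_int n * of_nat p :: real)" using p_pos by (simp add: field_simps)
  then have "\<phi> x = n * int p" by (metis of_int_eq_iff of_int_mult of_int_of_nat_eq)
  then show "\<phi> x = 0" using assms p_pos by (metis mod_mult_self2_is_0 mod_pos_pos_trivial)
qed (simp add: char_val_def)

lemma chars_range: "\<phi> \<in> chars \<Longrightarrow> x \<in> carrier G \<Longrightarrow> 0 \<le> \<phi> x \<and> \<phi> x < int p"
  using hom_in_carrier[of \<phi> G "integer_mod_group p" x] by (auto simp: chars_def)

lemma finite_chars:
  assumes "finite (carrier G)" shows "finite chars"
proof (rule finite_subset)
  show "chars \<subseteq> (\<Pi>\<^sub>E x\<in>carrier G. {0..<int p})"
  proof
    fix \<phi> assume \<phi>: "\<phi> \<in> chars"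
    then have "\<phi> \<in> extensional (carrier G)" by (simp add: chars_def)
    then show "\<phi> \<in> (\<Pi>\<^sub>E x\<in>carrier G. {0..<int p})"
      using chars_range[OF \<phi>] by (simp add: PiE_iff)
  qed
  show "finite (\<Pi>\<^sub>E x\<in>carrier G. {0..<int p})"
    using assms by (intro finite_PiE) auto
qed

lemma chars_add:
  assumes "\<phi> \<in> chars" "\<psi> \<in> chars"
  shows "(\<lambda>x\<in>carrier G. (\<phi> x + \<psi> x) mod int p) \<in> chars"
proof -
  have *: "\<phi> (x \<otimes> y) = (\<phi> x + \<phi> y) mod int p" "\<psi> (x \<otimes> y) = (\<psi> x + \<psi> y) mod int p"
    if "x \<in> carrier G" "y \<in> carrier G" for x y
    using assms that hom_mult[of _ G "integer_mod_group p"] by (auto simp: chars_def)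
  show ?thesis
    unfolding chars_def
  proof (intro IntI homI)
    fix x y assume xy: "x \<in> carrier G" "y \<in> carrier G"
    have "((a + b) mod int p + (c + d) mod int p) mod int p = ((a + c) mod int p + (b + d) mod int p) mod int p" for a b c d
      by (simp add: mod_add_eq algebra_simps)
    then show "(\<lambda>x\<in>carrier G. (\<phi> x + \<psi> x) mod int p) (x \<otimes> y) =
        (\<lambda>x\<in>carrier G. (\<phi> x + \<psi> x) mod int p) x \<otimes>\<^bsub>integer_mod_group p\<^esub> (\<lambda>x\<in>carrier G. (\<phi> x + \<psi> x) mod int p) y"
      using xy by (simp add: *)
  qed (use p_pos in auto)
qed

text \<open>Orthogonality: for \<open>x \<noteq> \<one>\<close> some character \<psi> has value 1 at
  \<open>x\<close>. Adding \<psi> permutes \<open>chars\<close> and multiplies the sum by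
  \<open>char_val \<psi> x\<close>, which is not 1, so the sum is 0.\<close>

lemma sum_chars_char_val:
  assumes fin: "finite (carrier G)" and x: "x \<in> carrier G"
  shows "(\<Sum>\<phi>\<in>chars. char_val \<phi> x) = (if x = \<one> then of_nat (card chars) else 0)"
proof (cases "x = \<one>")
  case True
  then show ?thesis by (simp add: char_val_one)
next
  case False
  obtain \<psi>' where \<psi>': "\<psi>' \<in> hom G (integer_mod_group p)" "\<psi>' x = 1"
    using separating_hom[of "{\<one>}" x] False x triv_subgroup by auto
  define \<psi> where "\<psi> = restrict \<psi>' (carrier G)"
  have \<psi>: "\<psi> \<in> chars" "\<psi> x = 1"
    using \<psi>' x by (auto simp: \<psi>_def chars_def hom_def Pi_iff)
  define T where "T \<psi> \<phi> = (\<lambda>x\<in>carrier G. (\<phi> x + \<psi> x) mod int p)" for \<psi> \<phi> :: "'a \<Rightarrow> int"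
  have T_char_val: "char_val (T \<psi> \<phi>) x = char_val \<phi> x * char_val \<psi> x" for \<phi>
    using x unfolding T_def char_val_def
    by (simp only: restrict_apply' cis_mod_p) (simp add: cis_mult distrib_left add_divide_distrib)
  have inj: "inj_on (T \<psi>) chars"
  proof (rule inj_onI)
    fix \<phi> \<phi>' assume *: "\<phi> \<in> chars" "\<phi>' \<in> chars" "T \<psi> \<phi> = T \<psi> \<phi>'"
    have "\<phi> y = \<phi>' y" if y: "y \<in> carrier G" for y
    proof -
      have "(\<phi> y + \<psi> y) mod int p = (\<phi>' y + \<psi> y) mod int p"
        using fun_cong[OF *(3), of y] y by (simp add: T_def)
      then have "\<phi> y mod int p = \<phi>' y mod int p"
        by (metis add_diff_cancel_right' mod_diff_left_eq)
      then show ?thesis using chars_range y * by auto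
    qed
    then show "\<phi> = \<phi>'" using * by (auto simp: chars_def intro: extensionalityI)
  qed
  have "T \<psi> ` chars \<subseteq> chars" using chars_add \<psi> by (auto simp: T_def)
  then have "bij_betw (T \<psi>) chars chars"
    using inj finite_chars[OF fin] by (simp add: bij_betw_def endo_inj_surj)
  then have "(\<Sum>\<phi>\<in>chars. char_val \<phi> x) = (\<Sum>\<phi>\<in>chars. char_val (T \<psi> \<phi>) x)"
    by (rule sum.reindex_bij_betw[symmetric])
  also have "\<dots> = (\<Sum>\<phi>\<in>chars. char_val \<phi> x) * char_val \<psi> x"
    by (simp add: T_char_val sum_distrib_right)
  finally have "(\<Sum>\<phi>\<in>chars. char_val \<phi> x) * (1 - char_val \<psi> x) = 0" by (simp add: algebra_simps)
  moreover have "char_val \<psi> x \<noteq> 1" using char_val_eq_1_iff[of \<psi> x] \<psi> p_gt_1 by simp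
  ultimately show ?thesis using False by simp
qed

lemma zero_char: "(\<lambda>x\<in>carrier G. 0) \<in> chars"
  using p_pos by (auto simp: chars_def hom_def)

text \<open>The sum of all \<open>char_val \<phi> x\<close> is evaluated in both orders: summing
  over characters leaves only the identity, summing over the group leaves only the trivial
  character.\<close>

lemma card_chars:
  assumes fin: "finite (carrier G)"
  shows "card chars = card (carrier G)"
proof -
  let ?z = "\<lambda>x\<in>carrier G. 0 :: int"
  have *: "(\<Sum>x\<in>carrier G. char_val \<phi> x) = (if \<phi> = ?z then of_nat (card (carrier G)) else 0)"
    if \<phi>: "\<phi> \<in> chars" for \<phi>
  proof (cases "\<phi> = ?z")
    case True
    have "(\<Sum>x\<in>carrier G. char_val ?z x) = (\<Sum>x\<in>carrier G. 1)" by (intro sum.cong) (auto simp: char_val_def)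
    then show ?thesis using True by simp
  next
    case False
    have "\<phi> \<in> extensional (carrier G)" using \<phi> by (simp add: chars_def)
    then obtain y where y: "y \<in> carrier G" "\<phi> y \<noteq> 0"
      using False by (metis extensionalityI restrict_apply' restrict_extensional)
    have "bij_betw (\<lambda>x. y \<otimes> x) (carrier G) (carrier G)"
      using y by (intro bij_betwI[where g = "\<lambda>x. inv y \<otimes> x"]) (use l_cancel_inv[of "inv y"] in \<open>auto simp: l_cancel_inv\<close>)
    then have "(\<Sum>x\<in>carrier G. char_val \<phi> x) = (\<Sum>x\<in>carrier G. char_val \<phi> (y \<otimes> x))"
      by (rule sum.reindex_bij_betw[symmetric])
    also have "\<dots> = char_val \<phi> y * (\<Sum>x\<in>carrier G. char_val \<phi> x)"
      using y \<phi> by (simp add: char_val_mult sum_distrib_left)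
    finally have "(1 - char_val \<phi> y) * (\<Sum>x\<in>carrier G. char_val \<phi> x) = 0" by (simp add: algebra_simps)
    moreover have "char_val \<phi> y \<noteq> 1" using char_val_eq_1_iff[of \<phi> y] y chars_range[OF \<phi>] by simp
    ultimately show ?thesis using False by simp
  qed
  have "of_nat (card chars) = (\<Sum>x\<in>carrier G. \<Sum>\<phi>\<in>chars. char_val \<phi> x)"
    using fin by (simp add: sum_chars_char_val sum.delta)
  also have "\<dots> = (\<Sum>\<phi>\<in>chars. \<Sum>x\<in>carrier G. char_val \<phi> x)" by (rule sum.swap)
  also have "\<dots> = (of_nat (card (carrier G)) :: complex)"
    using finite_chars[OF fin] zero_char by (simp add: * sum.delta cong: sum.cong)
  finally show ?thesis by simp
qed

text \<open>The squared modulus expands into a sum over pairs, and orthogonality keeps the pairs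
  with \<open>g q \<otimes> inv (g r) \<otimes> x = \<one>\<close>. The index set \<open>Q\<close>
  allows \<open>g\<close> to repeat values: the two uses are the inclusion of \<open>A\<close> and
  the product map on \<open>A \<times> A\<close>.\<close>

lemma fourier_count:
  fixes g :: "'q \<Rightarrow> 'a"
  assumes fin: "finite (carrier G)" and Q: "finite Q" "\<And>q. q \<in> Q \<Longrightarrow> g q \<in> carrier G"
    and x: "x \<in> carrier G"
  shows "(\<Sum>\<phi>\<in>chars. of_real ((cmod (\<Sum>q\<in>Q. char_val \<phi> (g q)))\<^sup>2) * char_val \<phi> x) =
    of_nat (card chars * card {(q, r) \<in> Q \<times> Q. g q \<otimes> inv (g r) \<otimes> x = \<one>})"
proof -
  have "of_real ((cmod (\<Sum>q\<in>Q. char_val \<phi> (g q)))\<^sup>2) * char_val \<phi> x =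
      (\<Sum>(q, r)\<in>Q \<times> Q. char_val \<phi> (g q \<otimes> inv (g r) \<otimes> x))" if \<phi>: "\<phi> \<in> chars" for \<phi>
  proof -
    have "of_real ((cmod (\<Sum>q\<in>Q. char_val \<phi> (g q)))\<^sup>2) = (\<Sum>q\<in>Q. char_val \<phi> (g q)) * (\<Sum>r\<in>Q. cnj (char_val \<phi> (g r)))"
      by (simp only: complex_norm_square cnj_sum)
    also have "\<dots> = (\<Sum>q\<in>Q. \<Sum>r\<in>Q. char_val \<phi> (g q) * cnj (char_val \<phi> (g r)))" by (rule sum_product)
    also have "\<dots> * char_val \<phi> x = (\<Sum>q\<in>Q. \<Sum>r\<in>Q. char_val \<phi> (g q \<otimes> inv (g r) \<otimes> x))"
      unfolding sum_distrib_right using \<phi> Q x by (intro sum.cong refl) (simp add: char_val_mult char_val_inv)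
    finally show ?thesis by (simp add: sum.cartesian_product)
  qed
  then have "(\<Sum>\<phi>\<in>chars. of_real ((cmod (\<Sum>q\<in>Q. char_val \<phi> (g q)))\<^sup>2) * char_val \<phi> x) =
      (\<Sum>\<phi>\<in>chars. \<Sum>(q, r)\<in>Q \<times> Q. char_val \<phi> (g q \<otimes> inv (g r) \<otimes> x))"
    by (intro sum.cong) auto
  also have "\<dots> = (\<Sum>qr\<in>Q \<times> Q. \<Sum>\<phi>\<in>chars. char_val \<phi> (g (fst qr) \<otimes> inv (g (snd qr)) \<otimes> x))"
    unfolding case_prod_unfold by (rule sum.swap)
  also have "\<dots> = (\<Sum>qr\<in>Q \<times> Q. if g (fst qr) \<otimes> inv (g (snd qr)) \<otimes> x = \<one> then of_nat (card chars) else 0)"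
    using Q x by (intro sum.cong refl sum_chars_char_val fin) auto
  also have "\<dots> = of_nat (card chars) * of_nat (card {qr \<in> Q \<times> Q. g (fst qr) \<otimes> inv (g (snd qr)) \<otimes> x = \<one>})"
    using Q by (simp add: sum.If_cases Int_def mult.commute)
  also have "{qr \<in> Q \<times> Q. g (fst qr) \<otimes> inv (g (snd qr)) \<otimes> x = \<one>} = {(q, r) \<in> Q \<times> Q. g q \<otimes> inv (g r) \<otimes> x = \<one>}"
    by auto
  finally show ?thesis by simp
qed

text \<open>Bogolyubov's lemma, with \<open>S\<close> the set of large Fourier coefficients of \<open>A\<close>: the number of
  representations of \<open>x\<close> is proportional to the sum of \<open>(M \<phi>)\<^sup>2 \<phi>(x)\<close> over all characters, and
  those outside \<open>S\<close> contribute less than the trivial character.\<close>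

lemma bogolyubov:
  assumes fin: "finite (carrier G)" and A: "A \<subseteq> carrier G" "A \<noteq> {}"
    and k: "card (carrier G) \<le> k * card A"
  obtains S where "S \<subseteq> hom G (integer_mod_group p)" "finite S" "card S \<le> k\<^sup>2"
    "\<And>x. x \<in> carrier G \<Longrightarrow> (\<And>\<phi>. \<phi> \<in> S \<Longrightarrow> \<phi> x = 0) \<Longrightarrow>
       \<exists>a\<in>A. \<exists>b\<in>A. \<exists>c\<in>A. \<exists>d\<in>A. x = c \<otimes> d \<otimes> inv (a \<otimes> b)"
proof -
  have finA: "finite A" using A fin finite_subset by blast
  have Ac: "a \<in> A \<Longrightarrow> a \<in> carrier G" for a using A by auto
  have finC: "finite chars" by (rule finite_chars[OF fin])
  define n where "n = real (card (carrier G))"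
  define \<alpha> where "\<alpha> = real (card A)"
  have \<alpha>: "\<alpha> > 0" using A finA by (simp add: \<alpha>_def card_gt_0_iff)
  have n: "n > 0" using fin by (auto simp: n_def card_gt_0_iff)
  define M where "M \<phi> = (cmod (\<Sum>a\<in>A. char_val \<phi> a))\<^sup>2" for \<phi>
  have M_nonneg: "0 \<le> M \<phi>" for \<phi> by (simp add: M_def)
  \<comment> \<open>Parseval's identity, obtained from \<open>fourier_count\<close> at the identity,
    where only the diagonal pairs remain.\<close>
  have sumM: "(\<Sum>\<phi>\<in>chars. M \<phi>) = n * \<alpha>"
  proof -
    have "{(q, r) \<in> A \<times> A. q \<otimes> inv r \<otimes> \<one> = \<one>} = (\<lambda>a. (a, a)) ` A"
      using Ac by (auto simp: image_iff) (metis inv_closed inv_equality inv_inv)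
    then have "card {(q, r) \<in> A \<times> A. q \<otimes> inv r \<otimes> \<one> = \<one>} = card A"
      by (simp add: card_image inj_on_def)
    moreover have "(\<Sum>\<phi>\<in>chars. of_real (M \<phi>) * char_val \<phi> \<one>) = complex_of_real (\<Sum>\<phi>\<in>chars. M \<phi>)"
      by (simp add: char_val_one)
    ultimately have "complex_of_real (\<Sum>\<phi>\<in>chars. M \<phi>) = of_nat (card (carrier G) * card A)"
      using fourier_count[of A "\<lambda>a. a" \<one>] fin finA Ac by (simp add: M_def card_chars[OF fin])
    then have "complex_of_real (\<Sum>\<phi>\<in>chars. M \<phi>) = complex_of_real (n * \<alpha>)"
      by (simp add: n_def \<alpha>_def)
    then show ?thesis by (simp only: of_real_eq_iff)
  qed
  have M2: "(M \<phi>)\<^sup>2 = (cmod (\<Sum>q\<in>A \<times> A. char_val \<phi> (fst q \<otimes> snd q)))\<^sup>2" if "\<phi> \<in> chars" for \<phi>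
  proof -
    have "(\<Sum>q\<in>A \<times> A. char_val \<phi> (fst q \<otimes> snd q)) = (\<Sum>(a, b)\<in>A \<times> A. char_val \<phi> a * char_val \<phi> b)"
      using that Ac by (intro sum.cong) (auto simp: char_val_mult)
    also have "\<dots> = (\<Sum>a\<in>A. char_val \<phi> a) * (\<Sum>a\<in>A. char_val \<phi> a)"
      by (simp add: sum_product sum.cartesian_product)
    finally show ?thesis by (simp add: M_def norm_mult power2_eq_square)
  qed
  \<comment> \<open>The threshold balances two uses of Parseval's identity. Coefficients below it
    contribute less than \<open>\<tau> * (n * \<alpha>) = \<alpha> ^ 4\<close>, which is the share
    of the trivial character; and at most
    \<open>n * \<alpha> / \<tau> = (n / \<alpha>)\<^sup>2\<close> coefficients reach it, whence the
    bound \<open>k\<^sup>2\<close>.\<close>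
  define \<tau> where "\<tau> = \<alpha> ^ 3 / n"
  define S where "S = {\<phi> \<in> chars. \<tau> \<le> M \<phi>}"
  have \<tau>: "\<tau> > 0" using \<alpha> n by (simp add: \<tau>_def)
  have S: "S \<subseteq> chars" "finite S" using finC by (auto simp: S_def)
  let ?z = "\<lambda>x\<in>carrier G. 0 :: int"
  have Mz: "M ?z = \<alpha>\<^sup>2"
  proof -
    have "(\<Sum>a\<in>A. char_val ?z a) = (\<Sum>a\<in>A. 1)" using Ac by (intro sum.cong) (auto simp: char_val_def)
    then show ?thesis by (simp add: M_def \<alpha>_def)
  qed
  have "\<alpha> \<le> n" using A fin by (simp add: \<alpha>_def n_def card_mono)
  then have zS: "?z \<in> S"
    using zero_char \<alpha> n by (simp add: S_def Mz \<tau>_def field_simps power3_eq_cube power2_eq_square)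
  show ?thesis
  proof
    show "S \<subseteq> hom G (integer_mod_group p)" using S by (auto simp: chars_def)
    show "finite S" by (rule S)
    have "real (card S) * \<tau> \<le> (\<Sum>\<phi>\<in>S. M \<phi>)"
      using sum_bounded_below[of S \<tau> M] by (simp add: S_def)
    also have "\<dots> \<le> n * \<alpha>"
      unfolding sumM[symmetric] using S finC M_nonneg by (intro sum_mono2) auto
    finally have "real (card S) \<le> (n / \<alpha>)\<^sup>2"
      using \<alpha> n by (simp add: \<tau>_def field_simps power3_eq_cube power2_eq_square)
    also have "n \<le> real k * \<alpha>" using k by (simp add: n_def \<alpha>_def flip: of_nat_mult)
    then have "n / \<alpha> \<le> real k" using \<alpha> by (simp add: field_simps)
    then have "(n / \<alpha>)\<^sup>2 \<le> (real k)\<^sup>2" using \<alpha> n by (intro power_mono) auto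
    finally show "card S \<le> k\<^sup>2" by (simp flip: of_nat_power)
  next
    fix x assume x: "x \<in> carrier G" and Sx: "\<And>\<phi>. \<phi> \<in> S \<Longrightarrow> \<phi> x = 0"
    show "\<exists>a\<in>A. \<exists>b\<in>A. \<exists>c\<in>A. \<exists>d\<in>A. x = c \<otimes> d \<otimes> inv (a \<otimes> b)"
    proof (rule ccontr)
      assume contra: "\<not> ?thesis"
      have "x = c \<otimes> d \<otimes> inv (a \<otimes> b)"
        if "(a \<otimes> b) \<otimes> inv (c \<otimes> d) \<otimes> x = \<one>" "a \<in> A" "b \<in> A" "c \<in> A" "d \<in> A" for a b c d
      proof -
        have c: "a \<otimes> b \<in> carrier G" "c \<otimes> d \<in> carrier G" using that Ac by auto
        have "x = inv ((a \<otimes> b) \<otimes> inv (c \<otimes> d))"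
          using that(1) c x by (metis inv_closed inv_equality inv_inv m_closed)
        then show ?thesis using c by (simp add: inv_mult_group)
      qed
      then have E: "{(q, r) \<in> (A \<times> A) \<times> (A \<times> A). fst q \<otimes> snd q \<otimes> inv (fst r \<otimes> snd r) \<otimes> x = \<one>} = {}"
        using contra by fastforce
      \<comment> \<open>For the product map on \<open>A \<times> A\<close> the count is that of the
        solutions of \<open>a \<otimes> b \<otimes> inv (c \<otimes> d) \<otimes> x =
        \<one>\<close>. If \<open>x\<close> has no representation, the whole Fourier sum
        vanishes.\<close>
      have "(\<Sum>\<phi>\<in>chars. of_real ((cmod (\<Sum>q\<in>A \<times> A. char_val \<phi> (fst q \<otimes> snd q)))\<^sup>2) * char_val \<phi> x) = of_nat (card chars *
          card {(q, r) \<in> (A \<times> A) \<times> (A \<times> A). fst q \<otimes> snd q \<otimes> inv (fst r \<otimes> snd r) \<otimes> x = \<one>})"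
        using fin finA Ac x by (intro fourier_count) auto
      then have "(\<Sum>\<phi>\<in>chars. of_real ((cmod (\<Sum>q\<in>A \<times> A. char_val \<phi> (fst q \<otimes> snd q)))\<^sup>2) * char_val \<phi> x) = 0"
        unfolding E by simp
      then have "(\<Sum>\<phi>\<in>chars. of_real ((M \<phi>)\<^sup>2) * char_val \<phi> x) = 0"
        by (simp add: M2 cong: sum.cong)
      then have "0 = Re (\<Sum>\<phi>\<in>chars. of_real ((M \<phi>)\<^sup>2) * char_val \<phi> x)" by simp
      also have "\<dots> = (\<Sum>\<phi>\<in>chars. (M \<phi>)\<^sup>2 * Re (char_val \<phi> x))" by simp
      also have "\<dots> = (\<Sum>\<phi>\<in>S. (M \<phi>)\<^sup>2 * Re (char_val \<phi> x)) + (\<Sum>\<phi>\<in>chars - S. (M \<phi>)\<^sup>2 * Re (char_val \<phi> x))"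
        using S finC by (metis (no_types, lifting) add.commute sum.subset_diff)
      also have "(\<Sum>\<phi>\<in>S. (M \<phi>)\<^sup>2 * Re (char_val \<phi> x)) = (\<Sum>\<phi>\<in>S. (M \<phi>)\<^sup>2)"
        by (intro sum.cong refl) (simp add: char_val_def Sx)
      finally have eq: "0 = (\<Sum>\<phi>\<in>S. (M \<phi>)\<^sup>2) + (\<Sum>\<phi>\<in>chars - S. (M \<phi>)\<^sup>2 * Re (char_val \<phi> x))" .
      have "(\<Sum>\<phi>\<in>chars - S. - (\<tau> * M \<phi>)) \<le> (\<Sum>\<phi>\<in>chars - S. (M \<phi>)\<^sup>2 * Re (char_val \<phi> x))"
      proof (rule sum_mono)
        fix \<phi> assume "\<phi> \<in> chars - S"
        then have "M \<phi> \<le> \<tau>" by (auto simp: S_def)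
        then have "(M \<phi>)\<^sup>2 \<le> \<tau> * M \<phi>" using M_nonneg[of \<phi>] by (simp add: power2_eq_square mult_right_mono)
        moreover have "- 1 \<le> Re (char_val \<phi> x)" using abs_Re_le_cmod[of "char_val \<phi> x"] by simp
        then have "(M \<phi>)\<^sup>2 * - 1 \<le> (M \<phi>)\<^sup>2 * Re (char_val \<phi> x)" by (intro mult_left_mono) auto
        ultimately show "- (\<tau> * M \<phi>) \<le> (M \<phi>)\<^sup>2 * Re (char_val \<phi> x)" by linarith
      qed
      moreover have "(\<Sum>\<phi>\<in>chars - S. - (\<tau> * M \<phi>)) = - \<tau> * (\<Sum>\<phi>\<in>chars - S. M \<phi>)"
        by (simp add: sum_distrib_left sum_negf)
      \<comment> \<open>The trivial character belongs to \<open>S\<close>, so its share of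
        Parseval's sum is missing outside \<open>S\<close>. This makes the final inequality
        strict.\<close>
      moreover have "\<alpha>\<^sup>2 + (\<Sum>\<phi>\<in>chars - S. M \<phi>) \<le> n * \<alpha>"
      proof -
        have "(\<Sum>\<phi>\<in>insert ?z (chars - S). M \<phi>) \<le> (\<Sum>\<phi>\<in>chars. M \<phi>)"
          using finC zero_char M_nonneg by (intro sum_mono2) auto
        then show ?thesis using finC zS by (simp add: Mz sumM)
      qed
      then have "\<tau> * (\<alpha>\<^sup>2 + (\<Sum>\<phi>\<in>chars - S. M \<phi>)) \<le> \<tau> * (n * \<alpha>)"
        using \<tau> by (intro mult_left_mono) auto
      moreover have "\<tau> * (n * \<alpha>) = (M ?z)\<^sup>2"
        using n by (simp add: \<tau>_def Mz power3_eq_cube power2_eq_square)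
      moreover have "(M ?z)\<^sup>2 \<le> (\<Sum>\<phi>\<in>S. (M \<phi>)\<^sup>2)"
        by (rule member_le_sum[OF zS]) (use S in auto)
      moreover have "\<tau> * \<alpha>\<^sup>2 > 0" using \<tau> \<alpha> by simp
      ultimately show False using eq by (simp add: algebra_simps)
    qed
  qed
qed

end

section \<open>Locally compact topologies on elementary abelian groups\<close>

text \<open>The assumption on \<open>P\<close> says that it depends on the coordinates in
  \<open>J\<close> only; freezing these at a point gives a basic cylinder inside the set. The closed
  version for the complement turns conditions on finitely many coordinates into closed sets for the
  compactness argument.\<close>

lemma openin_product_discrete_finite_support:
  assumes J: "finite J" "J \<subseteq> I"
    and P: "\<And>g h. g \<in> (\<Pi>\<^sub>E i\<in>I. D i) \<Longrightarrow> h \<in> (\<Pi>\<^sub>E i\<in>I. D i) \<Longrightarrow> (\<And>j. j \<in> J \<Longrightarrow> g j = h j) \<Longrightarrow> P g \<Longrightarrow> P h"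
  shows "openin (product_topology (\<lambda>i. discrete_topology (D i)) I) {g \<in> \<Pi>\<^sub>E i\<in>I. D i. P g}"
proof (subst openin_subopen, clarify)
  fix g assume g: "g \<in> (\<Pi>\<^sub>E i\<in>I. D i)" "P g"
  let ?U = "\<Pi>\<^sub>E i\<in>I. if i \<in> J then {g i} else D i"
  have "openin (product_topology (\<lambda>i. discrete_topology (D i)) I) ?U"
    using J g by (intro product_topology_basis) (auto intro: finite_subset[of _ J])
  moreover have "g \<in> ?U" using g by (auto simp: PiE_iff)
  moreover have "?U \<subseteq> {g \<in> \<Pi>\<^sub>E i\<in>I. D i. P g}"
  proof
    fix h assume h: "h \<in> ?U"
    have "h i \<in> D i" if "i \<in> I" for i
      using PiE_mem[OF h that] g that by (auto split: if_splits)
    then have hD: "h \<in> (\<Pi>\<^sub>E i\<in>I. D i)" using h by (simp add: PiE_iff)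
    have "g j = h j" if "j \<in> J" for j
      using PiE_mem[OF h, of j] that J by auto
    then show "h \<in> {g \<in> \<Pi>\<^sub>E i\<in>I. D i. P g}" using P[OF g(1) hD _ g(2)] hD by simp
  qed
  ultimately show "\<exists>U. openin (product_topology (\<lambda>i. discrete_topology (D i)) I) U \<and> g \<in> U \<and>
      U \<subseteq> {g \<in> \<Pi>\<^sub>E i\<in>I. D i. P g}" by blast
qed

lemma closedin_product_discrete_finite_support:
  assumes J: "finite J" "J \<subseteq> I"
    and P: "\<And>g h. g \<in> (\<Pi>\<^sub>E i\<in>I. D i) \<Longrightarrow> h \<in> (\<Pi>\<^sub>E i\<in>I. D i) \<Longrightarrow> (\<And>j. j \<in> J \<Longrightarrow> g j = h j) \<Longrightarrow> P g \<Longrightarrow> P h"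
  shows "closedin (product_topology (\<lambda>i. discrete_topology (D i)) I) {g \<in> \<Pi>\<^sub>E i\<in>I. D i. P g}"
proof -
  have "openin (product_topology (\<lambda>i. discrete_topology (D i)) I) {g \<in> \<Pi>\<^sub>E i\<in>I. D i. \<not> P g}"
    by (rule openin_product_discrete_finite_support[OF J]) (metis P)
  moreover have "{g \<in> \<Pi>\<^sub>E i\<in>I. D i. \<not> P g} = (\<Pi>\<^sub>E i\<in>I. D i) - {g \<in> \<Pi>\<^sub>E i\<in>I. D i. P g}" by auto
  ultimately show ?thesis by (simp add: closedin_def)
qed

lemma (in elem_abelian) elem_abelian_subgroup:
  assumes "subgroup H G"
  shows "elem_abelian (G\<lparr>carrier := H\<rparr>) p"
proof -
  interpret H: comm_group "G\<lparr>carrier := H\<rparr>"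
  proof (rule group.group_comm_groupI[OF subgroup_imp_group[OF assms]])
    fix x y assume "x \<in> carrier (G\<lparr>carrier := H\<rparr>)" "y \<in> carrier (G\<lparr>carrier := H\<rparr>)"
    then have "x \<in> carrier G" "y \<in> carrier G" using subgroup.subset[OF assms] by auto
    then show "x \<otimes>\<^bsub>G\<lparr>carrier := H\<rparr>\<^esub> y = y \<otimes>\<^bsub>G\<lparr>carrier := H\<rparr>\<^esub> x" by (simp add: m_comm)
  qed
  show ?thesis
  proof
    show "prime p" by (rule prime_p)
    fix x assume "x \<in> carrier (G\<lparr>carrier := H\<rparr>)"
    then have "x \<in> carrier G" using subgroup.subset[OF assms] by auto
    then show "x [^]\<^bsub>G\<lparr>carrier := H\<rparr>\<^esub> p = \<one>\<^bsub>G\<lparr>carrier := H\<rparr>\<^esub>"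
      using exponent nat_pow_consistent[of x p H] by simp
  qed
qed

section \<open>Translates and compact open subgroups\<close>

locale elem_topology = elem_abelian G p for G (structure) and p +
  fixes T
  assumes group_top: "group_topology G T"
begin

lemma topspace_eq [simp]: "topspace T = carrier G"
  using group_top by (simp add: group_topology_def)

lemma continuous_map_mult:
  assumes "continuous_map X T f" "continuous_map X T g"
  shows "continuous_map X T (\<lambda>x. f x \<otimes> g x)"
proof -
  have "continuous_map X (prod_topology T T) (\<lambda>x. (f x, g x))"
    using assms by (simp add: continuous_map_pairwise o_def)
  moreover have "continuous_map (prod_topology T T) T (\<lambda>(x, y). x \<otimes> y)"
    using group_top by (simp add: group_topology_def)
  ultimately have "continuous_map X T ((\<lambda>(x, y). x \<otimes> y) \<circ> (\<lambda>x. (f x, g x)))"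
    by (rule continuous_map_compose)
  then show ?thesis by (simp add: o_def)
qed

lemma continuous_map_translate:
  assumes "a \<in> carrier G" shows "continuous_map T T (\<lambda>x. a \<otimes> x)"
  using assms by (intro continuous_map_mult) auto

lemma translate_image:
  assumes "a \<in> carrier G" "U \<subseteq> carrier G"
  shows "(\<lambda>x. a \<otimes> x) ` U = {x \<in> carrier G. inv a \<otimes> x \<in> U}"
proof -
  have "a \<otimes> (inv a \<otimes> x) = x" "inv a \<otimes> (a \<otimes> x) = x" if "x \<in> carrier G" for x
    using assms that l_cancel_inv[of a x] l_cancel_inv[of "inv a" x] by auto
  then show ?thesis using assms by (auto simp: image_iff subset_iff) metis
qed

lemma openin_translate:
  assumes "a \<in> carrier G" "openin T U"
  shows "openin T ((\<lambda>x. a \<otimes> x) ` U)"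
  using openin_continuous_map_preimage[OF continuous_map_translate[of "inv a"] assms(2)] assms
    openin_subset[OF assms(2)] by (simp add: translate_image)

lemma closedin_translate:
  assumes "a \<in> carrier G" "closedin T U"
  shows "closedin T ((\<lambda>x. a \<otimes> x) ` U)"
  using closedin_continuous_map_preimage[OF continuous_map_translate[of "inv a"] assms(2)] assms
    closedin_subset[OF assms(2)] by (simp add: translate_image)

lemma nbhd_halve:
  assumes W: "openin T W" "\<one> \<in> W"
  obtains V where "openin T V" "\<one> \<in> V" "\<And>x. x \<in> V \<Longrightarrow> inv x \<in> V"
    "\<And>x y. x \<in> V \<Longrightarrow> y \<in> V \<Longrightarrow> x \<otimes> y \<in> W"
proof -
  have "continuous_map (prod_topology T T) T (\<lambda>(x, y). x \<otimes> y)" and inv: "continuous_map T T (\<lambda>x. inv x)"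
    using group_top by (simp_all add: group_topology_def)
  from openin_continuous_map_preimage[OF this(1) W(1)]
  have "openin (prod_topology T T) {x \<in> topspace (prod_topology T T). (\<lambda>(x, y). x \<otimes> y) x \<in> W}" .
  moreover have "(\<one>, \<one>) \<in> {x \<in> topspace (prod_topology T T). (\<lambda>(x, y). x \<otimes> y) x \<in> W}"
    using W by simp
  ultimately obtain A B where AB: "openin T A" "openin T B" "\<one> \<in> A" "\<one> \<in> B"
    "A \<times> B \<subseteq> {x \<in> topspace (prod_topology T T). (\<lambda>(x, y). x \<otimes> y) x \<in> W}"
    unfolding openin_prod_topology_alt by meson
  let ?V = "A \<inter> B \<inter> {x \<in> topspace T. inv x \<in> A \<inter> B}"
  show ?thesis
  proof
    show "openin T ?V"
      using AB openin_continuous_map_preimage[OF inv, of "A \<inter> B"] by (intro openin_Int) auto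
    show "\<one> \<in> ?V" using AB by simp
    show "inv x \<in> ?V" if "x \<in> ?V" for x using that by auto
    show "x \<otimes> y \<in> W" if "x \<in> ?V" "y \<in> ?V" for x y using that AB(5) by auto
  qed
qed

lemma finite_translates_cover:
  assumes "compactin T C" "openin T V" "\<one> \<in> V"
  obtains F where "finite F" "F \<subseteq> C" "C \<subseteq> (\<Union>f\<in>F. (\<lambda>x. f \<otimes> x) ` V)"
proof -
  have C: "C \<subseteq> carrier G" using compactin_subset_topspace[OF assms(1)] by simp
  have "c \<in> (\<lambda>x. c \<otimes> x) ` V" if "c \<in> C" for c
    using that C assms(3) by (intro image_eqI[of _ _ \<one>]) auto
  then have "C \<subseteq> \<Union>((\<lambda>f. (\<lambda>x. f \<otimes> x) ` V) ` C)" by blast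
  moreover have "\<forall>U\<in>(\<lambda>f. (\<lambda>x. f \<otimes> x) ` V) ` C. openin T U"
    using C assms(2) by (auto intro: openin_translate)
  ultimately obtain \<F> where \<F>: "finite \<F>" "\<F> \<subseteq> (\<lambda>f. (\<lambda>x. f \<otimes> x) ` V) ` C" "C \<subseteq> \<Union>\<F>"
    using assms(1) unfolding compactin_def by metis
  obtain F where "F \<subseteq> C" "finite F" "\<F> = (\<lambda>f. (\<lambda>x. f \<otimes> x) ` V) ` F"
    using finite_subset_image[OF \<F>(1,2)] by blast
  then show ?thesis using that \<F> by auto
qed

text \<open>If \<open>1 \<in> U \<subseteq> K\<close> with \<open>U\<close> open and \<open>K\<close> compact, then \<open>KK\<close> is covered by finitely many
  translates \<open>fU\<close>; as the group generated by these \<open>f\<close> is finite, \<open>U\<close> times it is a compact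
  open subgroup.\<close>

lemma compact_open_subgroup:
  assumes "locally_compact_space T"
  obtains K where "subgroup K G" "openin T K" "compactin T K"
proof -
  obtain U K where UK: "openin T U" "compactin T K" "\<one> \<in> U" "U \<subseteq> K"
    using assms unfolding locally_compact_space_def by (metis one_closed topspace_eq)
  have Kc: "K \<subseteq> carrier G" using compactin_subset_topspace[OF UK(2)] by simp
  define KK where "KK = (\<lambda>(x, y). x \<otimes> y) ` (K \<times> K)"
  have KK: "compactin T KK"
    unfolding KK_def
  proof (rule image_compactin)
    show "compactin (prod_topology T T) (K \<times> K)" using UK by (simp add: compactin_Times)
    show "continuous_map (prod_topology T T) T (\<lambda>(x, y). x \<otimes> y)"
      using group_top by (simp add: group_topology_def)
  qed
  obtain F where F: "finite F" "F \<subseteq> KK" "KK \<subseteq> (\<Union>f\<in>F. (\<lambda>x. f \<otimes> x) ` U)"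
    using KK by (rule finite_translates_cover[OF _ UK(1,3)])
  have Fc: "F \<subseteq> carrier G" using F(2) compactin_subset_topspace[OF KK] by simp
  define E where "E = generate G F"
  have E: "finite E" "subgroup E G" and FE: "F \<subseteq> E"
    using finite_generate[OF F(1) Fc] generate_is_subgroup[OF Fc] by (auto simp: E_def intro: generate.incl)
  have Ec: "E \<subseteq> carrier G" using E(2) subgroup.subset by blast
  define M where "M = (\<Union>f\<in>E. (\<lambda>x. f \<otimes> x) ` U)"
  have split: "\<exists>f\<in>E. \<exists>u\<in>U. x \<otimes> y = f \<otimes> u" if xy: "x \<in> K" "y \<in> K" for x y
  proof -
    have "x \<otimes> y \<in> KK" using xy by (auto simp: KK_def)
    then obtain f where "f \<in> F" "x \<otimes> y \<in> (\<lambda>x. f \<otimes> x) ` U" using F(3) by blast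
    then show ?thesis using FE by blast
  qed
  \<comment> \<open>Two descriptions of one set: as a union of translates of \<open>U\<close> it is
    open, as a finite union of translates of \<open>K\<close> it is compact. They agree because
    \<open>split\<close> with second factor \<open>\<one>\<close> puts \<open>K\<close> into
    translates of \<open>U\<close> by elements of \<open>E\<close>.\<close>
  have M_eq: "M = (\<Union>f\<in>E. (\<lambda>x. f \<otimes> x) ` K)"
  proof
    show "M \<subseteq> (\<Union>f\<in>E. (\<lambda>x. f \<otimes> x) ` K)" using UK by (auto simp: M_def)
    show "(\<Union>f\<in>E. (\<lambda>x. f \<otimes> x) ` K) \<subseteq> M"
    proof clarify
      fix f x assume fx: "f \<in> E" "x \<in> K"
      obtain h u where hu: "h \<in> E" "u \<in> U" "x \<otimes> \<one> = h \<otimes> u" using split[of x \<one>] fx UK by blast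
      have "f \<otimes> x = (f \<otimes> h) \<otimes> u"
        using fx hu Ec Kc UK(4) by (metis m_assoc r_one subsetD)
      moreover have "f \<otimes> h \<in> E" using fx hu E(2) subgroup.m_closed by metis
      ultimately show "f \<otimes> x \<in> M" using hu by (auto simp: M_def)
    qed
  qed
  have Mc: "M \<subseteq> carrier G" using M_eq Ec Kc by auto
  have mult: "x \<otimes> y \<in> M" if xy: "x \<in> M" "y \<in> M" for x y
  proof -
    obtain f u g v where *: "f \<in> E" "u \<in> U" "x = f \<otimes> u" "g \<in> E" "v \<in> U" "y = g \<otimes> v"
      using xy by (auto simp: M_def)
    \<comment> \<open>The product of two elements of \<open>U\<close> lies in \<open>KK\<close> and
      is rewritten as an element of \<open>E\<close> times one of \<open>U\<close>; by commutativity
      the three factors from \<open>E\<close> then combine.\<close>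
    obtain h w where hw: "h \<in> E" "w \<in> U" "u \<otimes> v = h \<otimes> w" using split[of u v] * UK(4) by blast
    have c: "f \<in> carrier G" "g \<in> carrier G" "h \<in> carrier G" "u \<in> carrier G" "v \<in> carrier G" "w \<in> carrier G"
      using * hw Ec Kc UK(4) by auto
    have "x \<otimes> y = (f \<otimes> g) \<otimes> (u \<otimes> v)" using * c by (simp add: m_ac)
    also have "\<dots> = (f \<otimes> g \<otimes> h) \<otimes> w" using c hw by (simp add: m_assoc)
    finally show ?thesis
      using * hw E(2) by (auto simp: M_def subgroup.m_closed)
  qed
  have one: "\<one> \<in> M"
    using UK(3) subgroup.one_closed[OF E(2)] by (force simp: M_def)
  have pow: "x [^] (n :: nat) \<in> M" if "x \<in> M" for x n
    by (induction n) (use one mult that in auto)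
  show ?thesis
  proof
    show "subgroup M G"
    proof
      show "inv x \<in> M" if "x \<in> M" for x
        using pow[OF that, of "p - 1"] inv_eq_pow[of x] that Mc by auto
    qed (use Mc mult one in auto)
    show "openin T M" unfolding M_def using Ec UK(1) by (intro openin_Union) (auto intro: openin_translate)
    show "compactin T M"
      unfolding M_eq
    proof (rule compactin_Union)
      show "finite ((\<lambda>f. (\<lambda>x. f \<otimes> x) ` K) ` E)" using E by simp
      show "compactin T S" if "S \<in> (\<lambda>f. (\<lambda>x. f \<otimes> x) ` K) ` E" for S
        using that Ec UK(2) continuous_map_translate by (auto intro!: image_compactin)
    qed
  qed
qed

section \<open>Small open subgroups of compact groups\<close>

lemma subgroup_closure:
  assumes W: "subgroup W G"
  shows "subgroup (T closure_of W) G"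
proof
  show "T closure_of W \<subseteq> carrier G" using closure_of_subset_topspace[of T W] by simp
  have Wc: "W \<subseteq> carrier G" using subgroup.subset[OF W] .
  show "\<one> \<in> T closure_of W"
    using closure_of_subset[of W T] Wc subgroup.one_closed[OF W] by auto
  have mult: "continuous_map (prod_topology T T) T (\<lambda>(x, y). x \<otimes> y)" and inv: "continuous_map T T (\<lambda>x. inv x)"
    using group_top by (simp_all add: group_topology_def)
  fix x assume x: "x \<in> T closure_of W"
  have "(\<lambda>x. inv x) ` (T closure_of W) \<subseteq> T closure_of ((\<lambda>x. inv x) ` W)"
    using continuous_map_image_closure_subset[OF inv] by blast
  also have "\<dots> \<subseteq> T closure_of W"
    using subgroup.m_inv_closed[OF W] by (intro closure_of_mono) auto
  finally show "inv x \<in> T closure_of W" using x by auto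
  fix y assume y: "y \<in> T closure_of W"
  have "(\<lambda>(x, y). x \<otimes> y) ` (prod_topology T T closure_of (W \<times> W)) \<subseteq> T closure_of ((\<lambda>(x, y). x \<otimes> y) ` (W \<times> W))"
    using continuous_map_image_closure_subset[OF mult] by blast
  also have "\<dots> \<subseteq> T closure_of W"
    using subgroup.m_closed[OF W] by (intro closure_of_mono) auto
  finally show "x \<otimes> y \<in> T closure_of W" using x y by (auto simp: closure_of_Times)
qed

text \<open>The complement of \<open>N\<close> is the union of the translates by the finitely many
  representatives outside \<open>N\<close>, and each of these is closed.\<close>

lemma closed_finite_index_imp_open:
  assumes N: "subgroup N G" "closedin T N"
    and R: "finite R" "R \<subseteq> carrier G" "carrier G \<subseteq> (\<Union>r\<in>R. (\<lambda>x. r \<otimes> x) ` N)"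
  shows "openin T N"
proof -
  let ?C = "\<Union>r\<in>R - N. (\<lambda>x. r \<otimes> x) ` N"
  note Nc = subgroup.subset[OF N(1)]
  have "closedin T ?C"
    using R N(2) by (intro closedin_Union) (auto intro: closedin_translate)
  moreover have "N = topspace T - ?C"
  proof -
    have "r \<in> N" if "r \<in> R" "n \<in> N" "r \<otimes> n \<in> N" for r n
    proof -
      have "r \<otimes> n \<otimes> inv n \<in> N"
        using subgroup.m_closed[OF N(1) that(3) subgroup.m_inv_closed[OF N(1) that(2)]] .
      moreover have "r \<otimes> n \<otimes> inv n = r" using that R Nc by (metis inv_solve_right' m_closed subsetD)
      ultimately show ?thesis by simp
    qed
    then have "N \<subseteq> topspace T - ?C" using Nc by auto
    moreover have "topspace T - ?C \<subseteq> N"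
    proof
      fix x assume x: "x \<in> topspace T - ?C"
      then obtain r n where "r \<in> R" "n \<in> N" "x = r \<otimes> n" using R(3) by auto
      then show "x \<in> N" using x subgroup.m_closed[OF N(1)] by auto
    qed
    ultimately show ?thesis by blast
  qed
  ultimately show ?thesis by (metis openin_diff openin_topspace)
qed

text \<open>If \<open>f \<otimes> v\<close> and \<open>f \<otimes> w\<close> both lie in
  \<open>H\<close>, their quotient is \<open>inv v \<otimes> w\<close>, an element of
  \<open>A\<close>. So each translate of \<open>V\<close> meets \<open>H\<close> in at most
  \<open>card (H \<inter> A)\<close> points, and \<open>A\<close> has density at least
  \<open>1 / card F\<close> in \<open>H\<close>. The number of homomorphisms therefore does not
  depend on \<open>H\<close>.\<close>

lemma bogolyubov_finite_subgroup:
  assumes V: "V \<subseteq> carrier G" "\<And>x y. x \<in> V \<Longrightarrow> y \<in> V \<Longrightarrow> x \<otimes> y \<in> A" "\<And>x. x \<in> V \<Longrightarrow> inv x \<in> V"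
    and F: "finite F" "F \<subseteq> carrier G" "carrier G \<subseteq> (\<Union>f\<in>F. (\<lambda>x. f \<otimes> x) ` V)"
    and H: "subgroup H G" "finite H"
  obtains \<Phi> :: "nat \<Rightarrow> 'a \<Rightarrow> int" where
    "\<And>i. \<Phi> i \<in> hom (G\<lparr>carrier := H\<rparr>) (integer_mod_group p)"
    "\<And>x. x \<in> H \<Longrightarrow> (\<And>i. i < (card F)\<^sup>2 \<Longrightarrow> \<Phi> i x = 0) \<Longrightarrow>
      \<exists>a\<in>A. \<exists>b\<in>A. \<exists>c\<in>A. \<exists>d\<in>A. x = c \<otimes> d \<otimes> inv (a \<otimes> b)"
proof -
  interpret H: elem_abelian "G\<lparr>carrier := H\<rparr>" p by (rule elem_abelian_subgroup[OF H(1)])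
  have Hc: "H \<subseteq> carrier G" using subgroup.subset[OF H(1)] .
  have card_le: "card (H \<inter> (\<lambda>x. f \<otimes> x) ` V) \<le> card (H \<inter> A)" if f: "f \<in> F" for f
  proof (cases "H \<inter> (\<lambda>x. f \<otimes> x) ` V = {}")
    case False
    then obtain v where v: "v \<in> V" "f \<otimes> v \<in> H" by auto
    have "inj_on (\<lambda>x. inv (f \<otimes> v) \<otimes> x) (H \<inter> (\<lambda>x. f \<otimes> x) ` V)"
    proof (rule inj_on_subset)
      have "inv (f \<otimes> v) \<in> carrier G" using v Hc by auto
      then show "inj_on (\<lambda>x. inv (f \<otimes> v) \<otimes> x) (carrier G)" by (rule inj_on_cmult)
    qed (use Hc in auto)
    moreover have "(\<lambda>x. inv (f \<otimes> v) \<otimes> x) ` (H \<inter> (\<lambda>x. f \<otimes> x) ` V) \<subseteq> H \<inter> A"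
    proof clarify
      fix w assume w: "w \<in> V" "f \<otimes> w \<in> H"
      have c: "f \<in> carrier G" "v \<in> carrier G" "w \<in> carrier G" using f v w F V by auto
      have "inv (f \<otimes> v) \<otimes> (f \<otimes> w) = inv v \<otimes> (inv f \<otimes> (f \<otimes> w))"
        using c by (simp add: inv_mult_group m_assoc)
      also have "\<dots> = inv v \<otimes> w" using c l_cancel_inv[of "inv f" w] by simp
      also have "\<dots> \<in> A" using V v w by auto
      finally show "inv (f \<otimes> v) \<otimes> (f \<otimes> w) \<in> H \<inter> A"
        using v w H(1) by (simp add: subgroup.m_closed subgroup.m_inv_closed)
    qed
    ultimately show ?thesis using H(2) by (intro card_inj_on_le) auto
  qed simp
  have "H = (\<Union>f\<in>F. H \<inter> (\<lambda>x. f \<otimes> x) ` V)" using F(3) Hc by blast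
  then have "card H \<le> (\<Sum>f\<in>F. card (H \<inter> (\<lambda>x. f \<otimes> x) ` V))"
    using card_UN_le[OF F(1), of "\<lambda>f. H \<inter> (\<lambda>x. f \<otimes> x) ` V"] by simp
  also have "\<dots> \<le> card F * card (H \<inter> A)"
    using sum_bounded_above[of F "\<lambda>f. card (H \<inter> (\<lambda>x. f \<otimes> x) ` V)" "card (H \<inter> A)"] card_le by simp
  finally have le: "card H \<le> card F * card (H \<inter> A)" .
  have "H \<noteq> {}" using subgroup.one_closed[OF H(1)] by auto
  then have "H \<inter> A \<noteq> {}" using le H(2) by (metis card_0_eq card.empty le_zero_eq mult_0_right)
  then have hyps: "finite (carrier (G\<lparr>carrier := H\<rparr>))" "H \<inter> A \<subseteq> carrier (G\<lparr>carrier := H\<rparr>)" "H \<inter> A \<noteq> {}"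
    "card (carrier (G\<lparr>carrier := H\<rparr>)) \<le> card F * card (H \<inter> A)"
    using le H(2) by auto
  obtain S where S: "S \<subseteq> hom (G\<lparr>carrier := H\<rparr>) (integer_mod_group p)" "finite S" "card S \<le> (card F)\<^sup>2"
    "\<And>x. x \<in> carrier (G\<lparr>carrier := H\<rparr>) \<Longrightarrow> (\<And>\<phi>. \<phi> \<in> S \<Longrightarrow> \<phi> x = 0) \<Longrightarrow>
       \<exists>a\<in>H \<inter> A. \<exists>b\<in>H \<inter> A. \<exists>c\<in>H \<inter> A. \<exists>d\<in>H \<inter> A. x = c \<otimes>\<^bsub>G\<lparr>carrier := H\<rparr>\<^esub> d \<otimes>\<^bsub>G\<lparr>carrier := H\<rparr>\<^esub>
         inv\<^bsub>G\<lparr>carrier := H\<rparr>\<^esub> (a \<otimes>\<^bsub>G\<lparr>carrier := H\<rparr>\<^esub> b)"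
    by (rule H.bogolyubov[OF hyps]) blast
  obtain h where h: "bij_betw h {0..<card S} S" using ex_bij_betw_nat_finite[OF S(2)] by blast
  \<comment> \<open>Padding with zero homomorphisms gives every \<open>H\<close> a sequence over the
    same index set, as gluing requires.\<close>
  define \<Phi> where "\<Phi> i = (if i < card S then h i else (\<lambda>_. 0))" for i
  show ?thesis
  proof
    show "\<Phi> i \<in> hom (G\<lparr>carrier := H\<rparr>) (integer_mod_group p)" for i
    proof (cases "i < card S")
      case True
      then show ?thesis using S(1) bij_betw_apply[OF h, of i] by (auto simp: \<Phi>_def)
    next
      case False
      then show ?thesis using p_pos by (auto simp: \<Phi>_def intro!: homI)
    qed
    fix x assume x: "x \<in> H" and *: "\<And>i. i < (card F)\<^sup>2 \<Longrightarrow> \<Phi> i x = 0"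
    have "\<phi> x = 0" if \<phi>: "\<phi> \<in> S" for \<phi>
    proof -
      have "\<phi> \<in> h ` {0..<card S}" using \<phi> h by (simp add: bij_betw_def)
      then obtain i where "i < card S" "\<phi> = h i" by auto
      then show ?thesis using *[of i] S(3) by (simp add: \<Phi>_def)
    qed
    then obtain a b c d where abcd: "a \<in> H \<inter> A" "b \<in> H \<inter> A" "c \<in> H \<inter> A" "d \<in> H \<inter> A"
      "x = c \<otimes> d \<otimes> inv\<^bsub>G\<lparr>carrier := H\<rparr>\<^esub> (a \<otimes> b)" using S(4)[of x] x by auto
    moreover have "a \<otimes> b \<in> H" using abcd H(1) by (simp add: subgroup.m_closed)
    ultimately show "\<exists>a\<in>A. \<exists>b\<in>A. \<exists>c\<in>A. \<exists>d\<in>A. x = c \<otimes> d \<otimes> inv (a \<otimes> b)"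
      using m_inv_consistent[OF H(1)] by auto
  qed
qed

text \<open>Bogolyubov's lemma gives the required subgroup inside every finite subgroup, with an index
  bound independent of the finite subgroup; Tychonoff's theorem glues these together.\<close>

lemma small_hom_kernel:
  assumes compact: "compact_space T" and U: "openin T U" "\<one> \<in> U"
  obtains m :: nat and \<phi> :: "nat \<Rightarrow> 'a \<Rightarrow> int" where
    "\<And>i. i < m \<Longrightarrow> \<phi> i \<in> hom G (integer_mod_group p)"
    "\<And>x. x \<in> carrier G \<Longrightarrow> (\<And>i. i < m \<Longrightarrow> \<phi> i x = 0) \<Longrightarrow> x \<in> U"
proof -
  \<comment> \<open>Three halvings match the shape
    \<open>c \<otimes> d \<otimes> inv (a \<otimes> b)\<close>: products from \<open>V3\<close> lie
    in \<open>V2\<close>, which plays the role of \<open>A\<close>; \<open>c \<otimes> d\<close> and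
    \<open>a \<otimes> b\<close> lie in \<open>V1\<close>; their quotient lies in
    \<open>U\<close>.\<close>
  obtain V1 where V1: "openin T V1" "\<one> \<in> V1" "\<And>x. x \<in> V1 \<Longrightarrow> inv x \<in> V1"
    "\<And>x y. x \<in> V1 \<Longrightarrow> y \<in> V1 \<Longrightarrow> x \<otimes> y \<in> U" by (rule nbhd_halve[OF U]) blast
  obtain V2 where V2: "openin T V2" "\<one> \<in> V2" "\<And>x. x \<in> V2 \<Longrightarrow> inv x \<in> V2"
    "\<And>x y. x \<in> V2 \<Longrightarrow> y \<in> V2 \<Longrightarrow> x \<otimes> y \<in> V1" by (rule nbhd_halve[OF V1(1,2)]) blast
  obtain V3 where V3: "openin T V3" "\<one> \<in> V3" "\<And>x. x \<in> V3 \<Longrightarrow> inv x \<in> V3"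
    "\<And>x y. x \<in> V3 \<Longrightarrow> y \<in> V3 \<Longrightarrow> x \<otimes> y \<in> V2" by (rule nbhd_halve[OF V2(1,2)]) blast
  have "compactin T (carrier G)" using compact by (simp add: compact_space_def)
  then obtain F where F: "finite F" "F \<subseteq> carrier G" "carrier G \<subseteq> (\<Union>f\<in>F. (\<lambda>x. f \<otimes> x) ` V3)"
    by (rule finite_translates_cover[OF _ V3(1,2)])
  define m where "m = (card F)\<^sup>2"
  \<comment> \<open>A point of \<open>?X\<close> is an \<open>m\<close>-tuple of arbitrary functions
    on the group with values below \<open>p\<close>. \<open>C E\<close> demands the homomorphism law
    and the inclusion of the common zeros in \<open>U\<close> for elements of \<open>E\<close> only.
    This concerns finitely many coordinates if \<open>E\<close> is finite, and a point common to all
    such \<open>C E\<close> is the desired family.\<close>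
  let ?I = "carrier G \<times> {..<m}"
  let ?D = "\<lambda>_ :: 'a \<times> nat. {0..<int p}"
  let ?X = "product_topology (\<lambda>c. discrete_topology (?D c)) ?I"
  define P where "P E g \<longleftrightarrow>
      (\<forall>x\<in>E. \<forall>y\<in>E. \<forall>i<m. g (x \<otimes> y, i) = (g (x, i) + g (y, i)) mod int p) \<and>
      (\<forall>x\<in>E. (\<forall>i<m. g (x, i) = 0) \<longrightarrow> x \<in> U)" for E and g :: "'a \<times> nat \<Rightarrow> int"
  define C where "C E = {g \<in> \<Pi>\<^sub>E c\<in>?I. ?D c. P E g}" for E
  have closed: "closedin ?X (C E)" if E: "finite E" "E \<subseteq> carrier G" for E
    unfolding C_def
  proof (rule closedin_product_discrete_finite_support)
    let ?J = "(E \<union> (\<lambda>(x, y). x \<otimes> y) ` (E \<times> E)) \<times> {..<m}"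
    show "finite ?J" using E by auto
    show "?J \<subseteq> ?I" using E by auto
    fix g h assume eq: "\<And>j. j \<in> ?J \<Longrightarrow> g j = h j" and P: "P E g"
    have 1: "g (x, i) = h (x, i)" if "x \<in> E" "i < m" for x i using eq that by simp
    have 2: "g (x \<otimes> y, i) = h (x \<otimes> y, i)" if "x \<in> E" "y \<in> E" "i < m" for x y i
      using eq[of "(x \<otimes> y, i)"] that by force
    show "P E h" unfolding P_def
    proof (intro conjI ballI allI impI)
      fix x y i assume "x \<in> E" "y \<in> E" "i < m"
      then show "h (x \<otimes> y, i) = (h (x, i) + h (y, i)) mod int p"
        using P 1[of x i] 1[of y i] 2[of x y i] unfolding P_def by metis
    next
      fix x assume "x \<in> E" "\<forall>i<m. h (x, i) = 0"
      then show "x \<in> U" using P 1[of x] unfolding P_def by metis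
    qed
  qed
  have nonempty: "C E \<noteq> {}" if E: "finite E" "E \<subseteq> carrier G" for E
  proof -
    let ?H = "generate G E"
    have H: "subgroup ?H G" "finite ?H" "E \<subseteq> ?H"
      using E finite_generate[OF E] generate_is_subgroup by (auto intro: generate.incl)
    obtain \<Phi> :: "nat \<Rightarrow> 'a \<Rightarrow> int" where \<Phi>:
      "\<And>i. \<Phi> i \<in> hom (G\<lparr>carrier := ?H\<rparr>) (integer_mod_group p)"
      "\<And>x. x \<in> ?H \<Longrightarrow> (\<And>i. i < m \<Longrightarrow> \<Phi> i x = 0) \<Longrightarrow>
        \<exists>a\<in>V2. \<exists>b\<in>V2. \<exists>c\<in>V2. \<exists>d\<in>V2. x = c \<otimes> d \<otimes> inv (a \<otimes> b)"
      unfolding m_def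
      by (rule bogolyubov_finite_subgroup[of V3 V2 F ?H]) (use V3 F H openin_subset[OF V3(1)] in auto)
    \<comment> \<open>\<open>P E\<close> inspects only elements of \<open>E\<close> and products of
      two of them, all in \<open>?H\<close>; elsewhere in the group 0 is as good as any value below
      \<open>p\<close>. The value \<open>undefined\<close> off \<open>?I\<close> is forced by
      extensionality.\<close>
    define g where "g c = (if c \<in> ?I then if fst c \<in> ?H then \<Phi> (snd c) (fst c) else 0 else undefined)" for c
    have gH: "g (x, i) = \<Phi> i x" if "x \<in> ?H" "i < m" for x i
      using that subgroup.mem_carrier[OF H(1)] by (simp add: g_def)
    have "\<Phi> i x \<in> {0..<int p}" if "x \<in> ?H" for x i
      using hom_in_carrier[OF \<Phi>(1)[of i], of x] that by simp
    then have "g \<in> (\<Pi>\<^sub>E c\<in>?I. ?D c)" using p_pos by (auto simp: g_def PiE_iff extensional_def)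
    moreover have "P E g" unfolding P_def
    proof (intro conjI ballI allI impI)
      fix x y i assume xy: "x \<in> E" "y \<in> E" "i < m"
      then have "x \<in> ?H" "y \<in> ?H" "x \<otimes> y \<in> ?H" using H by (auto intro: subgroup.m_closed[OF H(1)])
      then show "g (x \<otimes> y, i) = (g (x, i) + g (y, i)) mod int p"
        using hom_mult[OF \<Phi>(1)[of i], of x y] xy by (simp add: gH)
    next
      fix x assume x: "x \<in> E" "\<forall>i<m. g (x, i) = 0"
      then have "x \<in> ?H" using H by auto
      then obtain a b c d where "a \<in> V2" "b \<in> V2" "c \<in> V2" "d \<in> V2" "x = c \<otimes> d \<otimes> inv (a \<otimes> b)"
        using \<Phi>(2)[of x] x gH by auto
      then show "x \<in> U" using V1(3,4) V2(4) by metis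
    qed
    ultimately show ?thesis by (auto simp: C_def)
  qed
  have "compact_space ?X" by (simp add: compact_space_product_topology compact_space_discrete_topology)
  moreover have "\<forall>S\<in>C ` {E. finite E \<and> E \<subseteq> carrier G}. closedin ?X S" using closed by blast
  moreover have "\<Inter>\<F> \<noteq> {}" if \<F>: "finite \<F>" "\<F> \<subseteq> C ` {E. finite E \<and> E \<subseteq> carrier G}" for \<F>
  proof -
    obtain \<E> where \<E>: "\<E> \<subseteq> {E. finite E \<and> E \<subseteq> carrier G}" "finite \<E>" "\<F> = C ` \<E>"
      using finite_subset_image[OF \<F>] by blast
    have "C (\<Union>\<E>) \<noteq> {}" using \<E> by (intro nonempty) auto
    moreover have "C (\<Union>\<E>) \<subseteq> \<Inter>\<F>"
      unfolding \<E>(3) C_def P_def by blast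
    ultimately show ?thesis by blast
  qed
  ultimately have "\<Inter>(C ` {E. finite E \<and> E \<subseteq> carrier G}) \<noteq> {}"
    unfolding compact_space_fip by blast
  then obtain g where g: "\<And>E. finite E \<Longrightarrow> E \<subseteq> carrier G \<Longrightarrow> g \<in> C E" by blast
  show ?thesis
  proof (rule that[of m "\<lambda>i x. g (x, i)"])
    fix i assume i: "i < m"
    show "(\<lambda>x. g (x, i)) \<in> hom G (integer_mod_group p)"
    proof (rule homI)
      fix x assume x: "x \<in> carrier G"
      have "g \<in> (\<Pi>\<^sub>E c\<in>?I. ?D c)" using g[of "{}"] by (simp add: C_def)
      then show "g (x, i) \<in> carrier (integer_mod_group p)" using PiE_mem[of g ?I ?D "(x, i)"] x i by simp
      fix y assume y: "y \<in> carrier G"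
      show "g (x \<otimes> y, i) = g (x, i) \<otimes>\<^bsub>integer_mod_group p\<^esub> g (y, i)"
        using g[of "{x, y}"] x y i by (simp add: C_def P_def)
    qed
  next
    fix x assume "x \<in> carrier G" "\<And>i. i < m \<Longrightarrow> g (x, i) = 0"
    then show "x \<in> U" using g[of "{x}"] by (simp add: C_def P_def)
  qed
qed

text \<open>The homomorphisms from \<open>small_hom_kernel\<close> need not be continuous, so their
  common kernel \<open>W\<close> need not be closed. Its closure is a closed subgroup of finite
  index, hence open. Any \<open>x\<close> in the closure has a translate
  \<open>x \<otimes> v\<close> with \<open>v \<in> V\<close> in \<open>W \<subseteq> V\<close>, so
  \<open>x\<close> remains in \<open>U\<close>.\<close>

lemma small_open_subgroup:
  assumes compact: "compact_space T" and U: "openin T U" "\<one> \<in> U"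
  obtains N where "subgroup N G" "openin T N" "N \<subseteq> U"
proof -
  obtain V where V: "openin T V" "\<one> \<in> V" "\<And>x. x \<in> V \<Longrightarrow> inv x \<in> V"
    "\<And>x y. x \<in> V \<Longrightarrow> y \<in> V \<Longrightarrow> x \<otimes> y \<in> U" by (rule nbhd_halve[OF U]) blast
  obtain m :: nat and \<phi> :: "nat \<Rightarrow> 'a \<Rightarrow> int" where \<phi>:
    "\<And>i. i < m \<Longrightarrow> \<phi> i \<in> hom G (integer_mod_group p)"
    "\<And>x. x \<in> carrier G \<Longrightarrow> (\<And>i. i < m \<Longrightarrow> \<phi> i x = 0) \<Longrightarrow> x \<in> V"
    by (rule small_hom_kernel[OF compact V(1,2)]) blast
  define W where "W = {x \<in> carrier G. \<forall>i<m. \<phi> i x = 0}"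
  have \<phi>_diff: "\<phi> i (inv x \<otimes> y) = (\<phi> i y - \<phi> i x) mod int p"
    if "i < m" "x \<in> carrier G" "y \<in> carrier G" for i x y
  proof -
    have "\<phi> i (inv x) = (- \<phi> i x) mod int p"
      using hom_Zp_int_pow[OF \<phi>(1)[OF that(1)] that(2), of "-1"] that by (simp add: int_pow_neg)
    then show ?thesis using hom_mult[OF \<phi>(1)[OF that(1)], of "inv x" y] that by (simp add: mod_simps)
  qed
  have \<phi>_one: "\<phi> i \<one> = 0" if "i < m" for i
    using hom_one[OF \<phi>(1)[OF that]] by simp
  have W: "subgroup W G"
  proof
    show "\<one> \<in> W" using \<phi>_one by (simp add: W_def)
    show "inv x \<in> W" if "x \<in> W" for x
      using that \<phi>_diff[of _ x \<one>] \<phi>_one by (auto simp: W_def)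
    show "x \<otimes> y \<in> W" if "x \<in> W" "y \<in> W" for x y
      using that hom_mult[OF \<phi>(1)] by (auto simp: W_def)
  qed (auto simp: W_def)
  let ?N = "T closure_of W"
  have N: "subgroup ?N G" by (rule subgroup_closure[OF W])
  \<comment> \<open>Equal value vectors mean equal cosets of \<open>W\<close>, and there are at most
    \<open>p ^ m\<close> vectors; \<open>R\<close> realizes each vector that occurs.\<close>
  define f where "f x = (\<lambda>i\<in>{..<m}. \<phi> i x)" for x
  have "f x \<in> (\<Pi>\<^sub>E i\<in>{..<m}. {0..<int p})" if "x \<in> carrier G" for x
    unfolding f_def restrict_PiE_iff using hom_in_carrier[OF \<phi>(1) that] by simp
  then have "f ` carrier G \<subseteq> (\<Pi>\<^sub>E i\<in>{..<m}. {0..<int p})" by blast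
  then have "finite (f ` carrier G)" by (rule finite_subset) (auto intro: finite_PiE)
  then obtain R where R: "R \<subseteq> carrier G" "finite R" "f ` carrier G = f ` R"
    using finite_subset_image[of "f ` carrier G" f "carrier G"] by blast
  have "carrier G \<subseteq> (\<Union>r\<in>R. (\<lambda>x. r \<otimes> x) ` ?N)"
  proof
    fix x assume x: "x \<in> carrier G"
    then obtain r where r: "r \<in> R" "f x = f r" using R(3) by blast
    have "\<phi> i x = \<phi> i r" if "i < m" for i
      using fun_cong[OF r(2), of i] that by (simp add: f_def)
    then have "inv r \<otimes> x \<in> W" using \<phi>_diff x r R(1) by (auto simp: W_def)
    then have "inv r \<otimes> x \<in> ?N" using closure_of_subset[of W T] W_def by auto
    moreover have "x = r \<otimes> (inv r \<otimes> x)" using l_cancel_inv[of r x] x r R(1) by auto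
    ultimately show "x \<in> (\<Union>r\<in>R. (\<lambda>x. r \<otimes> x) ` ?N)" using r by blast
  qed
  then have "openin T ?N"
    using closed_finite_index_imp_open[OF N _ R(2,1)] by simp
  moreover have "?N \<subseteq> U"
  proof
    fix x assume x: "x \<in> ?N"
    then have xc: "x \<in> carrier G" using subgroup.mem_carrier[OF N] by simp
    have Vc: "V \<subseteq> carrier G" using openin_subset[OF V(1)] by simp
    have "x \<in> (\<lambda>v. x \<otimes> v) ` V" using V(2) xc by (intro image_eqI[of _ _ \<one>]) auto
    then obtain v where v: "v \<in> V" "x \<otimes> v \<in> W"
      using x openin_translate[OF xc V(1)] unfolding in_closure_of by blast
    then have "x \<otimes> v \<in> V" using \<phi>(2) by (auto simp: W_def)
    then have "x \<otimes> v \<otimes> inv v \<in> U" using V(3,4) v by blast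
    then show "x \<in> U" using v xc Vc by (metis inv_closed m_assoc r_inv r_one subsetD)
  qed
  ultimately show ?thesis using that N by blast
qed

section \<open>Continuous characters and compact groups\<close>

lemma hom_continuous:
  assumes N: "subgroup N G" "openin T N"
    and \<phi>: "\<phi> \<in> hom G (integer_mod_group p)" "\<And>n. n \<in> N \<Longrightarrow> \<phi> n = 0"
  shows "continuous_map T (discrete_topology {0..<int p}) \<phi>"
proof -
  have r: "\<phi> x \<in> {0..<int p}" if "x \<in> carrier G" for x
    using hom_in_carrier[OF \<phi>(1) that] by simp
  have "openin T {x \<in> carrier G. \<phi> x \<in> U}" for U
  proof (subst openin_subopen, clarify)
    fix x assume x: "x \<in> carrier G" "\<phi> x \<in> U"
    have "\<phi> (x \<otimes> n) = \<phi> x" if "n \<in> N" for n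
      using hom_mult[OF \<phi>(1), of x n] x subgroup.mem_carrier[OF N(1) that] \<phi>(2)[OF that] r[of x] by simp
    then have "(\<lambda>n. x \<otimes> n) ` N \<subseteq> {x \<in> carrier G. \<phi> x \<in> U}"
      using x subgroup.mem_carrier[OF N(1)] by auto
    moreover have "x \<in> (\<lambda>n. x \<otimes> n) ` N"
      using x subgroup.one_closed[OF N(1)] by (intro image_eqI[of _ _ \<one>]) auto
    ultimately show "\<exists>S. openin T S \<and> x \<in> S \<and> S \<subseteq> {x \<in> carrier G. \<phi> x \<in> U}"
      using openin_translate[OF x(1) N(2)] by blast
  qed
  then show ?thesis using r by (auto simp: continuous_map_def)
qed

text \<open>A homomorphism that vanishes on an open subgroup is continuous, so once an open subgroup
  \<open>N\<close> avoids \<open>x\<close>, the purely algebraic separation of \<open>x\<close> from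
  \<open>N\<close> suffices.\<close>

lemma separating_character:
  assumes "compact_space T" "Hausdorff_space T" "x \<in> carrier G" "x \<noteq> \<one>"
  obtains \<phi> where "\<phi> \<in> hom G (integer_mod_group p)"
    "continuous_map T (discrete_topology {0..<int p}) \<phi>" "\<phi> x = 1"
proof -
  have "closedin T {x}" using assms closedin_Hausdorff_singleton by fastforce
  then have "openin T (carrier G - {x})" by (metis openin_diff openin_topspace topspace_eq)
  moreover have "\<one> \<in> carrier G - {x}" using assms by auto
  ultimately obtain N where N: "subgroup N G" "openin T N" "N \<subseteq> carrier G - {x}"
    by (rule small_open_subgroup[OF assms(1)])
  then obtain \<phi> where "\<phi> \<in> hom G (integer_mod_group p)" "\<And>n. n \<in> N \<Longrightarrow> \<phi> n = 0" "\<phi> x = 1"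
    using separating_hom[of N x] assms by blast
  then show ?thesis using that hom_continuous[OF N(1,2)] by blast
qed

text \<open>A maximal family of continuous characters whose finite subfamilies take all values separates
  points, and by compactness the whole family takes all values.\<close>

theorem compact_homeomorphic_power:
  assumes compact: "compact_space T" and Haus: "Hausdorff_space T"
  shows "\<exists>X :: ('a \<Rightarrow> int) set. T homeomorphic_space product_topology (\<lambda>_. discrete_topology {0..<int p}) X"
proof -
  define D where "D = {\<phi> \<in> hom G (integer_mod_group p). continuous_map T (discrete_topology {0..<int p}) \<phi>}"
  \<comment> \<open>This is linear independence of characters in a form that survives unions of
    chains and extends from finite subfamilies to the whole family by compactness.\<close>
  define good where "good X \<longleftrightarrow> X \<subseteq> D \<and>
    (\<forall>F t. finite F \<longrightarrow> F \<subseteq> X \<longrightarrow> (\<forall>\<phi>\<in>F. t \<phi> \<in> {0..<int p}) \<longrightarrow> (\<exists>g\<in>carrier G. \<forall>\<phi>\<in>F. \<phi> g = t \<phi>))"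
    for X :: "('a \<Rightarrow> int) set"
  have "\<exists>M\<in>Collect good. \<forall>X\<in>Collect good. M \<subseteq> X \<longrightarrow> X = M"
  proof (rule subset_Zorn_nonempty)
    have "good {}" by (auto simp: good_def)
    then show "Collect good \<noteq> {}" by blast
    fix C assume C: "C \<noteq> {}" "subset.chain (Collect good) C"
    have "\<exists>g\<in>carrier G. \<forall>\<phi>\<in>F. \<phi> g = t \<phi>"
      if F: "finite F" "F \<subseteq> \<Union>C" "\<forall>\<phi>\<in>F. t \<phi> \<in> {0..<int p}" for F t
    proof -
      obtain X where X: "X \<in> C" "F \<subseteq> X"
        using finite_subset_Union_chain[OF F(1,2) C(1) C(2)] .
      then have "good X" using C by (auto simp: subset_chain_def)
      then show ?thesis using F X unfolding good_def by blast
    qed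
    moreover have "\<Union>C \<subseteq> D"
      using C unfolding subset_chain_def good_def by blast
    ultimately show "\<Union>C \<in> Collect good" unfolding good_def by blast
  qed
  then obtain X where X: "good X" and max: "\<And>Y. good Y \<Longrightarrow> X \<subseteq> Y \<Longrightarrow> Y = X"
    unfolding Bex_def Ball_def mem_Collect_eq by blast
  have XD: "X \<subseteq> D" using X unfolding good_def by blast
  have hom: "\<phi> \<in> hom G (integer_mod_group p)" and cont: "continuous_map T (discrete_topology {0..<int p}) \<phi>"
    if "\<phi> \<in> X" for \<phi>
    using that XD by (auto simp: D_def)
  have trivial: "g = \<one>" if g: "g \<in> carrier G" "\<And>\<phi>. \<phi> \<in> X \<Longrightarrow> \<phi> g = 0" for g
  proof (rule ccontr)
    assume "g \<noteq> \<one>"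
    then obtain \<psi> where \<psi>: "\<psi> \<in> D" "\<psi> g = 1"
      using separating_character[OF compact Haus g(1)] unfolding D_def by blast
    have "\<psi> \<notin> X" using g(2) \<psi>(2) by fastforce
    \<comment> \<open>Some \<open>h\<close> has the right values on \<open>F - {\<psi>}\<close>.
      Multiplying it by a power of \<open>g\<close> corrects \<psi>, whose value at \<open>g\<close>
      is 1, and leaves the other characters alone, since they vanish at \<open>g\<close>.\<close>
    have ext: "\<exists>h\<in>carrier G. \<forall>\<phi>\<in>F. \<phi> h = t \<phi>"
      if F: "finite F" "F \<subseteq> insert \<psi> X" "\<forall>\<phi>\<in>F. t \<phi> \<in> {0..<int p}" for F t
    proof -
      have "finite (F - {\<psi>})" "F - {\<psi>} \<subseteq> X" "\<forall>\<phi>\<in>F - {\<psi>}. t \<phi> \<in> {0..<int p}" using F by auto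
      then obtain h where h: "h \<in> carrier G" "\<forall>\<phi>\<in>F - {\<psi>}. \<phi> h = t \<phi>"
        using X unfolding good_def by blast
      let ?h = "h \<otimes> g [^] (t \<psi> - \<psi> h)"
      have \<psi>hom: "\<psi> \<in> hom G (integer_mod_group p)" using \<psi> by (simp add: D_def)
      have *: "\<phi> ?h = (\<phi> h + (t \<psi> - \<psi> h) * \<phi> g) mod int p" if "\<phi> \<in> hom G (integer_mod_group p)" for \<phi>
        using hom_mult[OF that, of h "g [^] (t \<psi> - \<psi> h)"] hom_Zp_int_pow[OF that] h g by (simp add: mod_simps)
      have "\<phi> ?h = t \<phi>" if \<phi>: "\<phi> \<in> F" for \<phi>
      proof (cases "\<phi> = \<psi>")
        case True
        then show ?thesis using *[OF \<psi>hom] \<psi>(2) F(3) \<phi> by auto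
      next
        case False
        then have "\<phi> \<in> X" using \<phi> F(2) by auto
        then have "\<phi> ?h = \<phi> h mod int p" using *[OF hom[OF \<open>\<phi> \<in> X\<close>]] g(2)[OF \<open>\<phi> \<in> X\<close>] by simp
        moreover have "\<phi> h = t \<phi>" using h(2) \<phi> False by blast
        ultimately show ?thesis using F(3) \<phi> by simp
      qed
      then show ?thesis using h g by (intro bexI[of _ ?h]) auto
    qed
    have "good (insert \<psi> X)"
      unfolding good_def
    proof (intro conjI allI impI)
      show "insert \<psi> X \<subseteq> D" using XD \<psi>(1) by blast
      show "\<exists>g\<in>carrier G. \<forall>\<phi>\<in>F. \<phi> g = t \<phi>"
        if "finite F" "F \<subseteq> insert \<psi> X" "\<forall>\<phi>\<in>F. t \<phi> \<in> {0..<int p}" for F t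
        using that by (rule ext)
    qed
    then show False using max[of "insert \<psi> X"] \<open>\<psi> \<notin> X\<close> by auto
  qed
  define \<Psi> where "\<Psi> g = (\<lambda>\<phi>\<in>X. \<phi> g)" for g
  let ?Y = "product_topology (\<lambda>_ :: 'a \<Rightarrow> int. discrete_topology {0..<int p}) X"
  have "continuous_map T ?Y \<Psi>"
    using cont by (auto simp: continuous_map_componentwise \<Psi>_def)
  moreover have "inj_on \<Psi> (carrier G)"
  proof (rule inj_onI)
    fix x y assume xy: "x \<in> carrier G" "y \<in> carrier G" "\<Psi> x = \<Psi> y"
    have "x \<otimes> inv y = \<one>"
    proof (rule trivial)
      fix \<phi> assume \<phi>: "\<phi> \<in> X"
      have "\<phi> x = \<phi> y" using fun_cong[OF xy(3), of \<phi>] \<phi> by (simp add: \<Psi>_def)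
      moreover have "\<phi> (inv y) = (- \<phi> y) mod int p"
        using hom_Zp_int_pow[OF hom[OF \<phi>] xy(2), of "-1"] xy by (simp add: int_pow_neg)
      ultimately show "\<phi> (x \<otimes> inv y) = 0"
        using hom_mult[OF hom[OF \<phi>], of x "inv y"] xy by (simp add: mod_simps)
    qed (use xy in auto)
    then show "x = y" using xy by (metis inv_equality inv_inv inv_closed)
  qed
  moreover have "\<Psi> ` carrier G = topspace ?Y"
  proof
    show "\<Psi> ` carrier G \<subseteq> topspace ?Y"
      using hom_in_carrier[OF hom] by (auto simp: \<Psi>_def)
    show "topspace ?Y \<subseteq> \<Psi> ` carrier G"
    proof
      fix t assume t: "t \<in> topspace ?Y"
      define C where "C \<phi> = {g \<in> topspace T. \<phi> g \<in> {t \<phi>}}" for \<phi>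
      \<comment> \<open>Including \<open>carrier G\<close> keeps the intersection inside the group
        even if \<open>X\<close> is empty.\<close>
      have closed: "\<forall>S\<in>insert (carrier G) (C ` X). closedin T S"
      proof
        fix S assume "S \<in> insert (carrier G) (C ` X)"
        moreover have "closedin T (C \<phi>)" if "\<phi> \<in> X" for \<phi>
          unfolding C_def by (rule closedin_continuous_map_preimage[OF cont[OF that]]) (use t that in auto)
        ultimately show "closedin T S" by (metis closedin_topspace image_iff insertE topspace_eq)
      qed
      have fip: "\<Inter>\<F> \<noteq> {}" if \<F>: "finite \<F>" "\<F> \<subseteq> insert (carrier G) (C ` X)" for \<F>
      proof -
        have "finite (\<F> - {carrier G})" "\<F> - {carrier G} \<subseteq> C ` X" using \<F> by auto
        then obtain F where F: "F \<subseteq> X" "finite F" "\<F> - {carrier G} = C ` F"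
          by (metis finite_subset_image)
        then obtain g where "g \<in> carrier G" "\<forall>\<phi>\<in>F. \<phi> g = t \<phi>"
        proof -
          have "\<forall>\<phi>\<in>F. t \<phi> \<in> {0..<int p}" using t F(1) by (auto simp: PiE_iff)
          moreover have "finite F \<longrightarrow> F \<subseteq> X \<longrightarrow> (\<forall>\<phi>\<in>F. t \<phi> \<in> {0..<int p}) \<longrightarrow> (\<exists>g\<in>carrier G. \<forall>\<phi>\<in>F. \<phi> g = t \<phi>)"
            using X unfolding good_def by (elim conjE) (drule spec[of _ F], erule spec[of _ t])
          ultimately show thesis using F(1,2) that by blast
        qed
        then have "g \<in> S" if "S \<in> \<F>" for S
          using that F(3) by (cases "S = carrier G") (auto simp: C_def)
        then show ?thesis by blast
      qed
      have "\<Inter>(insert (carrier G) (C ` X)) \<noteq> {}"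
      proof (rule compact_space_fip[THEN iffD1, OF compact, THEN spec, THEN mp], intro conjI allI impI)
        show "\<forall>S\<in>insert (carrier G) (C ` X). closedin T S" by (rule closed)
        show "\<Inter>\<F> \<noteq> {}" if "finite \<F> \<and> \<F> \<subseteq> insert (carrier G) (C ` X)" for \<F>
          using that by (intro fip) auto
      qed
      then obtain g where "g \<in> carrier G" "\<And>\<phi>. \<phi> \<in> X \<Longrightarrow> \<phi> g = t \<phi>" by (auto simp: C_def)
      then have "\<Psi> g = t" using t by (auto simp: \<Psi>_def PiE_iff extensional_def fun_eq_iff)
      then show "t \<in> \<Psi> ` carrier G" using \<open>g \<in> carrier G\<close> by blast
    qed
  qed
  moreover have "Hausdorff_space ?Y"
    by (simp add: Hausdorff_space_product_topology)
  ultimately have "homeomorphic_map T ?Y \<Psi>"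
    using compact by (intro continuous_imp_homeomorphic_map) auto
  then show ?thesis using homeomorphic_map_imp_homeomorphic_space by blast
qed

end

section \<open>Transport and products of group topologies\<close>

lemma group_topology_iso:
  assumes h: "h \<in> iso G H" and G: "group G" and H: "group H" and T: "group_topology H T"
  obtains S where "group_topology G S" "S homeomorphic_space T"
proof -
  interpret G: group G by (rule G)
  interpret H: group H by (rule H)
  interpret h: group_hom G H h using h by (simp add: group_hom_def group_hom_axioms_def G H iso_def)
  have bij: "bij_betw h (carrier G) (carrier H)" using h by (simp add: iso_def)
  have T': "topspace T = carrier H" "continuous_map (prod_topology T T) T (\<lambda>(x, y). x \<otimes>\<^bsub>H\<^esub> y)"
    "continuous_map T T (\<lambda>x. inv\<^bsub>H\<^esub> x)"
    using T by (simp_all add: group_topology_def)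
  define k where "k = inv_into (carrier G) h"
  have k: "k y \<in> carrier G" "h (k y) = y" if "y \<in> carrier H" for y
    using that bij unfolding k_def by (auto simp: bij_betw_def inv_into_into f_inv_into_f)
  have kh: "k (h x) = x" if "x \<in> carrier G" for x
    using that bij unfolding k_def by (simp add: bij_betw_inv_into_left)
  define S where "S = pullback_topology (carrier G) h T"
  have tS: "topspace S = carrier G"
    using T'(1) h.hom_closed by (auto simp: S_def topspace_pullback_topology)
  have hc: "continuous_map S T h"
    using continuous_map_pullback[OF continuous_map_id, where A = "carrier G" and f = h] by (simp add: S_def)
  have kc: "continuous_map T S k"
    unfolding S_def
  proof (rule continuous_map_pullback')
    show "continuous_map T T (h \<circ> k)"
      by (rule continuous_map_eq[OF continuous_map_id]) (use k T' in auto)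
  qed (use k T' in auto)
  have hom: "homeomorphic_maps S T h k"
    using hc kc k kh T'(1) tS by (simp add: homeomorphic_maps_def)
  have "group_topology G S"
    unfolding group_topology_def
  proof (intro conjI tS)
    have "continuous_map (prod_topology S S) T (\<lambda>z. h (fst z) \<otimes>\<^bsub>H\<^esub> h (snd z))"
    proof -
      have "continuous_map (prod_topology S S) (prod_topology T T) (\<lambda>z. (h (fst z), h (snd z)))"
        using hc by (intro continuous_map_pairedI continuous_map_compose[unfolded o_def, OF _ hc]
            continuous_map_fst continuous_map_snd)
      from continuous_map_compose[OF this T'(2)] show ?thesis by (simp add: o_def)
    qed
    from continuous_map_compose[OF this kc]
    have *: "continuous_map (prod_topology S S) S (\<lambda>z. k (h (fst z) \<otimes>\<^bsub>H\<^esub> h (snd z)))" by (simp add: o_def)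
    show "continuous_map (prod_topology S S) S (\<lambda>(x, y). x \<otimes>\<^bsub>G\<^esub> y)"
      by (rule continuous_map_eq[OF *]) (auto simp: tS kh simp flip: h.hom_mult)
    have **: "continuous_map S S (\<lambda>x. k (inv\<^bsub>H\<^esub> h x))"
      using continuous_map_compose[OF continuous_map_compose[OF hc T'(3)] kc] by (simp add: o_def)
    show "continuous_map S S (\<lambda>x. inv\<^bsub>G\<^esub> x)"
      by (rule continuous_map_eq[OF **]) (auto simp: tS kh simp flip: h.hom_inv)
  qed
  moreover have "S homeomorphic_space T" using hom unfolding homeomorphic_space_def by blast
  ultimately show ?thesis by (rule that)
qed

lemma group_topology_discrete:
  assumes "group G" shows "group_topology G (discrete_topology (carrier G))"
proof -
  interpret group G by (rule assms)
  show ?thesis by (auto simp: group_topology_def simp flip: prod_topology_discrete_topology)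
qed

lemma group_topology_prod:
  assumes G: "group G" and H: "group H" and S: "group_topology G S" and T: "group_topology H T"
  shows "group_topology (G \<times>\<times> H) (prod_topology S T)"
proof -
  have S': "topspace S = carrier G" "continuous_map (prod_topology S S) S (\<lambda>(x, y). x \<otimes>\<^bsub>G\<^esub> y)"
    "continuous_map S S (\<lambda>x. inv\<^bsub>G\<^esub> x)" using S by (simp_all add: group_topology_def)
  have T': "topspace T = carrier H" "continuous_map (prod_topology T T) T (\<lambda>(x, y). x \<otimes>\<^bsub>H\<^esub> y)"
    "continuous_map T T (\<lambda>x. inv\<^bsub>H\<^esub> x)" using T by (simp_all add: group_topology_def)
  let ?P = "prod_topology S T"
  note fst = continuous_map_fst[of S T] and snd = continuous_map_snd[of S T]
  note ff = continuous_map_fst[of ?P ?P] and ss = continuous_map_snd[of ?P ?P]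
  have 1: "continuous_map (prod_topology ?P ?P) S (\<lambda>z. fst (fst z) \<otimes>\<^bsub>G\<^esub> fst (snd z))"
    using continuous_map_compose[OF continuous_map_pairedI[OF continuous_map_compose[OF ff fst]
      continuous_map_compose[OF ss fst]] S'(2)] by (simp add: o_def)
  have 2: "continuous_map (prod_topology ?P ?P) T (\<lambda>z. snd (fst z) \<otimes>\<^bsub>H\<^esub> snd (snd z))"
    using continuous_map_compose[OF continuous_map_pairedI[OF continuous_map_compose[OF ff snd]
      continuous_map_compose[OF ss snd]] T'(2)] by (simp add: o_def)
  have 3: "continuous_map ?P S (\<lambda>z. inv\<^bsub>G\<^esub> (fst z))"
    using continuous_map_compose[OF fst S'(3)] by (simp add: o_def)
  have 4: "continuous_map ?P T (\<lambda>z. inv\<^bsub>H\<^esub> (snd z))"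
    using continuous_map_compose[OF snd T'(3)] by (simp add: o_def)
  show ?thesis
    unfolding group_topology_def
  proof (intro conjI)
    show "topspace ?P = carrier (G \<times>\<times> H)" using S' T' by simp
    show "continuous_map (prod_topology ?P ?P) ?P (\<lambda>(x, y). x \<otimes>\<^bsub>G \<times>\<times> H\<^esub> y)"
      by (rule continuous_map_eq[OF continuous_map_pairedI[OF 1 2]]) (auto simp: mult_DirProd')
    show "continuous_map ?P ?P (\<lambda>x. inv\<^bsub>G \<times>\<times> H\<^esub> x)"
      by (rule continuous_map_eq[OF continuous_map_pairedI[OF 3 4]]) (use S' T' G H in \<open>auto simp: inv_DirProd\<close>)
  qed
qed

lemma group_topology_product:
  assumes G: "\<And>i. i \<in> I \<Longrightarrow> group (G i)" and T: "\<And>i. i \<in> I \<Longrightarrow> group_topology (G i) (T i)"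
  shows "group_topology (product_group I G) (product_topology T I)"
proof -
  let ?P = "product_topology T I"
  have T': "topspace (T i) = carrier (G i)"
    "continuous_map (prod_topology (T i) (T i)) (T i) (\<lambda>(x, y). x \<otimes>\<^bsub>G i\<^esub> y)"
    "continuous_map (T i) (T i) (\<lambda>x. inv\<^bsub>G i\<^esub> x)" if "i \<in> I" for i
    using T[OF that] by (simp_all add: group_topology_def)
  have top: "topspace ?P = (\<Pi>\<^sub>E i\<in>I. carrier (G i))"
    using T'(1) by (auto intro: PiE_cong)
  have proj: "continuous_map ?P (T i) (\<lambda>x. x i)" if "i \<in> I" for i
    using that by (rule continuous_map_product_projection)
  note ff = continuous_map_fst[of ?P ?P] and ss = continuous_map_snd[of ?P ?P]
  have 1: "continuous_map (prod_topology ?P ?P) (T i) (\<lambda>z. fst z i \<otimes>\<^bsub>G i\<^esub> snd z i)" if "i \<in> I" for i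
    using continuous_map_compose[OF continuous_map_pairedI[OF continuous_map_compose[OF ff proj[OF that]]
      continuous_map_compose[OF ss proj[OF that]]] T'(2)[OF that]] by (simp add: o_def)
  have 2: "continuous_map ?P (T i) (\<lambda>x. inv\<^bsub>G i\<^esub> x i)" if "i \<in> I" for i
    using continuous_map_compose[OF proj[OF that] T'(3)[OF that]] by (simp add: o_def)
  show ?thesis
    unfolding group_topology_def
  proof (intro conjI)
    show "topspace ?P = carrier (product_group I G)" using top by simp
    have "continuous_map (prod_topology ?P ?P) ?P (\<lambda>z. \<lambda>i\<in>I. fst z i \<otimes>\<^bsub>G i\<^esub> snd z i)"
      using 1 by (auto simp: continuous_map_componentwise)
    then show "continuous_map (prod_topology ?P ?P) ?P (\<lambda>(x, y). x \<otimes>\<^bsub>product_group I G\<^esub> y)"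
      by (simp add: case_prod_unfold)
    have *: "continuous_map ?P ?P (\<lambda>x. \<lambda>i\<in>I. inv\<^bsub>G i\<^esub> x i)"
      using 2 by (auto simp: continuous_map_componentwise)
    show "continuous_map ?P ?P (\<lambda>x. inv\<^bsub>product_group I G\<^esub> x)"
      by (rule continuous_map_eq[OF *]) (use top G in \<open>simp add: inv_product_group\<close>)
  qed
qed

lemma product_topology_reindex:
  assumes f: "bij_betw f X Y"
  shows "product_topology (\<lambda>_. Z) Y homeomorphic_space product_topology (\<lambda>_. Z) X"
proof -
  define h where "h t = (\<lambda>x\<in>X. t (f x))" for t :: "'b \<Rightarrow> 'c"
  define k where "k t = (\<lambda>y\<in>Y. t (inv_into X f y))" for t :: "'a \<Rightarrow> 'c"
  have fX: "f x \<in> Y" if "x \<in> X" for x using f that by (auto simp: bij_betw_def)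
  have gY: "inv_into X f y \<in> X" if "y \<in> Y" for y
    using f that by (metis bij_betw_imp_surj_on inv_into_into)
  have fg: "f (inv_into X f y) = y" if "y \<in> Y" for y
    using f that by (metis bij_betw_inv_into_right)
  have gf: "inv_into X f (f x) = x" if "x \<in> X" for x
    using f that by (metis bij_betw_inv_into_left)
  have "homeomorphic_maps (product_topology (\<lambda>_. Z) Y) (product_topology (\<lambda>_. Z) X) h k"
    unfolding homeomorphic_maps_def
  proof (intro conjI ballI)
    show "continuous_map (product_topology (\<lambda>_. Z) Y) (product_topology (\<lambda>_. Z) X) h"
      using fX continuous_map_product_projection[of "f x" Y "\<lambda>_. Z" for x]
      by (auto simp: continuous_map_componentwise h_def)
    show "continuous_map (product_topology (\<lambda>_. Z) X) (product_topology (\<lambda>_. Z) Y) k"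
      using gY continuous_map_product_projection[of "inv_into X f y" X "\<lambda>_. Z" for y]
      by (auto simp: continuous_map_componentwise k_def)
    show "k (h t) = t" if "t \<in> topspace (product_topology (\<lambda>_. Z) Y)" for t
      using that gY fg by (auto simp: h_def k_def PiE_iff extensional_def fun_eq_iff)
    show "h (k t) = t" if "t \<in> topspace (product_topology (\<lambda>_. Z) X)" for t
      using that fX gf by (auto simp: h_def k_def PiE_iff extensional_def fun_eq_iff)
  qed
  then show ?thesis unfolding homeomorphic_space_def by blast
qed

section \<open>Cosets of an open subgroup and the structure of locally compact topologies\<close>

context elem_topology
begin

lemma elem_topology_subgroup:
  assumes K: "subgroup K G"
  shows "elem_topology (G\<lparr>carrier := K\<rparr>) p (subtopology T K)"
proof -
  interpret K: elem_abelian "G\<lparr>carrier := K\<rparr>" p by (rule elem_abelian_subgroup[OF K])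
  have Kc: "K \<subseteq> carrier G" using subgroup.subset[OF K] .
  have mult: "continuous_map (prod_topology T T) T (\<lambda>(x, y). x \<otimes> y)" and inv: "continuous_map T T (\<lambda>x. inv x)"
    using group_top by (simp_all add: group_topology_def)
  show ?thesis
  proof
    show "group_topology (G\<lparr>carrier := K\<rparr>) (subtopology T K)"
      unfolding group_topology_def
    proof (intro conjI)
      show "topspace (subtopology T K) = carrier (G\<lparr>carrier := K\<rparr>)" using Kc by auto
      have "continuous_map (subtopology (prod_topology T T) (K \<times> K)) (subtopology T K) (\<lambda>(x, y). x \<otimes> y)"
        using continuous_map_from_subtopology[OF mult] subgroup.m_closed[OF K]
        by (auto simp: continuous_map_in_subtopology)
      then show "continuous_map (prod_topology (subtopology T K) (subtopology T K)) (subtopology T K)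
          (\<lambda>(x, y). x \<otimes>\<^bsub>G\<lparr>carrier := K\<rparr>\<^esub> y)"
        by (simp add: subtopology_Times)
      have *: "continuous_map (subtopology T K) (subtopology T K) (\<lambda>x. inv x)"
        using continuous_map_from_subtopology[OF inv] subgroup.m_inv_closed[OF K]
        by (auto simp: continuous_map_in_subtopology)
      show "continuous_map (subtopology T K) (subtopology T K) (\<lambda>x. inv\<^bsub>G\<lparr>carrier := K\<rparr>\<^esub> x)"
        by (rule continuous_map_eq[OF *]) (use m_inv_consistent[OF K] in auto)
    qed
  qed
qed

text \<open>The representative \<open>r x\<close> depends only on the coset of \<open>x\<close>.
  Cosets are open, so \<open>r\<close> is continuous into the discrete space \<open>R\<close>, and
  \<open>x\<close> splits continuously into \<open>inv (r x) \<otimes> x\<close> and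
  \<open>r x\<close>.\<close>

lemma homeomorphic_open_subgroup_cosets:
  assumes K: "subgroup K G" "openin T K"
  obtains R where "R \<subseteq> carrier G" "K = carrier G \<Longrightarrow> \<exists>r. R = {r}" "R \<noteq> {}"
    "T homeomorphic_space prod_topology (subtopology T K) (discrete_topology R)"
proof -
  have Kc: "K \<subseteq> carrier G" using subgroup.subset[OF K(1)] .
  define c where "c x = {y \<in> carrier G. inv x \<otimes> y \<in> K}" for x
  define r where "r x = (SOME y. y \<in> c x)" for x
  have self: "x \<in> c x" if "x \<in> carrier G" for x
    using that subgroup.one_closed[OF K(1)] by (simp add: c_def)
  have rc: "r x \<in> c x" if "x \<in> carrier G" for x
    unfolding r_def using self[OF that] by (rule someI)
  have c_translate: "c (x \<otimes> k) = c x" if "x \<in> carrier G" "k \<in> K" for x k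
  proof -
    have k: "k \<in> carrier G" using that Kc by auto
    have 1: "inv (x \<otimes> k) \<otimes> y = inv k \<otimes> (inv x \<otimes> y)" if "y \<in> carrier G" for y
      using that k \<open>x \<in> carrier G\<close> by (simp add: inv_mult_group m_assoc)
    have "inv k \<otimes> z \<in> K \<longleftrightarrow> z \<in> K" if "z \<in> carrier G" for z
      using subgroup.m_closed[OF K(1)] subgroup.m_inv_closed[OF K(1)] \<open>k \<in> K\<close> l_cancel_inv[of k z] k that
      by metis
    then show ?thesis using 1 that by (auto simp: c_def)
  qed
  have c_eq: "c y = c x" if "x \<in> carrier G" "y \<in> c x" for x y
    using c_translate[of x "inv x \<otimes> y"] that l_cancel_inv[of x y] by (auto simp: c_def)
  have r_translate: "r (x \<otimes> k) = r x" if "x \<in> carrier G" "k \<in> K" for x k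
    using c_translate[OF that] by (simp add: r_def)
  have rr: "r (r x) = r x" if "x \<in> carrier G" for x
    using c_eq[OF that rc[OF that]] by (simp add: r_def)
  have rcarr: "r x \<in> carrier G" and rK: "inv (r x) \<otimes> x \<in> K" if "x \<in> carrier G" for x
  proof -
    show 1: "r x \<in> carrier G" using rc[OF that] by (simp add: c_def)
    have "x \<in> c (r x)" using c_eq[OF that rc[OF that]] self[OF that] by simp
    then show "inv (r x) \<otimes> x \<in> K" by (simp add: c_def)
  qed
  define R where "R = r ` carrier G"
  have Rc: "R \<subseteq> carrier G" using rcarr by (auto simp: R_def)
  have rR: "r s = s" if "s \<in> R" for s using that rr by (auto simp: R_def)
  have r_cont: "continuous_map T (discrete_topology R) r"
  proof -
    have "openin T {x \<in> carrier G. r x \<in> U}" for U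
    proof (subst openin_subopen, clarify)
      fix x assume x: "x \<in> carrier G" "r x \<in> U"
      have "(\<lambda>k. x \<otimes> k) ` K \<subseteq> {x \<in> carrier G. r x \<in> U}" using r_translate x Kc by auto
      moreover have "x \<in> (\<lambda>k. x \<otimes> k) ` K"
        using x subgroup.one_closed[OF K(1)] by (intro image_eqI[of _ _ \<one>]) auto
      ultimately show "\<exists>S. openin T S \<and> x \<in> S \<and> S \<subseteq> {x \<in> carrier G. r x \<in> U}"
        using openin_translate[OF x(1) K(2)] by blast
    qed
    then show ?thesis by (auto simp: continuous_map_def R_def)
  qed
  let ?P = "prod_topology (subtopology T K) (discrete_topology R)"
  have inv: "continuous_map T T (\<lambda>x. inv x)" using group_top by (simp add: group_topology_def)
  have incl: "continuous_map (discrete_topology R) T (\<lambda>x. x)" using Rc by auto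
  have "homeomorphic_maps T ?P (\<lambda>x. (inv (r x) \<otimes> x, r x)) (\<lambda>z. snd z \<otimes> fst z)"
    unfolding homeomorphic_maps_def
  proof (intro conjI ballI)
    have "continuous_map T T (\<lambda>x. inv (r x))"
      using continuous_map_compose[OF continuous_map_compose[OF r_cont incl] inv] by (simp add: o_def)
    then have "continuous_map T T (\<lambda>x. inv (r x) \<otimes> x)" by (intro continuous_map_mult) auto
    then have "continuous_map T (subtopology T K) (\<lambda>x. inv (r x) \<otimes> x)"
      using rK by (auto simp: continuous_map_in_subtopology)
    then show "continuous_map T ?P (\<lambda>x. (inv (r x) \<otimes> x, r x))"
      using r_cont by (rule continuous_map_pairedI)
    have "continuous_map ?P T snd"
      using continuous_map_compose[OF continuous_map_snd[of "subtopology T K" "discrete_topology R"] incl]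
      by (simp add: o_def)
    moreover have "continuous_map ?P T fst"
      using continuous_map_fst[of "subtopology T K" "discrete_topology R"]
      by (simp add: continuous_map_in_subtopology)
    ultimately show "continuous_map ?P T (\<lambda>z. snd z \<otimes> fst z)" by (rule continuous_map_mult)
    show "snd (inv (r x) \<otimes> x, r x) \<otimes> fst (inv (r x) \<otimes> x, r x) = x" if "x \<in> topspace T" for x
      using that l_cancel_inv[of "r x" x] rcarr[of x] by simp
    fix z assume z: "z \<in> topspace ?P"
    then obtain k s where ks: "z = (k, s)" "k \<in> K" "s \<in> R" by auto
    have c: "k \<in> carrier G" "s \<in> carrier G" using ks Rc Kc by auto
    have "r (s \<otimes> k) = s" using r_translate[OF c(2) ks(2)] rR ks by simp
    then show "(inv (r (snd z \<otimes> fst z)) \<otimes> (snd z \<otimes> fst z), r (snd z \<otimes> fst z)) = z"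
      using ks c l_cancel_inv[of "inv s" k] by simp
  qed
  then have "T homeomorphic_space ?P" unfolding homeomorphic_space_def by blast
  moreover have "\<exists>s. R = {s}" if "K = carrier G"
  proof -
    have "r x = r \<one>" if "x \<in> carrier G" for x
      using r_translate[of \<one> x] that \<open>K = carrier G\<close> by simp
    then have "R = (\<lambda>_. r \<one>) ` carrier G" unfolding R_def by (rule image_cong[OF refl])
    then have "R = {r \<one>}" by auto
    then show ?thesis by blast
  qed
  moreover have "R \<noteq> {}" by (auto simp: R_def)
  ultimately show ?thesis using that Rc by blast
qed

text \<open>For compact topologies \<open>K\<close> is chosen to be the whole group, with one coset.
  A finite \<open>R\<close> makes the space compact, so it can only be a singleton.\<close>

theorem LCH_structure:
  assumes lc: "locally_compact_space T" and Haus: "Hausdorff_space T"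
  obtains X :: "('a \<Rightarrow> int) set" and R :: "'a set" where
    "T homeomorphic_space prod_topology (product_topology (\<lambda>_. discrete_topology {0..<int p}) X) (discrete_topology R)"
    "R \<subseteq> carrier G" "infinite R \<or> (\<exists>r. R = {r})"
proof -
  obtain K where K: "subgroup K G" "openin T K" "compactin T K" "compact_space T \<Longrightarrow> K = carrier G"
  proof (cases "compact_space T")
    case True
    then show ?thesis using that[of "carrier G"] subgroup_self openin_topspace[of T]
      by (simp add: compact_space_def)
  next
    case False
    then show ?thesis using compact_open_subgroup[OF lc] that by metis
  qed
  interpret K: elem_topology "G\<lparr>carrier := K\<rparr>" p "subtopology T K" by (rule elem_topology_subgroup[OF K(1)])
  have comp: "compact_space (subtopology T K)" using K(3) by (simp add: compactin_subspace)
  obtain X :: "('a \<Rightarrow> int) set" where X: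
    "subtopology T K homeomorphic_space product_topology (\<lambda>_. discrete_topology {0..<int p}) X"
    using K.compact_homeomorphic_power[OF comp Hausdorff_space_subtopology[OF Haus]] by blast
  obtain R where R: "R \<subseteq> carrier G" "K = carrier G \<Longrightarrow> \<exists>r. R = {r}" "R \<noteq> {}"
    "T homeomorphic_space prod_topology (subtopology T K) (discrete_topology R)"
    by (rule homeomorphic_open_subgroup_cosets[OF K(1,2)]) blast
  show ?thesis
  proof
    show "T homeomorphic_space prod_topology (product_topology (\<lambda>_. discrete_topology {0..<int p}) X) (discrete_topology R)"
      using R(4) homeomorphic_space_prod_topology[OF X homeomorphic_space_refl] homeomorphic_space_trans by blast
    show "R \<subseteq> carrier G" by (rule R)
    show "infinite R \<or> (\<exists>r. R = {r})"
    proof (cases "finite R")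
      case True
      then have "compact_space (prod_topology (subtopology T K) (discrete_topology R))"
        using comp by (simp add: compact_space_prod_topology compact_space_discrete_topology)
      then have "compact_space T" using R(4) homeomorphic_compact_space by blast
      then show ?thesis using K(4) R(2) by blast
    qed simp
  qed
qed

end

section \<open>Cardinalities and model spaces\<close>

lemma elem_abelianI:
  assumes "prime p" "group G"
    and "\<And>x y. x \<in> carrier G \<Longrightarrow> y \<in> carrier G \<Longrightarrow> x \<otimes>\<^bsub>G\<^esub> y = y \<otimes>\<^bsub>G\<^esub> x"
    and "\<And>x. x \<in> carrier G \<Longrightarrow> x [^]\<^bsub>G\<^esub> p = \<one>\<^bsub>G\<^esub>"
  shows "elem_abelian G p"
proof -
  interpret comm_group G by (rule group.group_comm_groupI) (use assms in auto)
  show ?thesis by unfold_locales (use assms in auto)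
qed

lemma product_group_pow:
  "x [^]\<^bsub>product_group I (\<lambda>_. integer_mod_group p)\<^esub> (n :: nat) = (\<lambda>i\<in>I. (int n * x i) mod int p)"
proof (induction n)
  case (Suc n)
  then show ?case by (auto simp: fun_eq_iff mod_simps algebra_simps)
qed (auto simp: fun_eq_iff)

lemma sum_group_pow:
  "x [^]\<^bsub>sum_group I (\<lambda>_. integer_mod_group p)\<^esub> (n :: nat) = (\<lambda>i\<in>I. (int n * x i) mod int p)"
proof (induction n)
  case (Suc n)
  then show ?case by (auto simp: fun_eq_iff mod_simps algebra_simps)
qed (auto simp: fun_eq_iff)

lemma elem_abelian_product_group:
  assumes "prime p" shows "elem_abelian (product_group I (\<lambda>_. integer_mod_group p)) p"
proof (rule elem_abelianI[OF assms])
  fix x y assume "x \<in> carrier (product_group I (\<lambda>_. integer_mod_group p))"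
  show "x [^]\<^bsub>product_group I (\<lambda>_. integer_mod_group p)\<^esub> p = \<one>\<^bsub>product_group I (\<lambda>_. integer_mod_group p)\<^esub>"
    unfolding product_group_pow by simp
  show "x \<otimes>\<^bsub>product_group I (\<lambda>_. integer_mod_group p)\<^esub> y = y \<otimes>\<^bsub>product_group I (\<lambda>_. integer_mod_group p)\<^esub> x"
    by (simp add: add.commute)
qed simp

lemma elem_abelian_sum_group:
  assumes "prime p" shows "elem_abelian (sum_group I (\<lambda>_. integer_mod_group p)) p"
proof (rule elem_abelianI[OF assms])
  fix x y assume "x \<in> carrier (sum_group I (\<lambda>_. integer_mod_group p))"
  show "x [^]\<^bsub>sum_group I (\<lambda>_. integer_mod_group p)\<^esub> p = \<one>\<^bsub>sum_group I (\<lambda>_. integer_mod_group p)\<^esub>"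
    unfolding sum_group_pow by simp
  show "x \<otimes>\<^bsub>sum_group I (\<lambda>_. integer_mod_group p)\<^esub> y = y \<otimes>\<^bsub>sum_group I (\<lambda>_. integer_mod_group p)\<^esub> x"
    by (simp add: add.commute)
qed simp

lemma DirProd_pow: "(x, y) [^]\<^bsub>G \<times>\<times> H\<^esub> (n :: nat) = (x [^]\<^bsub>G\<^esub> n, y [^]\<^bsub>H\<^esub> n)"
  by (induction n) simp_all

lemma elem_abelian_DirProd:
  assumes "elem_abelian G p" "elem_abelian H p"
  shows "elem_abelian (G \<times>\<times> H) p"
proof -
  interpret G: elem_abelian G p by (rule assms)
  interpret H: elem_abelian H p by (rule assms)
  show ?thesis
  proof (rule elem_abelianI)
    show "group (G \<times>\<times> H)" by (rule DirProd_group) unfold_locales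
  qed (auto simp: G.prime_p DirProd_pow G.exponent H.exponent G.m_comm H.m_comm)
qed

text \<open>The unit vectors \<open>d i\<close> are distinct, which bounds the cardinality from
  below; they generate the sum, so the bound for generated subgroups applies from above.\<close>

lemma card_of_sum_group:
  assumes p: "prime p" and I: "infinite I"
  shows "|carrier (sum_group I (\<lambda>_. integer_mod_group p))| =o |I|"
proof -
  let ?A = "sum_group I (\<lambda>_. integer_mod_group p)"
  interpret A: elem_abelian ?A p by (rule elem_abelian_sum_group[OF p])
  have carr: "carrier ?A = {x \<in> \<Pi>\<^sub>E i\<in>I. {0..<int p}. finite {i \<in> I. x i \<noteq> 0}}"
    by (simp add: carrier_sum_group)
  define d where "d i = (\<lambda>j\<in>I. if j = i then 1 else 0 :: int)" for i
  have d: "d i \<in> carrier ?A" if "i \<in> I" for i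
  proof -
    have "{j \<in> I. d i j \<noteq> 0} \<subseteq> {i}" by (auto simp: d_def)
    then have "finite {j \<in> I. d i j \<noteq> 0}" by (rule finite_subset) simp
    then show ?thesis using A.p_gt_1 by (simp add: carr) (simp add: d_def)
  qed
  have dI: "d ` I \<subseteq> carrier ?A" using d by blast
  have inj: "inj_on d I"
  proof (rule inj_onI)
    fix i j assume ij: "i \<in> I" "j \<in> I" "d i = d j"
    have "d i i = d j i" using ij(3) by simp
    then show "i = j" using ij(1) by (simp add: d_def split: if_splits)
  qed
  have "t \<in> generate ?A (d ` I)" if "finite F" "t \<in> carrier ?A" "{i \<in> I. t i \<noteq> 0} \<subseteq> F" for t F
    using that
  proof (induction F arbitrary: t)
    case empty
    then have "t = \<one>\<^bsub>?A\<^esub>" by (auto simp: carr PiE_iff extensional_def fun_eq_iff)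
    then show ?case using generate.one by metis
  next
    case (insert i F)
    show ?case
    proof (cases "i \<in> I")
      case False
      then show ?thesis using insert by auto
    next
      case True
      define t' where "t' = t(i := 0)"
      have sub: "{j \<in> I. t' j \<noteq> 0} \<subseteq> F" using insert.prems by (auto simp: t'_def)
      then have "t' \<in> carrier ?A"
        using insert.prems insert.hyps True A.p_pos finite_subset[OF sub]
        by (auto simp: carr t'_def PiE_iff extensional_def)
      then have g: "t' \<in> generate ?A (d ` I)" using insert.IH sub by blast
      have "d i \<in> generate ?A (d ` I)" using True by (auto intro: generate.incl)
      \<comment> \<open>The entry \<open>t i\<close> is one of 0, ..., \<open>p - 1\<close>, so
        \<open>nat\<close> loses nothing.\<close>
      then have "d i [^]\<^bsub>?A\<^esub> nat (t i) \<in> generate ?A (d ` I)"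
        using A.subgroup_int_pow_closed[OF A.generate_is_subgroup[OF dI], of "d i" "int (nat (t i))"]
        by (simp only: int_pow_int)
      then have "t' \<otimes>\<^bsub>?A\<^esub> d i [^]\<^bsub>?A\<^esub> nat (t i) \<in> generate ?A (d ` I)" using g by (rule generate.eng[rotated])
      also have "t' \<otimes>\<^bsub>?A\<^esub> d i [^]\<^bsub>?A\<^esub> nat (t i) = t"
        using insert.prems(1) True unfolding sum_group_pow
        by (auto simp: carr t'_def d_def PiE_iff extensional_def fun_eq_iff)
      finally show ?thesis .
    qed
  qed
  then have "carrier ?A \<subseteq> generate ?A (d ` I)" by (auto simp: carr)
  then have "|carrier ?A| \<le>o |generate ?A (d ` I)|" by (rule card_of_mono1)
  also have "|generate ?A (d ` I)| \<le>o |d ` I|"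
    using d I inj by (intro A.card_of_generate_infinite) (auto simp: finite_image_iff)
  also have "|d ` I| \<le>o |I|" by (rule card_of_image)
  finally have "|carrier ?A| \<le>o |I|" .
  moreover have "|I| \<le>o |carrier ?A|"
    using inj d by (metis card_of_ordLeqI)
  ultimately show ?thesis by (simp add: ordIso_iff_ordLeq)
qed

lemma finite_ordLeq_infinite: "finite A \<Longrightarrow> infinite B \<Longrightarrow> |A| \<le>o |B|"
  by (meson finite_iff_ordLess_natLeq infinite_iff_natLeq_ordLeq ordLess_imp_ordLeq ordLeq_transitive)

lemma card_of_Pow_mono: "|A| \<le>o |B| \<Longrightarrow> |Pow A| \<le>o |Pow B|"
  unfolding card_of_ordLeq[symmetric] by (metis image_Pow_mono inj_on_image_Pow)

lemma card_of_Pow_cong: "|A| =o |B| \<Longrightarrow> |Pow A| =o |Pow B|"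
  by (simp add: ordIso_iff_ordLeq card_of_Pow_mono)

text \<open>Functions are coded by their graphs, which are subsets of
  \<open>X \<times> {0..<int p}\<close>; conversely, subsets of \<open>X\<close> are coded by
  indicator functions.\<close>

lemma card_of_power_Zp:
  assumes "1 < p" "infinite X"
  shows "|\<Pi>\<^sub>E x\<in>X. {0..<int p}| =o |Pow X|"
proof -
  let ?P = "\<Pi>\<^sub>E x\<in>X. {0..<int p}"
  have "|?P| \<le>o |Pow (X \<times> {0..<int p})|"
  proof (rule card_of_ordLeqI)
    show "inj_on (\<lambda>t. (\<lambda>x. (x, t x)) ` X) ?P"
    proof (rule inj_onI)
      fix s t assume st: "s \<in> ?P" "t \<in> ?P" "(\<lambda>x. (x, s x)) ` X = (\<lambda>x. (x, t x)) ` X"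
      have "s x = t x" if "x \<in> X" for x
      proof -
        have "(x, s x) \<in> (\<lambda>x. (x, t x)) ` X" using st(3) that by blast
        then show ?thesis by auto
      qed
      then show "s = t" using st by (meson PiE_ext)
    qed
  qed (auto simp: PiE_iff)
  also have "|X \<times> {0..<int p}| =o |X|"
    using assms by (intro card_of_Times_infinite_simps(1))
      (auto intro: finite_ordLeq_infinite)
  then have "|Pow (X \<times> {0..<int p})| =o |Pow X|" by (rule card_of_Pow_cong)
  finally have "|?P| \<le>o |Pow X|" .
  moreover have "|Pow X| \<le>o |?P|"
  proof (rule card_of_ordLeqI)
    show "inj_on (\<lambda>S. \<lambda>x\<in>X. if x \<in> S then 1 else 0 :: int) (Pow X)"
    proof (rule inj_onI)
      fix S S' assume S: "S \<in> Pow X" "S' \<in> Pow X"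
        "(\<lambda>x\<in>X. if x \<in> S then 1 else 0 :: int) = (\<lambda>x\<in>X. if x \<in> S' then 1 else 0)"
      have "x \<in> S \<longleftrightarrow> x \<in> S'" if "x \<in> X" for x
        using fun_cong[OF S(3), of x] that by (simp split: if_splits)
      then show "S = S'" using S by blast
    qed
    show "(\<lambda>x\<in>X. if x \<in> S then 1 else 0 :: int) \<in> ?P" if "S \<in> Pow X" for S
      using assms by simp
  qed
  ultimately show ?thesis by (simp add: ordIso_iff_ordLeq)
qed

lemma ctwo_cexp_natLeq: "ctwo ^c natLeq =o |Pow (UNIV :: nat set)|"
  unfolding cexp_def Field_natLeq ctwo_def Field_card_of
  by (rule ordIso_symmetric[OF card_of_Pow_Func])

section \<open>Topological sums of Cantor sets\<close>

abbreviation cantor :: "nat \<Rightarrow> 'x set \<Rightarrow> ('x \<Rightarrow> int) topology" where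
  "cantor p X \<equiv> product_topology (\<lambda>_. discrete_topology {0..<int p}) X"

text \<open>The type of \<open>R\<close> is free because the theorem indexes by \<open>{()}\<close>,
  the naturals, \<open>I\<close>, the power set of the naturals, and sets of coset
  representatives.\<close>

definition cantor_sum :: "nat \<Rightarrow> 'r set \<Rightarrow> ((nat \<Rightarrow> int) \<times> 'r) topology" where
  "cantor_sum p R = prod_topology (cantor p UNIV) (discrete_topology R)"

lemma homeomorphic_discrete_topology:
  assumes "bij_betw f A B"
  shows "discrete_topology A homeomorphic_space discrete_topology B"
proof -
  have "homeomorphic_maps (discrete_topology A) (discrete_topology B) f (inv_into A f)"
    using assms bij_betw_inv_into[OF assms]
    by (auto simp: homeomorphic_maps_def bij_betw_inv_into_left bij_betw_inv_into_right
        dest: bij_betwE)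
  then show ?thesis unfolding homeomorphic_space_def by blast
qed

lemma homeomorphic_to_discrete:
  assumes "T homeomorphic_space discrete_topology D"
  shows "T = discrete_topology (topspace T)"
proof -
  obtain f where f: "homeomorphic_map T (discrete_topology D) f"
    using assms homeomorphic_space by blast
  have "openin T {x}" if "x \<in> topspace T" for x
  proof -
    have "f ` topspace T = D" using homeomorphic_imp_surjective_map[OF f] by simp
    then have "openin (discrete_topology D) (f ` {x})" using that by auto
    then show ?thesis using homeomorphic_map_openness[OF f, of "{x}"] that by simp
  qed
  then show ?thesis by (metis discrete_topology_unique)
qed

lemma infinite_cantor:
  assumes "1 < p" shows "infinite (\<Pi>\<^sub>E x\<in>(UNIV :: nat set). {0..<int p})"
proof -
  have "infinite (Pow (UNIV :: nat set))" using finite_Pow_iff infinite_UNIV_nat by blast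
  then show ?thesis
    using card_of_ordIso_finite[OF card_of_power_Zp[OF assms infinite_UNIV_nat]] by blast
qed

lemma cantor_sum_cong:
  assumes "|R| =o |R'|"
  shows "cantor_sum p R homeomorphic_space cantor_sum p R'"
proof -
  obtain f where "bij_betw f R R'" using assms card_of_ordIso by blast
  then show ?thesis
    unfolding cantor_sum_def
    by (intro homeomorphic_space_prod_topology homeomorphic_space_refl homeomorphic_discrete_topology)
qed

lemma
  assumes "1 < p"
  shows Hausdorff_cantor_sum: "Hausdorff_space (cantor_sum p R)"
    and locally_compact_cantor_sum: "locally_compact_space (cantor_sum p R)"
proof -
  have "Hausdorff_space (cantor p (UNIV :: nat set))"
    by (simp add: Hausdorff_space_product_topology)
  then show "Hausdorff_space (cantor_sum p R)"
    unfolding cantor_sum_def by (simp add: Hausdorff_space_prod_topology)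
  have "compact_space (cantor p (UNIV :: nat set))"
    by (simp add: compact_space_product_topology compact_space_discrete_topology)
  then show "locally_compact_space (cantor_sum p R)"
    unfolding cantor_sum_def
    by (simp add: locally_compact_space_prod_topology compact_imp_locally_compact_space
        locally_compact_space_discrete_topology)
qed

lemma compactin_cantor_fibre:
  assumes "r \<in> R"
  shows "compactin (cantor_sum p R) ((\<Pi>\<^sub>E x\<in>UNIV. {0..<int p}) \<times> {r})"
proof -
  have "compact_space (cantor p (UNIV :: nat set))"
    by (simp add: compact_space_product_topology compact_space_discrete_topology)
  then show ?thesis using assms unfolding cantor_sum_def by (simp add: compactin_Times compact_space_def)
qed

text \<open>A fibre is compact and infinite, whereas compact subsets of a discrete space are
  finite.\<close>

lemma cantor_sum_not_discrete:
  assumes "1 < p" "R \<noteq> {}"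
  shows "\<not> cantor_sum p R homeomorphic_space discrete_topology D"
proof
  assume "cantor_sum p R homeomorphic_space discrete_topology D"
  then have *: "cantor_sum p R = discrete_topology (topspace (cantor_sum p R))"
    by (rule homeomorphic_to_discrete)
  obtain r where "r \<in> R" using assms by blast
  then have "compactin (discrete_topology (topspace (cantor_sum p R)))
      ((\<Pi>\<^sub>E x\<in>(UNIV :: nat set). {0..<int p}) \<times> {r})"
    using compactin_cantor_fibre[of r R p] * by metis
  then have "finite ((\<Pi>\<^sub>E x\<in>(UNIV :: nat set). {0..<int p}) \<times> {r})"
    using compactin_discrete_topology by blast
  then show False using infinite_cantor[OF assms(1)] by (auto dest: finite_cartesian_productD1)
qed

text \<open>\<open>cantor_sum p R\<close> is a union of \<open>|R|\<close> compact sets, while a compact subset of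
  \<open>cantor_sum p R'\<close> meets only finitely many fibres.\<close>

lemma cantor_sum_homeomorphic_imp:
  assumes p: "1 < p" and hom: "cantor_sum p R homeomorphic_space cantor_sum p R'" and R': "infinite R'"
  shows "infinite R \<and> |R'| \<le>o |R|"
proof -
  let ?C = "\<Pi>\<^sub>E x\<in>(UNIV :: nat set). {0..<int p}"
  have top: "topspace (cantor_sum p S) = ?C \<times> S" for S :: "'s set" by (simp add: cantor_sum_def)
  obtain f where f: "homeomorphic_map (cantor_sum p R) (cantor_sum p R') f"
    using hom homeomorphic_space by blast
  define F where "F r = snd ` f ` (?C \<times> {r})" for r
  have fin: "finite (F r)" if "r \<in> R" for r
  proof -
    have "compactin (discrete_topology R') (F r)"
      unfolding F_def
      using compactin_cantor_fibre[OF that] homeomorphic_imp_continuous_map[OF f]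
        continuous_map_snd[of "cantor p (UNIV :: nat set)" "discrete_topology R'"]
      by (auto intro!: image_compactin simp: cantor_sum_def)
    then show ?thesis by (simp add: compactin_discrete_topology)
  qed
  have "f ` (?C \<times> R) = ?C \<times> R'" using homeomorphic_imp_surjective_map[OF f] by (simp add: top)
  moreover have "?C \<noteq> {}" using infinite_cantor[OF p] by auto
  ultimately have "R' = snd ` f ` (?C \<times> R)" by (simp add: snd_image_times)
  also have "?C \<times> R = (\<Union>r\<in>R. ?C \<times> {r})" by auto
  then have "snd ` f ` (?C \<times> R) = (\<Union>r\<in>R. F r)" unfolding F_def by (simp only: image_UN)
  finally have eq: "R' = (\<Union>r\<in>R. F r)" .
  then have inf: "infinite R" using fin R' by auto
  have "|\<Union>r\<in>R. F r| \<le>o |R|"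
    by (rule card_of_UNION_ordLeq_infinite[OF inf ordIso_imp_ordLeq[OF card_of_refl]])
      (use inf fin in \<open>blast intro: finite_ordLeq_infinite\<close>)
  then show ?thesis using inf eq by simp
qed

section \<open>Realizing the models and counting classes\<close>

lemma (in elem_abelian) exists_subgroup_card:
  assumes "infinite R" "|R| \<le>o |carrier G|"
  obtains H where "subgroup H G" "|H| =o |R|"
proof -
  obtain Y where Y: "Y \<subseteq> carrier G" "|R| =o |Y|"
    using assms internalize_card_of_ordLeq2 by (metis card_of_ordIso_subst)
  have inf: "infinite Y" using assms Y card_of_ordIso_finite by blast
  have "|generate G Y| =o |Y|"
    using card_of_generate_infinite[OF inf Y(1)] card_of_mono1[of Y "generate G Y"]
    by (auto simp: ordIso_iff_ordLeq intro: generate.incl)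
  then have "|generate G Y| =o |R|" using Y ordIso_symmetric ordIso_transitive by blast
  then show ?thesis using that generate_is_subgroup[OF Y(1)] by blast
qed

text \<open>The discrete factor must be a group as well, so \<open>R\<close> is replaced by a
  subgroup \<open>H\<close> of the same cardinality, the trivial one if \<open>R\<close> is a
  singleton. As \<open>H\<close> is no larger than the Cantor group \<open>?P\<close>, the product
  of the two is as large as \<open>B\<close>, hence isomorphic to it, and its topology can be
  carried over.\<close>

lemma exists_cantor_sum_topology:
  assumes B: "elem_abelian B p" and card: "|carrier B| =o |Pow (UNIV :: nat set)|"
    and R: "infinite R \<and> |R| \<le>o |carrier B| \<or> (\<exists>r. R = {r})"
  shows "\<exists>T\<in>LCH_group_topologies B. T homeomorphic_space cantor_sum p R"
proof -
  interpret B: elem_abelian B p by (rule B)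
  let ?P = "product_group (UNIV :: nat set) (\<lambda>_. integer_mod_group p)"
  interpret P: elem_abelian ?P p by (rule elem_abelian_product_group[OF B.prime_p])
  obtain H where H: "subgroup H B" "|H| =o |R|"
  proof (cases "infinite R")
    case True
    then show ?thesis using B.exists_subgroup_card[of R] R that by (metis finite.emptyI finite_insert)
  next
    case False
    then obtain r where "R = {r}" using R by blast
    then have "|{\<one>\<^bsub>B\<^esub>}| =o |R|" by (auto intro!: card_of_ordIsoI[of "\<lambda>_. r"] simp: bij_betw_def)
    then show ?thesis using that B.triv_subgroup by blast
  qed
  let ?H = "B\<lparr>carrier := H\<rparr>"
  interpret H: elem_abelian ?H p by (rule B.elem_abelian_subgroup[OF H(1)])
  let ?Q = "?P \<times>\<times> ?H"
  have Q: "elem_abelian ?Q p" by (rule elem_abelian_DirProd[OF P.elem_abelian_axioms H.elem_abelian_axioms])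
  have cP: "|carrier ?P| =o |Pow (UNIV :: nat set)|"
    using card_of_power_Zp[OF B.p_gt_1 infinite_UNIV_nat] by simp
  have infP: "infinite (carrier ?P)" using infinite_cantor[OF B.p_gt_1] by simp
  have cBP: "|carrier B| =o |carrier ?P|" using card cP ordIso_symmetric ordIso_transitive by blast
  have "|H| \<le>o |carrier ?P|"
    using card_of_mono1[OF subgroup.subset[OF H(1)]] cBP ordLeq_ordIso_trans by blast
  then have "|carrier ?P \<times> H| =o |carrier ?P|"
    using infP subgroup.one_closed[OF H(1)] by (intro card_of_Times_infinite_simps(1)) auto
  then have "|carrier B| =o |carrier ?Q|"
    using ordIso_transitive[OF cBP ordIso_symmetric] by simp
  moreover have "infinite (carrier B)" using infP cBP card_of_ordIso_finite by blast
  ultimately have "B \<cong> ?Q" by (intro elem_abelian_iso[OF B Q])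
  then obtain h where h: "h \<in> iso B ?Q" unfolding is_iso_def by blast
  have "group_topology ?P (product_topology (\<lambda>_. discrete_topology (carrier (integer_mod_group p))) (UNIV :: nat set))"
    by (intro group_topology_product group_topology_discrete group_integer_mod_group)
  then have "group_topology ?Q (prod_topology (cantor p UNIV) (discrete_topology (carrier ?H)))"
    by (intro group_topology_prod group_topology_discrete P.is_group H.is_group) simp
  then have "group_topology ?Q (cantor_sum p H)" by (simp add: cantor_sum_def)
  then obtain T where T: "group_topology B T" "T homeomorphic_space cantor_sum p H"
    by (rule group_topology_iso[OF h B.is_group elem_abelian.axioms(1)[OF Q, THEN comm_group.axioms(2)]])
  have "T \<in> LCH_group_topologies B"
    using T Hausdorff_cantor_sum[OF B.p_gt_1] locally_compact_cantor_sum[OF B.p_gt_1]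
      homeomorphic_Hausdorff_space homeomorphic_locally_compact_space
    unfolding LCH_group_topologies_def by blast
  moreover have "T homeomorphic_space cantor_sum p R"
    using T(2) cantor_sum_cong[OF H(2)] homeomorphic_space_trans by blast
  ultimately show ?thesis by blast
qed

text \<open>A finite \<open>X\<close> would make both factors, and so \<open>T\<close>, discrete.
  For infinite \<open>X\<close> a single fibre already has as many points as \<open>Pow X\<close>;
  this cardinal bound is what ties the topology to the continuum hypothesis.\<close>

lemma (in elem_topology) nondiscrete_structure:
  assumes lc: "locally_compact_space T" and Haus: "Hausdorff_space T"
    and nd: "T \<noteq> discrete_topology (carrier G)"
  obtains X :: "('a \<Rightarrow> int) set" and R :: "'a set" where "infinite X"
    "T homeomorphic_space prod_topology (cantor p X) (discrete_topology R)"
    "R \<subseteq> carrier G" "infinite R \<or> (\<exists>r. R = {r})" "|Pow X| \<le>o |carrier G|"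
proof -
  obtain X :: "('a \<Rightarrow> int) set" and R :: "'a set" where XR:
    "T homeomorphic_space prod_topology (cantor p X) (discrete_topology R)"
    "R \<subseteq> carrier G" "infinite R \<or> (\<exists>r. R = {r})" by (rule LCH_structure[OF lc Haus]) blast
  have infX: "infinite X"
  proof
    assume "finite X"
    then have "finite (topspace (cantor p X))" by (simp add: finite_PiE)
    moreover have "Hausdorff_space (cantor p X)" by (simp add: Hausdorff_space_product_topology)
    ultimately have "cantor p X = discrete_topology (topspace (cantor p X))"
      by (metis finite_topspace_imp_discrete_topology)
    then have "T homeomorphic_space discrete_topology (topspace (cantor p X) \<times> R)"
      using XR(1) by (metis prod_topology_discrete_topology)
    then show False using nd homeomorphic_to_discrete by fastforce
  qed
  obtain f where "homeomorphic_map (prod_topology (cantor p X) (discrete_topology R)) T f"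
    using XR(1) homeomorphic_space homeomorphic_space_sym by blast
  then have f: "inj_on f ((\<Pi>\<^sub>E x\<in>X. {0..<int p}) \<times> R)" "f ` ((\<Pi>\<^sub>E x\<in>X. {0..<int p}) \<times> R) = carrier G"
    using homeomorphic_imp_injective_map homeomorphic_imp_surjective_map by fastforce+
  have "R \<noteq> {}" using XR(3) by auto
  then have "|\<Pi>\<^sub>E x\<in>X. {0..<int p}| \<le>o |(\<Pi>\<^sub>E x\<in>X. {0..<int p}) \<times> R|" by (rule card_of_Times1)
  moreover have "|(\<Pi>\<^sub>E x\<in>X. {0..<int p}) \<times> R| \<le>o |carrier G|"
    using f by (intro card_of_ordLeqI[of f]) auto
  ultimately have "|\<Pi>\<^sub>E x\<in>X. {0..<int p}| \<le>o |carrier G|" by (rule ordLeq_transitive)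
  then have "|Pow X| \<le>o |carrier G|"
    using card_of_power_Zp[OF p_gt_1 infX] ordIso_ordLeq_trans ordIso_symmetric by blast
  then show ?thesis using that infX XR by blast
qed

text \<open>Sending a topology to its class is injective on \<T>, and onto the classes if \<T>
  represents all of them. Finiteness guards the lower bound, since \<open>card\<close> is 0 on
  infinite sets.\<close>

lemma card_LCH_group_topology_classes:
  assumes \<T>: "\<T> \<subseteq> LCH_group_topologies G"
    and inj: "\<And>S T. S \<in> \<T> \<Longrightarrow> T \<in> \<T> \<Longrightarrow> S homeomorphic_space T \<Longrightarrow> S = T"
  shows "finite (LCH_group_topology_classes G) \<Longrightarrow> card \<T> \<le> card (LCH_group_topology_classes G)"
    and "(\<And>T. T \<in> LCH_group_topologies G \<Longrightarrow> \<exists>S\<in>\<T>. T homeomorphic_space S) \<Longrightarrow>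
      card (LCH_group_topology_classes G) = card \<T>"
proof -
  let ?L = "LCH_group_topologies G"
  define E where "E = {(S, T). S \<in> ?L \<and> T \<in> ?L \<and> S homeomorphic_space T}"
  have classes: "LCH_group_topology_classes G = ?L // E"
    by (simp add: LCH_group_topology_classes_def E_def)
  have eq: "E `` {S} = E `` {T} \<longleftrightarrow> S homeomorphic_space T" if "S \<in> ?L" "T \<in> ?L" for S T
  proof
    assume "E `` {S} = E `` {T}"
    moreover have "S \<in> E `` {S}" using that homeomorphic_space_refl by (auto simp: E_def)
    ultimately have "T homeomorphic_space S" by (auto simp: E_def)
    then show "S homeomorphic_space T" using homeomorphic_space_sym by blast
  next
    assume "S homeomorphic_space T"
    then have "S homeomorphic_space U \<longleftrightarrow> T homeomorphic_space U" for U :: "'a topology"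
      using homeomorphic_space_sym homeomorphic_space_trans by blast
    then show "E `` {S} = E `` {T}" using that by (auto simp: E_def)
  qed
  have inj': "inj_on (\<lambda>T. E `` {T}) \<T>"
    using eq \<T> inj by (intro inj_onI) blast
  have sub: "(\<lambda>T. E `` {T}) ` \<T> \<subseteq> ?L // E"
    using \<T> by (auto intro: quotientI)
  show "card \<T> \<le> card (LCH_group_topology_classes G)" if "finite (LCH_group_topology_classes G)"
    using card_inj_on_le[OF inj' sub] that by (simp add: classes)
  assume cover: "\<And>T. T \<in> ?L \<Longrightarrow> \<exists>S\<in>\<T>. T homeomorphic_space S"
  have "?L // E \<subseteq> (\<lambda>T. E `` {T}) ` \<T>"
  proof
    fix c assume "c \<in> ?L // E"
    then obtain T where T: "T \<in> ?L" "c = E `` {T}" by (auto elim: quotientE)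
    then obtain S where "S \<in> \<T>" "T homeomorphic_space S" using cover by blast
    then show "c \<in> (\<lambda>T. E `` {T}) ` \<T>" using eq[of T S] T \<T> by auto
  qed
  then have "?L // E = (\<lambda>T. E `` {T}) ` \<T>" using sub by blast
  then show "card (LCH_group_topology_classes G) = card \<T>"
    using card_image[OF inj'] by (simp add: classes)
qed

text \<open>"At most four" is stated with \<open>finite\<close> because \<open>card\<close> is 0 for
  infinitely many classes; for "precisely four" finiteness is implied.\<close>

theorem corollary2p4:
  fixes p :: nat and I :: "'i set" and J :: "'j set"
  assumes "prime p"
    and "|I| =o cardSuc natLeq"
    and "|J| =o natLeq"
  defines "A \<equiv> sum_group I (\<lambda>_. integer_mod_group p)"
    and "B \<equiv> product_group J (\<lambda>_. integer_mod_group p)"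
  shows
    "(continuum_hypothesis \<longleftrightarrow>
        (\<exists>T. group_topology A T \<and> compact_space T \<and> Hausdorff_space T)) \<and>
     (continuum_hypothesis \<longleftrightarrow>
        (\<exists>T\<in>LCH_group_topologies A. T \<noteq> discrete_topology (carrier A))) \<and>
     (continuum_hypothesis \<longleftrightarrow>
        finite (LCH_group_topology_classes B) \<and> card (LCH_group_topology_classes B) \<le> 4) \<and>
     (continuum_hypothesis \<longleftrightarrow> card (LCH_group_topology_classes B) = 4)"
proof -
  let ?N = "UNIV :: nat set"
  have p: "1 < p" using assms(1) prime_gt_1_nat by blast
  interpret A: elem_abelian A p unfolding A_def by (rule elem_abelian_sum_group[OF assms(1)])
  interpret B: elem_abelian B p unfolding B_def by (rule elem_abelian_product_group[OF assms(1)])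

  have N_lt: "|?N| <o |I|"
    using cardSuc_greater[OF natLeq_Card_order] card_of_nat assms(2)
    by (meson ordIso_ordLess_trans ordIso_symmetric ordLess_ordIso_trans)
  have I_least: "|I| \<le>o |X|" if "|?N| <o |X|" for X :: "'x set"
    using cardSuc_least[OF natLeq_Card_order card_of_Card_order, of X] card_of_nat assms(2) that
    by (meson ordIso_ordLeq_trans ordIso_ordLess_trans ordIso_symmetric)
  have infI: "infinite I"
    using N_lt infinite_iff_card_of_nat ordLess_imp_ordLeq by blast
  have infJ: "infinite J"
    using assms(3) infinite_iff_natLeq_ordLeq ordIso_iff_ordLeq by blast
  have cA: "|carrier A| =o |I|" unfolding A_def by (rule card_of_sum_group[OF assms(1) infI])
  have cB: "|carrier B| =o |Pow ?N|"
  proof -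
    have "|carrier B| =o |Pow J|" using card_of_power_Zp[OF p infJ] B.p_pos by (simp add: B_def carrier_integer_mod_group)
    moreover have "|J| =o |?N|" using assms(3) card_of_nat ordIso_symmetric ordIso_transitive by blast
    ultimately show ?thesis using card_of_Pow_cong ordIso_transitive by blast
  qed
  have I_le: "|I| \<le>o |Pow ?N|" by (rule I_least[OF card_of_Pow])
  \<comment> \<open>Since \<open>|I|\<close> is the successor of the countable cardinal, Cantor's
    theorem gives one inequality outright; only the other carries information.\<close>
  have CH_iff: "continuum_hypothesis \<longleftrightarrow> |Pow ?N| \<le>o |I|"
  proof -
    have "continuum_hypothesis \<longleftrightarrow> |I| =o |Pow ?N|"
      unfolding continuum_hypothesis_def using assms(2) ctwo_cexp_natLeq
      by (meson ordIso_symmetric ordIso_transitive)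
    then show ?thesis using I_le by (simp add: ordIso_iff_ordLeq)
  qed
  have infA: "infinite (carrier A)" using infI cA card_of_ordIso_finite by blast

  have 12: "\<exists>T. group_topology A T \<and> compact_space T \<and> Hausdorff_space T" if CH: continuum_hypothesis
  proof -
    let ?P = "product_group ?N (\<lambda>_. integer_mod_group p)"
    interpret P: elem_abelian ?P p by (rule elem_abelian_product_group[OF assms(1)])
    have IP: "|I| =o |Pow ?N|" using CH CH_iff I_le by (simp add: ordIso_iff_ordLeq)
    have "|Pow ?N| =o |carrier ?P|"
      using ordIso_symmetric[OF card_of_power_Zp[OF p infinite_UNIV_nat]] by simp
    then have "|carrier A| =o |carrier ?P|" by (rule ordIso_transitive[OF ordIso_transitive[OF cA IP]])
    then have "A \<cong> ?P" by (intro elem_abelian_iso[OF A.elem_abelian_axioms P.elem_abelian_axioms infA])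
    then obtain h where h: "h \<in> iso A ?P" unfolding is_iso_def by blast
    have "group_topology ?P (product_topology (\<lambda>_. discrete_topology (carrier (integer_mod_group p))) ?N)"
      by (intro group_topology_product group_topology_discrete group_integer_mod_group)
    then have "group_topology ?P (cantor p ?N)" by simp
    then obtain T where T: "group_topology A T" "T homeomorphic_space cantor p ?N"
      by (rule group_topology_iso[OF h A.is_group P.is_group])
    have "compact_space (cantor p ?N)" "Hausdorff_space (cantor p ?N)"
      by (simp_all add: compact_space_product_topology compact_space_discrete_topology Hausdorff_space_product_topology)
    then show ?thesis
      using T homeomorphic_compact_space homeomorphic_Hausdorff_space by blast
  qed
  have 23: "\<exists>T\<in>LCH_group_topologies A. T \<noteq> discrete_topology (carrier A)"
    if T: "group_topology A T" "compact_space T" "Hausdorff_space T" for T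
  proof -
    have "T \<in> LCH_group_topologies A"
      using T compact_imp_locally_compact_space by (auto simp: LCH_group_topologies_def)
    moreover have "T \<noteq> discrete_topology (carrier A)"
      using T(2) infA compact_space_discrete_topology by auto
    ultimately show ?thesis by blast
  qed
  have 31: continuum_hypothesis if T: "T \<in> LCH_group_topologies A" "T \<noteq> discrete_topology (carrier A)" for T
  proof -
    interpret elem_topology A p T
      by unfold_locales (use T in \<open>simp add: LCH_group_topologies_def\<close>)
    obtain X :: "(('i \<Rightarrow> int) \<Rightarrow> int) set" where X: "infinite X" "|Pow X| \<le>o |carrier A|"
      using nondiscrete_structure T unfolding LCH_group_topologies_def by blast
    \<comment> \<open>As \<open>X\<close> is infinite, the continuum is at most
      \<open>|Pow X|\<close>, which is bounded by \<open>|carrier A|\<close>, that is, by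
      \<open>|I|\<close>.\<close>
    have "|Pow ?N| \<le>o |Pow X|" using X(1) infinite_iff_card_of_nat card_of_Pow_mono by blast
    then show ?thesis
      unfolding CH_iff by (rule ordLeq_transitive[OF _ ordLeq_ordIso_trans[OF X(2) cA]])
  qed

  let ?D = "discrete_topology (carrier B)"
  have D: "?D \<in> LCH_group_topologies B"
    using group_topology_discrete[OF B.is_group]
    by (simp add: LCH_group_topologies_def locally_compact_space_discrete_topology)
  have ex: "\<exists>T\<in>LCH_group_topologies B. T homeomorphic_space cantor_sum p R"
    if "infinite R \<and> |R| \<le>o |carrier B| \<or> (\<exists>r. R = {r})" for R :: "'r set"
    using that by (rule exists_cantor_sum_topology[OF B.elem_abelian_axioms cB])
  have le: "|R| \<le>o |carrier B|" if "|R| \<le>o |Pow ?N|" for R :: "'r set"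
    using that cB ordIso_symmetric ordLeq_ordIso_trans by blast
  obtain T1 where T1: "T1 \<in> LCH_group_topologies B" "T1 homeomorphic_space cantor_sum p {()}"
    using ex[of "{()}"] by blast
  obtain T2 where T2: "T2 \<in> LCH_group_topologies B" "T2 homeomorphic_space cantor_sum p ?N"
    using ex[of ?N] le[OF ordLess_imp_ordLeq[OF card_of_Pow]] infinite_UNIV_nat by blast
  obtain T3 where T3: "T3 \<in> LCH_group_topologies B" "T3 homeomorphic_space cantor_sum p I"
    using ex[of I] le[OF I_le] infI by blast
  obtain T4 where T4: "T4 \<in> LCH_group_topologies B" "T4 homeomorphic_space cantor_sum p (Pow ?N)"
    using ex[of "Pow ?N"] le[OF ordIso_imp_ordLeq[OF card_of_refl]] finite_Pow_iff infinite_UNIV_nat by blast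
  note sym = homeomorphic_space_sym[THEN iffD1]
  have nD: "\<not> T homeomorphic_space ?D" if "T homeomorphic_space cantor_sum p R" "R \<noteq> {}" for T :: "('j \<Rightarrow> int) topology" and R :: "'r set"
    using cantor_sum_not_discrete[OF p that(2)] homeomorphic_space_trans[OF sym[OF that(1)]] by blast
  \<comment> \<open>The comparison is demanded for infinite \<open>R\<close> only: a homeomorphism
    onto a sum over an infinite \<open>R'\<close> already forces \<open>R\<close> to be infinite,
    which disposes of the singleton.\<close>
  have nh: "\<not> S homeomorphic_space T"
    if "S homeomorphic_space cantor_sum p R" "T homeomorphic_space cantor_sum p R'"
      "infinite R'" "infinite R \<Longrightarrow> |R| <o |R'|" for S T :: "('j \<Rightarrow> int) topology" and R :: "'r set" and R' :: "'s set"
  proof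
    assume "S homeomorphic_space T"
    then have "cantor_sum p R homeomorphic_space cantor_sum p R'"
      by (rule homeomorphic_space_trans[OF homeomorphic_space_trans[OF sym[OF that(1)]] that(2)])
    then have "infinite R \<and> |R'| \<le>o |R|" by (rule cantor_sum_homeomorphic_imp[OF p _ that(3)])
    then show False using that(4) not_ordLess_ordLeq by blast
  qed
  have infP: "infinite (Pow ?N)" using finite_Pow_iff infinite_UNIV_nat by blast
  have n12: "\<not> T1 homeomorphic_space T2" by (rule nh[OF T1(2) T2(2)]) (auto simp: infinite_UNIV_nat)
  have n13: "\<not> T1 homeomorphic_space T3" by (rule nh[OF T1(2) T3(2) infI]) simp
  have n14: "\<not> T1 homeomorphic_space T4" by (rule nh[OF T1(2) T4(2) infP]) simp
  have n23: "\<not> T2 homeomorphic_space T3" by (rule nh[OF T2(2) T3(2) infI N_lt])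
  have n24: "\<not> T2 homeomorphic_space T4" by (rule nh[OF T2(2) T4(2) infP card_of_Pow])
  have n1: "\<not> T1 homeomorphic_space ?D" by (rule nD[OF T1(2)]) simp
  have n2: "\<not> T2 homeomorphic_space ?D" by (rule nD[OF T2(2)]) simp
  have n3: "\<not> T3 homeomorphic_space ?D" by (rule nD[OF T3(2)]) (use infI in auto)
  have n4: "\<not> T4 homeomorphic_space ?D" by (rule nD[OF T4(2)]) auto

  have CH4: "card (LCH_group_topology_classes B) = 4" if CH: continuum_hypothesis
  proof -
    have "\<exists>S\<in>{?D, T1, T2, T3}. T homeomorphic_space S" if T: "T \<in> LCH_group_topologies B" for T
    proof (cases "T = ?D")
      case True
      then show ?thesis using homeomorphic_space_refl by blast
    next
      case False
      interpret elem_topology B p T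
        by unfold_locales (use T in \<open>simp add: LCH_group_topologies_def\<close>)
      obtain X :: "(('j \<Rightarrow> int) \<Rightarrow> int) set" and R :: "('j \<Rightarrow> int) set" where XR: "infinite X"
        "T homeomorphic_space prod_topology (cantor p X) (discrete_topology R)"
        "R \<subseteq> carrier B" "infinite R \<or> (\<exists>r. R = {r})" "|Pow X| \<le>o |carrier B|"
        using nondiscrete_structure T False unfolding LCH_group_topologies_def by blast
      have cBI: "|carrier B| \<le>o |I|" using CH unfolding CH_iff by (rule ordIso_ordLeq_trans[OF cB])
      \<comment> \<open>No cardinal lies strictly between the countable one and its
        successor.\<close>
      have dich: "|Y| =o |?N| \<or> |Y| =o |I|" if "infinite Y" "|Y| \<le>o |I|" for Y :: "'y set"
      proof (cases "|Y| \<le>o |?N|")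
        case True
        then show ?thesis using that(1) infinite_iff_card_of_nat ordIso_iff_ordLeq by blast
      next
        case False
        then have "|?N| <o |Y|"
          by (rule not_ordLeq_iff_ordLess[OF card_of_Well_order card_of_Well_order, THEN iffD1])
        then show ?thesis using I_least[of Y] that(2) by (simp add: ordIso_iff_ordLeq)
      qed
      \<comment> \<open>Cantor's theorem and the bound on \<open>|Pow X|\<close> make
        \<open>X\<close> smaller than \<open>I\<close>, hence countable. Only the Cantor set can
        then occur as compact factor.\<close>
      have "|X| <o |I|" by (rule ordLess_ordLeq_trans[OF ordLess_ordLeq_trans[OF card_of_Pow XR(5)] cBI])
      then have "|X| =o |?N|" using dich[OF XR(1)] ordLess_imp_ordLeq not_ordLess_ordIso by blast
      then obtain f where "bij_betw f ?N X" using card_of_ordIso ordIso_symmetric by blast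
      then have "cantor p X homeomorphic_space cantor p ?N" by (rule product_topology_reindex)
      then have TR: "T homeomorphic_space cantor_sum p R"
        unfolding cantor_sum_def
        by (rule homeomorphic_space_trans[OF XR(2) homeomorphic_space_prod_topology[OF _ homeomorphic_space_refl]])
      have to: "T homeomorphic_space S" if "S homeomorphic_space cantor_sum p R'" "|R| =o |R'|"
        for S :: "('j \<Rightarrow> int) topology" and R' :: "'r set"
        by (rule homeomorphic_space_trans[OF homeomorphic_space_trans[OF TR cantor_sum_cong[OF that(2)]] sym[OF that(1)]])
      show ?thesis
      proof (cases "infinite R")
        case True
        have "|R| \<le>o |I|" by (rule ordLeq_transitive[OF card_of_mono1[OF XR(3)] cBI])
        then show ?thesis using dich[OF True] to[OF T2(2)] to[OF T3(2)] by blast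
      next
        case False
        then obtain r where "R = {r}" using XR(4) by blast
        then have "|R| =o |{()}|" by (auto intro!: card_of_ordIsoI[of "\<lambda>_. ()"] simp: bij_betw_def)
        then show ?thesis using to[OF T1(2)] by blast
      qed
    qed
    then have "card (LCH_group_topology_classes B) = card {?D, T1, T2, T3}"
      by (intro card_LCH_group_topology_classes(2))
        (use D T1 T2 T3 n12 n13 n23 n1 n2 n3 sym in blast)+
    also have "\<dots> = 4"
    proof -
      have "distinct [?D, T1, T2, T3]"
        using n12 n13 n23 n1 n2 n3 homeomorphic_space_refl by auto
      from distinct_card[OF this] show ?thesis by simp
    qed
    finally show ?thesis .
  qed
  \<comment> \<open>Without the continuum hypothesis \<open>|I|\<close> lies strictly below the
    continuum, so \<open>T3\<close> and \<open>T4\<close> are no longer homeomorphic and a fifth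
    class appears.\<close>
  have nCH5: "5 \<le> card (LCH_group_topology_classes B)"
    if nCH: "\<not> continuum_hypothesis" and fin: "finite (LCH_group_topology_classes B)"
  proof -
    have "|I| <o |Pow ?N|"
      using nCH not_ordLeq_iff_ordLess[OF card_of_Well_order card_of_Well_order] unfolding CH_iff by blast
    then have n34: "\<not> T3 homeomorphic_space T4" by (rule nh[OF T3(2) T4(2) infP])
    have "card {?D, T1, T2, T3, T4} \<le> card (LCH_group_topology_classes B)"
      by (rule card_LCH_group_topology_classes(1)[OF _ _ fin])
        (use D T1 T2 T3 T4 n12 n13 n14 n23 n24 n34 n1 n2 n3 n4 sym in blast)+
    moreover have "card {?D, T1, T2, T3, T4} = 5"
    proof -
      have "distinct [?D, T1, T2, T3, T4]"
        using n12 n13 n14 n23 n24 n34 n1 n2 n3 n4 homeomorphic_space_refl by auto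
      from distinct_card[OF this] show ?thesis by simp
    qed
    ultimately show ?thesis by simp
  qed
  \<comment> \<open>An infinite set would have \<open>card\<close> equal to 0, not 4.\<close>
  have fin: "finite (LCH_group_topology_classes B)" if "card (LCH_group_topology_classes B) = 4"
    using that by (metis card.infinite zero_neq_numeral)
  show ?thesis
  proof (intro conjI iffI)
    show "\<exists>T. group_topology A T \<and> compact_space T \<and> Hausdorff_space T" if continuum_hypothesis
      using 12[OF that] .
    show "\<exists>T\<in>LCH_group_topologies A. T \<noteq> discrete_topology (carrier A)" if continuum_hypothesis
      using 12[OF that] 23 by blast
    show "finite (LCH_group_topology_classes B)" if continuum_hypothesis using fin[OF CH4[OF that]] .
    show "card (LCH_group_topology_classes B) \<le> 4" if continuum_hypothesis using CH4[OF that] by simp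
    show "card (LCH_group_topology_classes B) = 4" if continuum_hypothesis using CH4[OF that] .
    show continuum_hypothesis if "\<exists>T. group_topology A T \<and> compact_space T \<and> Hausdorff_space T"
      using that 23 31 by blast
    show continuum_hypothesis if "\<exists>T\<in>LCH_group_topologies A. T \<noteq> discrete_topology (carrier A)"
      using that 31 by blast
    show continuum_hypothesis
      if "finite (LCH_group_topology_classes B) \<and> card (LCH_group_topology_classes B) \<le> 4"
      using nCH5 that by fastforce
    show continuum_hypothesis if "card (LCH_group_topology_classes B) = 4"
      using nCH5 fin[OF that] that by fastforce
  qed
qed

end
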